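(* Let $p$ be a prime, let $F$ be a field containing a primitive $p$-th root of unity $\zeta_p$, and let $a,b,c,d\in F^\times$. Consider the assertions: (1) There is a continuous homomorphism $\phi\colon G_F\to\tilde{\mathbb U}_5(\mathbb F_p)$ with $s_1\circ\phi=\chi_a$, $s_2\circ\phi=\chi_b$, $s_3\circ\phi=\chi_c$, $s_4\circ\phi=\chi_d$. (2) There exist $B\in F[\sqrt[p]{a}]$ with $\mathrm N_{F[\sqrt[p]{a}]/F}(B)=bf_1^p$ for some $f_1\in F^\times$, and $C\in F[\sqrt[p]{d}]$ with $\mathrm N_{F[\sqrt[p]{d}]/F}(C)=cf_2^p$ for some $f_2\in F^\times$, such that for every $\sigma\in\mathrm{Gal}(F[\sqrt[p]{a}]/F)$ and every $\tau\in\mathrm{Gal}(F[\sqrt[p]{d}]/F)$ we have $(\sigma(B),\tau(C))_{F[\sqrt[p]{a},\sqrt[p]{d}]}=0$. Then (1) implies (2). Moreover (2) implies (1) if $p=2$, or if the following holds: ($a$ and $b$ are linearly independent in $F^\times/F^{\times p}$, or $a$ is a $p$-th power in $F$) and ($d$ and $c$ are linearly independent in $F^\times/F^{\times p}$, or $d$ is a $p$-th power in $F$).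
   Context: $G_F$ denotes the absolute Galois group of $F$ (Galois group of a separable closure). Since $\zeta_p\in F$, Kummer theory gives $H^1(F,\mathbb F_p)=\mathrm{Hom}_{cont}(G_F,\mathbb F_p)\cong F^\times/F^{\times p}$; $\chi_a$ denotes the character corresponding to $a$, i.e. $\sigma(\sqrt[p]a)=\zeta_p^{\chi_a(\sigma)}\sqrt[p]a$. For a field $K\ni\zeta_p$ and $x,y\in K^\times$, $(x,y)_K=\chi_x\smile\chi_y\in H^2(K,\mathbb F_p)$. Definition of $\tilde{\mathbb U}_5(\mathbb F_p)$: let $\mathbb U_2$ be the group of upper unitriangular $2\times 2$ matrices over $\mathbb F_p$ (cyclic of order $p$), $R=\mathbb F_p[\mathbb U_2]$ its group algebra with $\mathbb U_2$ acting by left multiplication, and $W=R\rtimes\mathbb U_2$ with product $(x,h)(x',h')=(x+hx',hh')$. Let $\tilde G=W\times W$, and $M=R\otimes_{\mathbb F_p}R$ with $g=((x_1,h_1),(x_2,h_2))\in\tilde G$ acting by $g\cdot(r\otimes r')=h_1r\otimes h_2r'$. Then $\tilde{\mathbb U}_5(\mathbb F_p)$ is the set $M\times\tilde G$ with product $(u,g)(u',g')=(u+g\cdot u'+x_1\otimes h_2x_2',\,gg')$, where $g=((x_1,h_1),(x_2,h_2))$, $g'=((x_1',h_1'),(x_2',h_2'))$ (the extension of $\tilde G$ by $M$ with class the cup product of the 1-cocycles $g\mapsto x_1$ and $g\mapsto x_2$). The homomorphisms $s_i\colon\tilde{\mathbb U}_5\to\mathbb F_p$ are: $s_1(u,g)=(h_1)_{12}$,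 $s_2(u,g)=\varepsilon(x_1)$, $s_3(u,g)=\varepsilon(x_2)$, $s_4(u,g)=(h_2)_{12}$, where $\varepsilon\colon R\to\mathbb F_p$ is the augmentation (sum of coefficients). *)

theory Defs
  imports
    "HOL-Analysis.Analysis"
    "HOL-Algebra.Bij"
    "HOL-Algebra.Coset"
    "HOL-Algebra.Algebraic_Closure_Type"
    "Berlekamp_Zassenhaus.Finite_Field"
begin

section \<open>Galois groups inside an ambient field\<close>

text \<open>Fields are subfields (as sets) of one ambient field, which is always
  the algebraic closure of the base field below.\<close>

definition is_subfield :: "'k::field set \<Rightarrow> bool" where
  "is_subfield L \<longleftrightarrow> 0 \<in> L \<and> 1 \<in> L \<and>
     (\<forall>x\<in>L. \<forall>y\<in>L. x + y \<in> L \<and> x * y \<in> L) \<and> (\<forall>x\<in>L. - x \<in> L \<and> inverse x \<in> L)"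

definition adjoin :: "'k::field set \<Rightarrow> 'k set \<Rightarrow> 'k set" where
  "adjoin K S = \<Inter>{L. is_subfield L \<and> K \<subseteq> L \<and> S \<subseteq> L}"

text \<open>The separable closure of \<open>K\<close> in the ambient algebraically closed field:
  the roots of polynomials over \<open>K\<close> without multiple roots.\<close>

definition sep_closure :: "'k::alg_closed_field set \<Rightarrow> 'k set" where
  "sep_closure K = {x. \<exists>q. (\<forall>i. Polynomial.coeff q i \<in> K) \<and> rsquarefree q \<and> poly q x = 0}"

text \<open>The \<open>K\<close>-embeddings of \<open>L\<close> into the ambient field. As \<open>1 \<in> K\<close>, such a map preserves \<open>1\<close>.
  Maps are \<open>undefined\<close> outside \<open>L\<close>, so that each embedding is counted once.\<close>

definition embeddings :: "'k::field set \<Rightarrow> 'k set \<Rightarrow> ('k \<Rightarrow> 'k) set" where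
  "embeddings K L = {\<sigma> \<in> extensional L.
     (\<forall>x\<in>L. \<forall>y\<in>L. \<sigma> (x + y) = \<sigma> x + \<sigma> y \<and> \<sigma> (x * y) = \<sigma> x * \<sigma> y) \<and> (\<forall>x\<in>K. \<sigma> x = x)}"

text \<open>The norm of a finite separable extension \<open>L/K\<close>, as the product of the images under
  the \<open>K\<close>-embeddings of \<open>L\<close> into the algebraic closure.\<close>

definition field_norm :: "'k::alg_closed_field set \<Rightarrow> 'k set \<Rightarrow> 'k \<Rightarrow> 'k" where
  "field_norm K L x = (\<Prod>\<sigma>\<in>embeddings K L. \<sigma> x)"

definition gal_group :: "'k::field set \<Rightarrow> 'k set \<Rightarrow> ('k \<Rightarrow> 'k) monoid" where
  "gal_group K L = BijGroup L \<lparr>carrier := Bij L \<inter> embeddings K L\<rparr>"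

text \<open>The Krull topology: the basic open sets are the cosets \<open>\<sigma> Gal(L/K(S))\<close>,
  \<open>S\<close> a finite subset of \<open>L\<close>.\<close>

definition krull_topology :: "'k::field set \<Rightarrow> 'k set \<Rightarrow> ('k \<Rightarrow> 'k) topology" where
  "krull_topology K L = topology_generated_by
     {{\<tau> \<in> carrier (gal_group K L). \<forall>x\<in>S. \<tau> x = \<sigma> x} | \<sigma> S.
        \<sigma> \<in> carrier (gal_group K L) \<and> finite S \<and> S \<subseteq> L}"

definition abs_gal :: "'k::alg_closed_field set \<Rightarrow> ('k \<Rightarrow> 'k) monoid" where
  "abs_gal K = gal_group K (sep_closure K)"

definition abs_gal_top :: "'k::alg_closed_field set \<Rightarrow> ('k \<Rightarrow> 'k) topology" where
  "abs_gal_top K = krull_topology K (sep_closure K)"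


section \<open>Continuous cohomology in degree two, with trivial coefficients\<close>

text \<open>\<open>G\<close> is a group with topology \<open>T\<close>; the ring \<open>'c\<close> of coefficients is discrete with trivial
  action. Cochains are \<open>undefined\<close> outside \<open>G\<close>, respectively \<open>G \<times> G\<close>.\<close>

definition cochains1 :: "'g monoid \<Rightarrow> 'g topology \<Rightarrow> ('g \<Rightarrow> 'c) set" where
  "cochains1 G T = {f \<in> extensional (carrier G). continuous_map T (discrete_topology UNIV) f}"

definition cochains2 :: "'g monoid \<Rightarrow> 'g topology \<Rightarrow> ('g \<times> 'g \<Rightarrow> 'c) set" where
  "cochains2 G T = {f \<in> extensional (carrier G \<times> carrier G).
     continuous_map (prod_topology T T) (discrete_topology UNIV) f}"

definition coboundary1 :: "'g monoid \<Rightarrow> ('g \<Rightarrow> 'c::comm_ring_1) \<Rightarrow> 'g \<times> 'g \<Rightarrow> 'c" where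
  "coboundary1 G f = (\<lambda>(s, t)\<in>carrier G \<times> carrier G. f t - f (s \<otimes>\<^bsub>G\<^esub> t) + f s)"

definition cocycles2 :: "'g monoid \<Rightarrow> 'g topology \<Rightarrow> ('g \<times> 'g \<Rightarrow> 'c::comm_ring_1) monoid" where
  "cocycles2 G T =
     \<lparr>carrier = {f \<in> cochains2 G T. \<forall>r\<in>carrier G. \<forall>s\<in>carrier G. \<forall>t\<in>carrier G.
        f (s, t) - f (r \<otimes>\<^bsub>G\<^esub> s, t) + f (r, s \<otimes>\<^bsub>G\<^esub> t) - f (r, s) = 0},
      mult = (\<lambda>f g. \<lambda>x\<in>carrier G \<times> carrier G. f x + g x),
      one = (\<lambda>x\<in>carrier G \<times> carrier G. 0)\<rparr>"

definition coboundaries2 :: "'g monoid \<Rightarrow> 'g topology \<Rightarrow> ('g \<times> 'g \<Rightarrow> 'c::comm_ring_1) set" where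
  "coboundaries2 G T = coboundary1 G ` cochains1 G T"

definition H2 :: "'g monoid \<Rightarrow> 'g topology \<Rightarrow> ('g \<times> 'g \<Rightarrow> 'c::comm_ring_1) set monoid" where
  "H2 G T = cocycles2 G T Mod coboundaries2 G T"

definition cup11 ::
  "'g monoid \<Rightarrow> 'g topology \<Rightarrow> ('g \<Rightarrow> 'c::comm_ring_1) \<Rightarrow> ('g \<Rightarrow> 'c) \<Rightarrow> ('g \<times> 'g \<Rightarrow> 'c) set" where
  "cup11 G T f g =
     coboundaries2 G T #>\<^bsub>cocycles2 G T\<^esub> (\<lambda>(s, t)\<in>carrier G \<times> carrier G. f s * g t)"


section \<open>Kummer characters and symbols\<close>

definition primitive_root :: "nat \<Rightarrow> 'k::field \<Rightarrow> bool" where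
  "primitive_root n z \<longleftrightarrow> z ^ n = 1 \<and> (\<forall>k. 0 < k \<and> k < n \<longrightarrow> z ^ k \<noteq> 1)"

definition proot :: "nat \<Rightarrow> 'k::alg_closed_field \<Rightarrow> 'k" where
  "proot n x = (SOME r. r ^ n = x)"

text \<open>\<open>'p mod_ring\<close> is the field of \<open>p\<close> elements, where \<open>p = CARD('p)\<close>.\<close>

definition kummer_char ::
  "'k::alg_closed_field \<Rightarrow> 'k \<Rightarrow> ('k \<Rightarrow> 'k) \<Rightarrow> 'p::prime_card mod_ring" where
  "kummer_char \<zeta> x \<sigma> =
     (THE i. \<sigma> (proot CARD('p) x) = \<zeta> ^ nat (to_int_mod_ring i) * proot CARD('p) x)"

definition H2_field :: "'p::prime_card itself \<Rightarrow> 'k::alg_closed_field set \<Rightarrow>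
    (('k \<Rightarrow> 'k) \<times> ('k \<Rightarrow> 'k) \<Rightarrow> 'p mod_ring) set monoid" where
  "H2_field _ K = H2 (abs_gal K) (abs_gal_top K)"

definition symbol :: "'p::prime_card itself \<Rightarrow> 'k::alg_closed_field \<Rightarrow> 'k set \<Rightarrow> 'k \<Rightarrow> 'k \<Rightarrow>
    (('k \<Rightarrow> 'k) \<times> ('k \<Rightarrow> 'k) \<Rightarrow> 'p mod_ring) set" where
  "symbol _ \<zeta> K x y = cup11 (abs_gal K) (abs_gal_top K) (kummer_char \<zeta> x) (kummer_char \<zeta> y)"

text \<open>Linear independence of the pair \<open>(a, b)\<close> in the vector space of \<open>n\<close>-th power classes
  over the field of \<open>n\<close> elements (\<open>n\<close> prime), written multiplicatively.\<close>

definition indep_classes :: "nat \<Rightarrow> 'a::field \<Rightarrow> 'a \<Rightarrow> bool" where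
  "indep_classes n a b \<longleftrightarrow>
     (\<forall>i j. (\<exists>f. f \<noteq> 0 \<and> a powi i * b powi j = f ^ n) \<longrightarrow> int n dvd i \<and> int n dvd j)"


section \<open>The group \<open>U\<^sub>5\<close>-tilde\<close>

text \<open>A unitriangular \<open>2 \<times> 2\<close> matrix is recorded by its \<open>(1,2)\<close> entry, so that multiplication
  in \<open>U\<^sub>2\<close> is addition. An element of the group algebra \<open>R\<close> is its coefficient function, and
  \<open>R \<otimes> R\<close> is the space of functions on \<open>U\<^sub>2 \<times> U\<^sub>2\<close>, the basis element \<open>g \<otimes> g'\<close>
  corresponding to the indicator function of \<open>(g, g')\<close>.\<close>

type_synonym 'p U2 = "'p mod_ring"
type_synonym 'p R = "'p U2 \<Rightarrow> 'p mod_ring"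
type_synonym 'p W = "'p R \<times> 'p U2"
type_synonym 'p M = "'p U2 \<times> 'p U2 \<Rightarrow> 'p mod_ring"
type_synonym 'p U5 = "'p M \<times> ('p W \<times> 'p W)"

definition R_act :: "'p::prime_card U2 \<Rightarrow> 'p R \<Rightarrow> 'p R" where
  "R_act h r = (\<lambda>k. r (k - h))"

definition R_tensor :: "'p::prime_card R \<Rightarrow> 'p R \<Rightarrow> 'p M" where
  "R_tensor r r' = (\<lambda>(k, k'). r k * r' k')"

definition R_aug :: "'p::prime_card R \<Rightarrow> 'p mod_ring" where
  "R_aug r = (\<Sum>k\<in>UNIV. r k)"

definition W_mult :: "'p::prime_card W \<Rightarrow> 'p W \<Rightarrow> 'p W" where
  "W_mult = (\<lambda>(x, h) (x', h'). (\<lambda>k. x k + R_act h x' k, h + h'))"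

text \<open>The linear extension of \<open>r \<otimes> r' \<mapsto> h\<^sub>1 r \<otimes> h\<^sub>2 r'\<close>.\<close>

definition M_act :: "'p::prime_card W \<times> 'p W \<Rightarrow> 'p M \<Rightarrow> 'p M" where
  "M_act = (\<lambda>((x1, h1), (x2, h2)) u. \<lambda>(k, k'). u (k - h1, k' - h2))"

lemma M_act_tensor:
  "M_act ((x1, h1), (x2, h2)) (R_tensor r r') = R_tensor (R_act h1 r) (R_act h2 r')"
  by (auto simp: M_act_def R_tensor_def R_act_def)

definition U5_mult :: "'p::prime_card U5 \<Rightarrow> 'p U5 \<Rightarrow> 'p U5" where
  "U5_mult = (\<lambda>(u, ((x1, h1), (x2, h2))) (u', ((x1', h1'), (x2', h2'))).
     (\<lambda>k. u k + M_act ((x1, h1), (x2, h2)) u' k + R_tensor x1 (R_act h2 x2') k,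
      (W_mult (x1, h1) (x1', h1'), W_mult (x2, h2) (x2', h2'))))"

definition U5_tilde :: "'p::prime_card U5 monoid" where
  "U5_tilde = \<lparr>carrier = UNIV, mult = U5_mult,
     one = (\<lambda>_. 0, ((\<lambda>_. 0, 0), (\<lambda>_. 0, 0)))\<rparr>"

lemma group_U5_tilde: "group (U5_tilde :: 'p::prime_card U5 monoid)"
proof (rule groupI)
  fix x y z :: "'p U5"
  show "x \<otimes>\<^bsub>U5_tilde\<^esub> y \<otimes>\<^bsub>U5_tilde\<^esub> z = x \<otimes>\<^bsub>U5_tilde\<^esub> (y \<otimes>\<^bsub>U5_tilde\<^esub> z)"
    by (auto simp: U5_tilde_def U5_mult_def W_mult_def M_act_def R_tensor_def R_act_def
        fun_eq_iff algebra_simps split: prod.splits)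
  show "\<one>\<^bsub>U5_tilde\<^esub> \<otimes>\<^bsub>U5_tilde\<^esub> x = x"
    by (auto simp: U5_tilde_def U5_mult_def W_mult_def M_act_def R_tensor_def R_act_def
        split: prod.splits)
  obtain u x1 h1 x2 h2 where x: "x = (u, ((x1, h1), (x2, h2)))"
    by (metis surj_pair)
  define v :: "'p U5" where "v = (\<lambda>(k, k'). - u (k + h1, k' + h2) + x1 (k + h1) * x2 (k' + h2),
      ((\<lambda>k. - x1 (k + h1), - h1), (\<lambda>k. - x2 (k + h2), - h2)))"
  have "v \<otimes>\<^bsub>U5_tilde\<^esub> x = \<one>\<^bsub>U5_tilde\<^esub>"
    by (auto simp: v_def x U5_tilde_def U5_mult_def W_mult_def M_act_def R_tensor_def R_act_def
        fun_eq_iff)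
  thus "\<exists>y\<in>carrier U5_tilde. y \<otimes>\<^bsub>U5_tilde\<^esub> x = \<one>\<^bsub>U5_tilde\<^esub>"
    by (rule bexI[of _ v]) (simp add: U5_tilde_def)
qed (auto simp: U5_tilde_def)

definition s1 :: "'p::prime_card U5 \<Rightarrow> 'p mod_ring" where
  "s1 = (\<lambda>(u, ((x1, h1), (x2, h2))). h1)"

definition s2 :: "'p::prime_card U5 \<Rightarrow> 'p mod_ring" where
  "s2 = (\<lambda>(u, ((x1, h1), (x2, h2))). R_aug x1)"

definition s3 :: "'p::prime_card U5 \<Rightarrow> 'p mod_ring" where
  "s3 = (\<lambda>(u, ((x1, h1), (x2, h2))). R_aug x2)"

definition s4 :: "'p::prime_card U5 \<Rightarrow> 'p mod_ring" where
  "s4 = (\<lambda>(u, ((x1, h1), (x2, h2))). h2)"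


section \<open>The two assertions\<close>

text \<open>\<open>range to_ac\<close> is the copy of the field \<open>'a\<close> in its algebraic closure.\<close>

definition lifts_to_U5 ::
  "'p::prime_card itself \<Rightarrow> 'a::field \<Rightarrow> 'a \<Rightarrow> 'a \<Rightarrow> 'a \<Rightarrow> 'a \<Rightarrow> bool" where
  "lifts_to_U5 _ \<zeta> a b c d \<longleftrightarrow>
     (let F = range (to_ac :: 'a \<Rightarrow> 'a alg_closure);
          chr = (\<lambda>x. kummer_char (to_ac \<zeta>) (to_ac x) :: _ \<Rightarrow> 'p mod_ring)
      in \<exists>\<phi> \<in> hom (abs_gal F) (U5_tilde :: 'p U5 monoid).
           continuous_map (abs_gal_top F) (discrete_topology UNIV) \<phi> \<and>
           (\<forall>\<sigma>\<in>carrier (abs_gal F).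
              s1 (\<phi> \<sigma>) = chr a \<sigma> \<and> s2 (\<phi> \<sigma>) = chr b \<sigma> \<and> s3 (\<phi> \<sigma>) = chr c \<sigma> \<and> s4 (\<phi> \<sigma>) = chr d \<sigma>))"

definition norm_symbol_condition ::
  "'p::prime_card itself \<Rightarrow> 'a::field \<Rightarrow> 'a \<Rightarrow> 'a \<Rightarrow> 'a \<Rightarrow> 'a \<Rightarrow> bool" where
  "norm_symbol_condition _ \<zeta> a b c d \<longleftrightarrow>
     (let F = range (to_ac :: 'a \<Rightarrow> 'a alg_closure);
          p = CARD('p);
          ra = proot p (to_ac a);
          rd = proot p (to_ac d);
          Fa = adjoin F {ra};
          Fd = adjoin F {rd};
          Fad = adjoin F {ra, rd}
      in \<exists>B\<in>Fa. \<exists>C\<in>Fd.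
           (\<exists>f1. f1 \<noteq> 0 \<and> field_norm F Fa B = to_ac (b * f1 ^ p)) \<and>
           (\<exists>f2. f2 \<noteq> 0 \<and> field_norm F Fd C = to_ac (c * f2 ^ p)) \<and>
           (\<forall>\<sigma>\<in>carrier (gal_group F Fa). \<forall>\<tau>\<in>carrier (gal_group F Fd).
              symbol TYPE('p) (to_ac \<zeta>) Fad (\<sigma> B) (\<tau> C) = \<one>\<^bsub>H2_field TYPE('p) Fad\<^esub>))"

end

theory Submission
  imports Defs
begin

text \<open>A homomorphism to \<open>U\<^sub>5\<close>-tilde over \<open>(\<chi>\<^sub>a, \<chi>\<^sub>d)\<close> is a pair of cocycles \<open>x\<^sub>1, x\<^sub>2\<close> with values in the
  group algebra \<open>R\<close>, the Galois group acting through \<open>\<chi>\<^sub>a\<close> and \<open>\<chi>\<^sub>d\<close>, together with a trivialisation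
  of their cup product in \<open>R \<otimes> R\<close>. If \<open>a\<close> is not a \<open>p\<close>-th power then \<open>R\<close> is induced from
  \<open>F[a\<^bsup>1/p\<^esup>]\<close>, so that \<open>x\<^sub>1\<close> amounts to a class \<open>B\<close> in \<open>F[a\<^bsup>1/p\<^esup>]\<close> whose norm is, up to \<open>p\<close>-th powers,
  given by the augmentation of \<open>x\<^sub>1\<close>; otherwise \<open>x\<^sub>1\<close> is a family of \<open>p\<close> elements of \<open>F\<close> and \<open>B\<close> is their
  product. By Shapiro's lemma the cup product in \<open>R \<otimes> R\<close> vanishes if and only if its components
  \<open>(\<sigma>(B), \<tau>(C))\<close> do, as \<open>\<sigma>\<close> and \<open>\<tau>\<close> vary.

  All of this is done on cochains for the group of ring automorphisms of the whole algebraic closure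
  that fix \<open>F\<close>, whose restriction to the separable closure is onto the absolute Galois group.\<close>

hide_const (open) Polynomials.lead_coeff Polynomials.degree Coset.order

section \<open>Automorphisms of an algebraically closed algebraic extension\<close>

text \<open>Both directions rest on one dictionary. Writing a cocycle as \<sigma>(\<beta>_{k -
  h(\<sigma>)}) = \<zeta>^{x_\<sigma>(k)} \<beta>_k, with h the character of a, the p-th powers B_k
  of the \<beta>_k are permuted by G_F through h. If h is onto they are the conjugates of B = B_0
  and their product is its norm, and where h vanishes the k-th coordinate of x is the Kummer
  character of B_k. If h is trivial the coordinates are unrelated; conversely B is then put into one
  coordinate and 1 into the others. The obstacle is that the image of (\<chi>_a, \<chi>_d) in F_p x
  F_p can be any subgroup. If it is a line, the \<sigma> and \<tau> of the symbol condition are in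
  general not induced by one automorphism, and R \<otimes> R is a sum of several induced modules.
  Shapiro's lemma is therefore proved for arbitrary orbits, from a trivialisation at every point (k,
  l); letting \<sigma> and \<tau> vary independently is what supplies all of these.\<close>

definition poly_over :: "'k::field set \<Rightarrow> 'k poly \<Rightarrow> bool" where
  "poly_over L f \<longleftrightarrow> (\<forall>i. poly.coeff f i \<in> L)"

definition auts :: "'k::field set \<Rightarrow> ('k \<Rightarrow> 'k) set" where
  "auts F = {\<sigma>. (\<forall>x y. \<sigma> (x + y) = \<sigma> x + \<sigma> y \<and> \<sigma> (x * y) = \<sigma> x * \<sigma> y) \<and> (\<forall>c\<in>F. \<sigma> c = c)}"

text \<open>Partial embeddings are handled as their graphs, which are subrings of \<open>'k \<times> 'k\<close>; for these,
  being single-valued means having trivial intersection with \<open>{0} \<times> 'k\<close>. Polynomials over the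
  domain and their images then become pairs of polynomials, with no coefficientwise map.\<close>

definition ring_graph :: "'k::field set \<Rightarrow> ('k \<times> 'k) set \<Rightarrow> bool" where
  "ring_graph F \<Gamma> \<longleftrightarrow> (\<forall>c\<in>F. (c, c) \<in> \<Gamma>) \<and>
     (\<forall>x x' y y'. (x, x') \<in> \<Gamma> \<longrightarrow> (y, y') \<in> \<Gamma> \<longrightarrow> (x + y, x' + y') \<in> \<Gamma> \<and> (x * y, x' * y') \<in> \<Gamma>) \<and>
     (\<forall>y. (0, y) \<in> \<Gamma> \<longrightarrow> y = 0)"

definition poly_pair :: "('k::field \<times> 'k) set \<Rightarrow> 'k poly \<Rightarrow> 'k poly \<Rightarrow> bool" where
  "poly_pair \<Gamma> f f' \<longleftrightarrow> (\<forall>i. (poly.coeff f i, poly.coeff f' i) \<in> \<Gamma>)"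

lemma ring_graphI:
  assumes "\<And>c. c \<in> F \<Longrightarrow> (c, c) \<in> \<Gamma>" "\<And>y. (0, y) \<in> \<Gamma> \<Longrightarrow> y = 0"
    "\<And>x x' y y'. (x, x') \<in> \<Gamma> \<Longrightarrow> (y, y') \<in> \<Gamma> \<Longrightarrow> (x + y, x' + y') \<in> \<Gamma>"
    "\<And>x x' y y'. (x, x') \<in> \<Gamma> \<Longrightarrow> (y, y') \<in> \<Gamma> \<Longrightarrow> (x * y, x' * y') \<in> \<Gamma>"
  shows "ring_graph F \<Gamma>"
  unfolding ring_graph_def using assms by simp

lemma subfield_closed:
  assumes "is_subfield L"
  shows "0 \<in> L" "1 \<in> L" "x \<in> L \<Longrightarrow> y \<in> L \<Longrightarrow> x + y \<in> L" "x \<in> L \<Longrightarrow> y \<in> L \<Longrightarrow> x * y \<in> L"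
    "x \<in> L \<Longrightarrow> - x \<in> L" "x \<in> L \<Longrightarrow> inverse x \<in> L"
  using assms by (auto simp: is_subfield_def)

lemma subfield_closed':
  assumes "is_subfield L"
  shows "x \<in> L \<Longrightarrow> y \<in> L \<Longrightarrow> x - y \<in> L" "x \<in> L \<Longrightarrow> y \<in> L \<Longrightarrow> x / y \<in> L" "x \<in> L \<Longrightarrow> x ^ n \<in> L"
proof -
  note c = subfield_closed[OF assms]
  show "x - y \<in> L" if "x \<in> L" "y \<in> L"
    using c(3)[OF that(1) c(5)[OF that(2)]] by simp
  show "x / y \<in> L" if "x \<in> L" "y \<in> L"
    using c(4)[OF that(1) c(6)[OF that(2)]] by (simp add: divide_inverse)
  show "x ^ n \<in> L" if "x \<in> L"
    by (induction n) (auto intro: c that)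
qed

lemma subfield_sum:
  assumes "is_subfield L" "\<And>i. i \<in> A \<Longrightarrow> f i \<in> L"
  shows "sum f A \<in> L"
  using assms(2) by (induction A rule: infinite_finite_induct) (auto intro: subfield_closed[OF assms(1)])

lemma subfield_prod:
  assumes "is_subfield L" "\<And>i. i \<in> A \<Longrightarrow> f i \<in> L"
  shows "prod f A \<in> L"
  using assms(2) by (induction A rule: infinite_finite_induct) (auto intro: subfield_closed[OF assms(1)])

lemma adjoin_subfield: "is_subfield (adjoin K A)"
  by (auto simp: adjoin_def is_subfield_def)

lemma adjoin_base: "K \<subseteq> adjoin K A" and adjoin_gens: "A \<subseteq> adjoin K A"
  by (auto simp: adjoin_def)

lemma adjoin_least: "is_subfield L \<Longrightarrow> K \<subseteq> L \<Longrightarrow> A \<subseteq> L \<Longrightarrow> adjoin K A \<subseteq> L"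
  by (auto simp: adjoin_def)

context
  fixes F :: "'k::field set" and \<Gamma> :: "('k \<times> 'k) set"
  assumes F: "is_subfield F" and \<Gamma>: "ring_graph F \<Gamma>"
begin

lemma graph_base: "c \<in> F \<Longrightarrow> (c, c) \<in> \<Gamma>"
  using \<Gamma> by (simp add: ring_graph_def)

lemma graph_add: "(x, x') \<in> \<Gamma> \<Longrightarrow> (y, y') \<in> \<Gamma> \<Longrightarrow> (x + y, x' + y') \<in> \<Gamma>"
  and graph_mult: "(x, x') \<in> \<Gamma> \<Longrightarrow> (y, y') \<in> \<Gamma> \<Longrightarrow> (x * y, x' * y') \<in> \<Gamma>"
  using \<Gamma> by (auto simp: ring_graph_def)

lemma graph_zero: "(0, y) \<in> \<Gamma> \<longleftrightarrow> y = 0"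
  using \<Gamma> subfield_closed(1)[OF F] by (auto simp: ring_graph_def)

lemma graph_diff: "(x, x') \<in> \<Gamma> \<Longrightarrow> (y, y') \<in> \<Gamma> \<Longrightarrow> (x - y, x' - y') \<in> \<Gamma>"
  using graph_add[of x x' "(-1) * y" "(-1) * y'"] graph_mult[of "-1" "-1" y y']
    graph_base[of "-1"] subfield_closed(2,5)[OF F] by simp

lemma graph_unique: "(x, y) \<in> \<Gamma> \<Longrightarrow> (x, z) \<in> \<Gamma> \<Longrightarrow> y = z"
  using graph_diff[of x y x z] by (simp add: graph_zero)

lemma graph_sum: "(\<And>i. i \<in> A \<Longrightarrow> (f i, f' i) \<in> \<Gamma>) \<Longrightarrow> (sum f A, sum f' A) \<in> \<Gamma>"
  by (induction A rule: infinite_finite_induct) (auto intro: graph_add simp: graph_zero)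

lemma poly_pair_zero: "poly_pair \<Gamma> 0 f' \<longleftrightarrow> f' = 0"
  by (auto simp: poly_pair_def graph_zero poly_eq_iff)

lemma poly_pair_mult: "poly_pair \<Gamma> f f' \<Longrightarrow> poly_pair \<Gamma> g g' \<Longrightarrow> poly_pair \<Gamma> (f * g) (f' * g')"
  unfolding poly_pair_def coeff_mult by (intro allI graph_sum graph_mult) auto

lemma poly_pair_add: "poly_pair \<Gamma> f f' \<Longrightarrow> poly_pair \<Gamma> g g' \<Longrightarrow> poly_pair \<Gamma> (f + g) (f' + g')"
  and poly_pair_diff: "poly_pair \<Gamma> f f' \<Longrightarrow> poly_pair \<Gamma> g g' \<Longrightarrow> poly_pair \<Gamma> (f - g) (f' - g')"
  unfolding poly_pair_def by (auto intro: graph_add graph_diff)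

lemma poly_pair_monom: "(a, a') \<in> \<Gamma> \<Longrightarrow> poly_pair \<Gamma> (Polynomial.monom a k) (Polynomial.monom a' k)"
  by (auto simp: poly_pair_def graph_zero)

lemma poly_pair_const: "(a, a') \<in> \<Gamma> \<Longrightarrow> poly_pair \<Gamma> [:a:] [:a':]"
  using poly_pair_monom[of a a' 0] by (simp add: monom_0)

lemma poly_pair_Id: "poly_over F f \<Longrightarrow> poly_pair \<Gamma> f f"
  by (auto simp: poly_over_def poly_pair_def graph_base)

lemma poly_pair_eval: "poly_pair \<Gamma> f f' \<Longrightarrow> (x, x') \<in> \<Gamma> \<Longrightarrow> (poly f x, poly f' x') \<in> \<Gamma>"
proof (induction f arbitrary: f')
  case 0
  thus ?case by (simp add: poly_pair_zero graph_zero)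
next
  case (pCons a g)
  obtain a' g' where f': "f' = pCons a' g'" by (cases f')
  have "(a, a') \<in> \<Gamma>"
    using pCons.prems(1) unfolding poly_pair_def f' by (metis coeff_pCons_0)
  moreover have "poly_pair \<Gamma> g g'"
    using pCons.prems(1) unfolding poly_pair_def f' by (metis coeff_pCons_Suc)
  ultimately show ?case
    using pCons.IH pCons.prems(2) f' by (auto intro: graph_add graph_mult)
qed

text \<open>Long division by the monic \<open>m\<close> is driven by the first components, and the
  second components copy each step with the paired coefficients; the degree bound is therefore on
  \<open>r\<close> only.\<close>

lemma poly_pair_division:
  assumes m: "poly_pair \<Gamma> m m'" "lead_coeff m = 1" "degree m > 0"
  shows "poly_pair \<Gamma> f f' \<Longrightarrow> \<exists>g g' r r'. poly_pair \<Gamma> g g' \<and> poly_pair \<Gamma> r r' \<and>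
           f = g * m + r \<and> f' = g' * m' + r' \<and> degree r < degree m"
proof (induction "degree f" arbitrary: f f' rule: less_induct)
  case less
  show ?case
  proof (cases "degree f < degree m")
    case True
    thus ?thesis
      using less.prems by (intro exI[of _ 0] exI[of _ f] exI[of _ f']) (auto simp: poly_pair_zero)
  next
    case False
    define a a' k where "a = lead_coeff f" and "a' = poly.coeff f' (degree f)"
      and "k = degree f - degree m"
    have "(a, a') \<in> \<Gamma>" using less.prems by (simp add: a_def a'_def poly_pair_def)
    hence q: "poly_pair \<Gamma> (Polynomial.monom a k) (Polynomial.monom a' k)" by (rule poly_pair_monom)
    let ?f = "f - Polynomial.monom a k * m" and ?f' = "f' - Polynomial.monom a' k * m'"
    have p: "poly_pair \<Gamma> ?f ?f'"
      using poly_pair_diff[OF less.prems poly_pair_mult[OF q m(1)]] .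
    have "degree (Polynomial.monom a k * m) \<le> degree f"
      using degree_mult_le[of "Polynomial.monom a k" m] degree_monom_le[of a k] False k_def
      by linarith
    hence "degree ?f \<le> degree f" by (intro degree_diff_le) auto
    moreover have "poly.coeff ?f (degree f) = 0"
      using False m(2) by (simp add: coeff_monom_mult a_def k_def)
    ultimately have "degree ?f < degree f"
      using False m(3) by (metis degree_0 leading_coeff_0_iff linorder_not_less nat_less_le order.strict_trans2)
    from less.hyps[OF this p] obtain g g' r r' where
      "poly_pair \<Gamma> g g'" "poly_pair \<Gamma> r r'" "?f = g * m + r" "?f' = g' * m' + r'" "degree r < degree m"
      by blast
    moreover from this(3,4) have "f = (Polynomial.monom a k + g) * m + r"
      "f' = (Polynomial.monom a' k + g') * m' + r'"
      by (simp_all add: algebra_simps)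
    ultimately show ?thesis using poly_pair_add[OF q] by metis
  qed
qed

end

section \<open>Extending partial embeddings to automorphisms\<close>

locale alg_over =
  fixes F :: "'k::alg_closed_field set"
  assumes subfield: "is_subfield F"
    and algebraic: "\<exists>q. q \<noteq> 0 \<and> poly_over F q \<and> poly q x = 0"
begin

lemma algebraic_coeff0:
  assumes "x \<noteq> 0"
  shows "\<exists>q. poly.coeff q 0 \<noteq> 0 \<and> poly_over F q \<and> poly q x = 0"
proof -
  obtain q where q: "q \<noteq> 0" "poly_over F q" "poly q x = 0" using algebraic by blast
  thus ?thesis
  proof (induction q)
    case 0
    thus ?case by simp
  next
    case (pCons a q)
    show ?case
    proof (cases "a = 0")
      case True
      have "poly_over F q" using pCons.prems(2) unfolding poly_over_def by (metis coeff_pCons_Suc)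
      moreover have "poly q x = 0" "q \<noteq> 0" using pCons.prems True assms by auto
      ultimately show ?thesis using pCons.IH by blast
    next
      case False
      thus ?thesis using pCons.prems by (intro exI[of _ "pCons a q"]) simp
    qed
  qed
qed

text \<open>Writing an equation of \<open>x\<close> as a + x q'(x) = 0 with a \<noteq> 0 gives 1/x =
  -q'(x)/a.\<close>

lemma inverse_poly:
  assumes "x \<noteq> 0"
  obtains r where "poly_over F r" "inverse x = poly r x"
proof -
  obtain q where q: "poly.coeff q 0 \<noteq> 0" "poly_over F q" "poly q x = 0"
    using algebraic_coeff0[OF assms] by blast
  obtain a q' where q': "q = pCons a q'" by (cases q)
  have a: "a \<noteq> 0" "a \<in> F" using q(1,2) unfolding poly_over_def q' by (auto dest: spec[of _ 0])
  have "poly_over F q'" using q(2) unfolding poly_over_def q' by (metis coeff_pCons_Suc)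
  hence "poly_over F ([:- inverse a:] * q')"
    using a subfield_closed[OF subfield] by (auto simp: poly_over_def)
  moreover have "x * poly q' x = - a" using q(3) q' by (simp add: add_eq_0_iff)
  hence "inverse x = poly ([:- inverse a:] * q') x"
    using assms a by (simp add: field_simps)
  ultimately show thesis using that by blast
qed

text \<open>The inverse of \<open>x\<close> is a polynomial in \<open>x\<close> over
  \<open>F\<close>, and ring graphs respect such polynomials. This is why \<open>ring_graph\<close>
  asks for sums and products only.\<close>

lemma graph_inverse:
  assumes "ring_graph F \<Gamma>" "(x, x') \<in> \<Gamma>"
  shows "(inverse x, inverse x') \<in> \<Gamma>"
proof (cases "x = 0")
  case True
  thus ?thesis using assms graph_zero[OF subfield assms(1)] by auto
next
  case False
  obtain r where r: "poly_over F r" "inverse x = poly r x" using inverse_poly[OF False] by blast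
  have p: "(poly r x, poly r x') \<in> \<Gamma>"
    using poly_pair_eval[OF subfield assms(1) poly_pair_Id[OF subfield assms(1) r(1)] assms(2)] .
  have "(x * poly r x, x' * poly r x') \<in> \<Gamma>"
    using graph_mult[OF subfield assms(1) assms(2) p] .
  moreover have "x * poly r x = 1" using r(2) False by (metis right_inverse)
  ultimately have "(1, x' * poly r x') \<in> \<Gamma>" by simp
  moreover have "(1, 1) \<in> \<Gamma>"
    using graph_base[OF subfield assms(1)] subfield_closed(2)[OF subfield] by simp
  ultimately have "x' * poly r x' = 1" using graph_unique[OF subfield assms(1)] by blast
  hence "inverse x' = poly r x'" by (rule inverse_unique)
  thus ?thesis using p r(2) by simp
qed

lemma ring_graph_Id:
  assumes "is_subfield L" "F \<subseteq> L"
  shows "ring_graph F (Id_on L)"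
  using assms by (auto simp: ring_graph_def is_subfield_def Id_on_iff)

text \<open>A ring between \<open>F\<close> and an algebraic extension is a field: inverses come
  from \<open>graph_inverse\<close> for the diagonal of \<open>L\<close>.\<close>

lemma subfieldI:
  assumes "F \<subseteq> L" "\<And>x y. x \<in> L \<Longrightarrow> y \<in> L \<Longrightarrow> x + y \<in> L" "\<And>x y. x \<in> L \<Longrightarrow> y \<in> L \<Longrightarrow> x * y \<in> L"
  shows "is_subfield L"
proof -
  have "ring_graph F (Id_on L)"
    using assms subfield_closed(1)[OF subfield] by (auto simp: ring_graph_def Id_on_iff)
  hence "inverse x \<in> L" if "x \<in> L" for x
    using graph_inverse[of "Id_on L" x x] that by (auto simp: Id_on_iff)
  moreover have "- x \<in> L" if "x \<in> L" for x
    using assms(3)[of "-1" x] that assms(1) subfield_closed(2,5)[OF subfield] by auto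
  ultimately show ?thesis
    using assms subfield_closed(1,2)[OF subfield] by (auto simp: is_subfield_def)
qed

text \<open>\<open>m\<close> is the minimal polynomial of \<open>x\<close> over the domain of
  \<open>\<Gamma>\<close>, and \<open>m'\<close> is its image under the partial embedding. If
  \<open>\<Gamma>\<close> is the diagonal of a field, this is the ordinary minimal
  polynomial.\<close>

lemma min_poly_pair:
  assumes \<Gamma>: "ring_graph F \<Gamma>"
  obtains m m' where "poly_pair \<Gamma> m m'" "lead_coeff m = 1" "poly m x = 0" "degree m > 0"
    "lead_coeff m' = 1" "degree m' = degree m"
    "\<And>r r'. poly_pair \<Gamma> r r' \<Longrightarrow> degree r < degree m \<Longrightarrow> poly r x = 0 \<Longrightarrow> r = 0"
    "\<And>f f'. poly_pair \<Gamma> f f' \<Longrightarrow> poly f x = 0 \<Longrightarrow>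
       \<exists>g g'. poly_pair \<Gamma> g g' \<and> f = g * m \<and> f' = g' * m'"
proof -
  note s = subfield \<Gamma>
  let ?P = "\<lambda>(q, q'). q \<noteq> 0 \<and> poly_pair \<Gamma> q q' \<and> poly q x = 0"
  obtain q where "q \<noteq> 0" "poly_over F q" "poly q x = 0" using algebraic by blast
  hence "?P (q, q)" using poly_pair_Id[OF s] by simp
  then obtain z where z: "?P z" "\<And>y. ?P y \<Longrightarrow> degree (fst z) \<le> degree (fst y)"
    using exists_least_iff[of "\<lambda>n. \<exists>y. ?P y \<and> degree (fst y) = n"]
    by (metis (no_types, lifting) linorder_not_le)
  obtain q q' where qq: "z = (q, q')" by (cases z)
  have q: "q \<noteq> 0" "poly_pair \<Gamma> q q'" "poly q x = 0" using z(1) qq by auto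
  define a a' where "a = lead_coeff q" and "a' = poly.coeff q' (degree q)"
  have a: "a \<noteq> 0" "(a, a') \<in> \<Gamma>" using q by (auto simp: a_def a'_def poly_pair_def)
  define m m' where "m = [:inverse a:] * q" and "m' = [:inverse a':] * q'"
  have m: "poly_pair \<Gamma> m m'" unfolding m_def m'_def
    by (intro poly_pair_mult[OF s] poly_pair_const[OF s] graph_inverse[OF \<Gamma>] a q)
  have dm: "degree m = degree q" using a by (simp add: m_def)
  have l: "lead_coeff m = 1" using a by (simp add: m_def a_def)
  have r: "poly m x = 0" using q by (simp add: m_def)
  have d: "degree m > 0"
  proof (rule ccontr)
    assume "\<not> ?thesis"
    then obtain c where "m = [:c:]" by (metis degree_eq_zeroE not_gr_zero)
    thus False using l r by simp
  qed
  have min: "r = 0" if "poly_pair \<Gamma> r r'" "degree r < degree m" "poly r x = 0" for r r'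
  proof (rule ccontr)
    assume "r \<noteq> 0"
    hence "degree q \<le> degree r" using z(2)[of "(r, r')"] that qq by simp
    thus False using that(2) dm by simp
  qed
  \<comment> \<open>Both (1, 1) and the pair of leading coefficients lie in \<open>\<Gamma>\<close>,
    so single-valuedness makes \<open>m'\<close> monic of the same degree; this is what later
    provides it with a root.\<close>
  have one: "poly.coeff m' (degree m) = 1"
    using m l graph_unique[OF s, of 1 1 "poly.coeff m' (degree m)"] graph_base[OF s]
      subfield_closed(2)[OF subfield] unfolding poly_pair_def by metis
  moreover have "poly.coeff m' i = 0" if "i > degree m" for i
    using m that graph_zero[OF s] unfolding poly_pair_def by (metis coeff_eq_0)
  ultimately have d': "degree m' = degree m"
    by (intro antisym degree_le le_degree) auto
  have "\<exists>g g'. poly_pair \<Gamma> g g' \<and> f = g * m \<and> f' = g' * m'"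
    if f: "poly_pair \<Gamma> f f'" "poly f x = 0" for f f'
  proof -
    obtain g g' r r' where g: "poly_pair \<Gamma> g g'" "poly_pair \<Gamma> r r'"
      "f = g * m + r" "f' = g' * m' + r'" "degree r < degree m"
      using poly_pair_division[OF s m l d f(1)] by blast
    have "poly r x = 0" using g(3) f(2) r by simp
    hence "r = 0" using min g by blast
    thus ?thesis using g poly_pair_zero[OF s] by auto
  qed
  note div = this
  have one': "lead_coeff m' = 1" using one d' by simp
  show thesis by (rule that[OF m l r d one' d'], erule (2) min, erule (1) div)
qed

text \<open>The new graph is f(x) \<mapsto> f'(y) on the ring generated by \<open>x\<close>; the
  hypothesis \<open>root\<close> says that only 0 lies over 0, that is, that the map is well
  defined.\<close>

lemma graph_extend:
  assumes \<Gamma>: "ring_graph F \<Gamma>" and root: "\<forall>f f'. poly_pair \<Gamma> f f' \<longrightarrow> poly f x = 0 \<longrightarrow> poly f' y = 0"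
  defines "\<Gamma>' \<equiv> {(poly f x, poly f' y) | f f'. poly_pair \<Gamma> f f'}"
  shows "ring_graph F \<Gamma>'" "\<Gamma> \<subseteq> \<Gamma>'" "(x, y) \<in> \<Gamma>'"
proof -
  note s = subfield \<Gamma>
  show sub: "\<Gamma> \<subseteq> \<Gamma>'"
  proof
    fix z assume "z \<in> \<Gamma>"
    then obtain a b where z: "z = (a, b)" "(a, b) \<in> \<Gamma>" by (cases z) auto
    show "z \<in> \<Gamma>'" unfolding \<Gamma>'_def using poly_pair_const[OF s z(2)] z(1)
      by (intro CollectI exI[of _ "[:a:]"] exI[of _ "[:b:]"]) auto
  qed
  have "(1, 1) \<in> \<Gamma>" using graph_base[OF s] subfield_closed(2)[OF subfield] by simp
  from poly_pair_monom[OF s this, of 1] show "(x, y) \<in> \<Gamma>'" unfolding \<Gamma>'_def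
    by (intro CollectI exI[of _ "Polynomial.monom 1 1"]) (auto simp: poly_monom)
  have "(a + b, a' + b') \<in> \<Gamma>' \<and> (a * b, a' * b') \<in> \<Gamma>'" if "(a, a') \<in> \<Gamma>'" "(b, b') \<in> \<Gamma>'" for a a' b b'
  proof -
    from that obtain f f' g g' where h: "poly_pair \<Gamma> f f'" "poly_pair \<Gamma> g g'"
      "a = poly f x" "a' = poly f' y" "b = poly g x" "b' = poly g' y" unfolding \<Gamma>'_def by auto
    show ?thesis unfolding \<Gamma>'_def
      using h poly_pair_add[OF s h(1,2)] poly_pair_mult[OF s h(1,2)]
      by (metis (mono_tags, lifting) mem_Collect_eq poly_add poly_mult)
  qed
  moreover have "b = 0" if "(0, b) \<in> \<Gamma>'" for b
    using that root unfolding \<Gamma>'_def by auto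
  moreover have "(c, c) \<in> \<Gamma>'" if "c \<in> F" for c
    using sub graph_base[OF s that] by auto
  ultimately show "ring_graph F \<Gamma>'" by (intro ring_graphI) simp_all
qed

text \<open>Zorn's lemma on ring graphs. A maximal one is total, because for any \<open>x\<close>
  the image \<open>m'\<close> of its minimal polynomial has a root to which \<open>x\<close> can be
  sent. Bijectivity is not built into \<open>auts\<close>; it is recovered in
  \<open>aut_bij\<close>.\<close>

lemma extend_graph_to_aut:
  assumes \<Gamma>: "ring_graph F \<Gamma>"
  obtains \<sigma> where "\<sigma> \<in> auts F" "\<And>x y. (x, y) \<in> \<Gamma> \<Longrightarrow> \<sigma> x = y"
proof -
  let ?A = "{\<Delta>. ring_graph F \<Delta> \<and> \<Gamma> \<subseteq> \<Delta>}"
  have "\<exists>m \<in> ?A. \<forall>x \<in> ?A. m \<subseteq> x \<longrightarrow> x = m"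
  proof (rule subset_Zorn_nonempty)
    show "?A \<noteq> {}" using \<Gamma> by blast
    fix \<C> assume \<C>: "\<C> \<noteq> {}" "subset.chain ?A \<C>"
    have sub: "\<C> \<subseteq> ?A" using \<C>(2) by (auto simp: subset_chain_def)
    have ch: "U \<subseteq> V \<or> V \<subseteq> U" if "U \<in> \<C>" "V \<in> \<C>" for U V
      using \<C>(2) that by (auto simp: subset_chain_def)
    have "(x + y, x' + y') \<in> \<Union> \<C> \<and> (x * y, x' * y') \<in> \<Union> \<C>" if "(x, x') \<in> \<Union> \<C>" "(y, y') \<in> \<Union> \<C>" for x x' y y'
    proof -
      from that ch obtain U where U: "U \<in> \<C>" "(x, x') \<in> U" "(y, y') \<in> U" by blast
      hence "ring_graph F U" using sub by blast
      thus ?thesis using U graph_add[OF subfield] graph_mult[OF subfield] by blast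
    qed
    moreover have "y = 0" if "(0, y) \<in> \<Union> \<C>" for y
      using that sub graph_zero[OF subfield] by blast
    moreover have "(c, c) \<in> \<Union> \<C>" if "c \<in> F" for c
      using that \<C>(1) sub graph_base[OF subfield] by blast
    ultimately have "ring_graph F (\<Union> \<C>)" by (intro ring_graphI) simp_all
    moreover have "\<Gamma> \<subseteq> \<Union> \<C>" using \<C>(1) sub by blast
    ultimately show "\<Union> \<C> \<in> ?A" by blast
  qed
  then obtain M where "M \<in> ?A" "\<forall>x\<in>?A. M \<subseteq> x \<longrightarrow> x = M" by (elim bexE)
  hence M: "ring_graph F M" "\<Gamma> \<subseteq> M"
    and max: "\<And>\<Delta>. ring_graph F \<Delta> \<Longrightarrow> M \<subseteq> \<Delta> \<Longrightarrow> \<Delta> = M"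
    by (simp_all add: order_trans[of \<Gamma> M])
  note s = subfield M(1)
  have tot: "\<exists>y. (x, y) \<in> M" for x
  proof -
    obtain m m' where m: "degree m > 0" "degree m' = degree m"
      "\<And>f f'. poly_pair M f f' \<Longrightarrow> poly f x = 0 \<Longrightarrow> \<exists>g g'. poly_pair M g g' \<and> f = g * m \<and> f' = g' * m'"
      using min_poly_pair[OF M(1), of x] by metis
    obtain y where y: "poly m' y = 0" using alg_closed_imp_poly_has_root[of m'] m by auto
    have r: "\<forall>f f'. poly_pair M f f' \<longrightarrow> poly f x = 0 \<longrightarrow> poly f' y = 0"
      using m(3) y by fastforce
    note ext = graph_extend[of M x y, OF M(1) r]
    show ?thesis using ext(3) unfolding max[OF ext(1,2)] by blast
  qed
  define \<sigma> where "\<sigma> x = (THE y. (x, y) \<in> M)" for x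
  have \<sigma>: "\<sigma> x = y" if "(x, y) \<in> M" for x y
    unfolding \<sigma>_def
  proof (rule the_equality)
    show "(x, y) \<in> M" by (rule that)
    show "z = y" if "(x, z) \<in> M" for z by (rule graph_unique[OF s that \<open>(x, y) \<in> M\<close>])
  qed
  have \<sigma>': "(x, \<sigma> x) \<in> M" for x
  proof -
    obtain y where "(x, y) \<in> M" using tot by blast
    thus ?thesis using \<sigma>[of x y] by simp
  qed
  have "\<sigma> \<in> auts F"
    unfolding auts_def
    by (intro CollectI conjI allI ballI \<sigma> graph_add[OF s] graph_mult[OF s] graph_base[OF s] \<sigma>')
  thus thesis by (rule that) (rule \<sigma>, rule subsetD[OF M(2)])
qed

end

section \<open>Field operations under a single automorphism\<close>

context
  fixes F :: "'k::field set" and \<sigma> :: "'k \<Rightarrow> 'k"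
  assumes F: "is_subfield F" and \<sigma>: "\<sigma> \<in> auts F"
begin

lemma aut_add: "\<sigma> (x + y) = \<sigma> x + \<sigma> y" and aut_mult: "\<sigma> (x * y) = \<sigma> x * \<sigma> y"
  and aut_base: "c \<in> F \<Longrightarrow> \<sigma> c = c"
  using \<sigma> by (auto simp: auts_def)

lemma aut_0: "\<sigma> 0 = 0" and aut_1: "\<sigma> 1 = 1"
  using aut_base subfield_closed(1,2)[OF F] by auto

lemma aut_minus: "\<sigma> (- x) = - \<sigma> x"
  using aut_mult[of "-1" x] aut_base[of "-1"] subfield_closed(2,5)[OF F] by auto

lemma aut_diff: "\<sigma> (x - y) = \<sigma> x - \<sigma> y"
  using aut_add[of x "-y"] aut_minus by simp

lemma aut_inverse: "\<sigma> (inverse x) = inverse (\<sigma> x)"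
proof (cases "x = 0")
  case True
  thus ?thesis by (simp add: aut_0)
next
  case False
  hence "\<sigma> x * \<sigma> (inverse x) = 1" by (simp flip: aut_mult add: aut_1)
  thus ?thesis by (metis inverse_unique)
qed

lemma aut_divide: "\<sigma> (x / y) = \<sigma> x / \<sigma> y"
  by (simp add: divide_inverse aut_mult aut_inverse)

lemma aut_power: "\<sigma> (x ^ n) = \<sigma> x ^ n"
  by (induction n) (auto simp: aut_1 aut_mult)

lemma aut_sum: "\<sigma> (sum f A) = (\<Sum>i\<in>A. \<sigma> (f i))"
  by (induction A rule: infinite_finite_induct) (auto simp: aut_0 aut_add)

lemma aut_prod: "\<sigma> (prod f A) = (\<Prod>i\<in>A. \<sigma> (f i))"
  by (induction A rule: infinite_finite_induct) (auto simp: aut_1 aut_mult)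

lemma aut_eq_0: "\<sigma> x = 0 \<longleftrightarrow> x = 0"
proof
  assume "\<sigma> x = 0"
  show "x = 0"
  proof (rule ccontr)
    assume "x \<noteq> 0"
    hence "\<sigma> x * \<sigma> (inverse x) = 1" by (simp flip: aut_mult add: aut_1)
    thus False using \<open>\<sigma> x = 0\<close> by simp
  qed
qed (simp add: aut_0)

lemma aut_inj: "\<sigma> x = \<sigma> y \<longleftrightarrow> x = y"
  using aut_eq_0[of "x - y"] by (auto simp: aut_diff)

lemma aut_poly: "poly_over F f \<Longrightarrow> \<sigma> (poly f x) = poly f (\<sigma> x)"
  by (simp add: poly_altdef aut_sum aut_mult aut_power aut_base poly_over_def)

lemma aut_vimage_subfield: "is_subfield L \<Longrightarrow> is_subfield {z. \<sigma> z \<in> L}"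
  by (auto simp: is_subfield_def aut_0 aut_1 aut_add aut_mult aut_minus aut_inverse)

lemma aut_adjoin_stable:
  assumes "\<And>a. a \<in> A \<Longrightarrow> \<sigma> a \<in> adjoin F B" "z \<in> adjoin F A"
  shows "\<sigma> z \<in> adjoin F B"
proof -
  have "F \<subseteq> {z. \<sigma> z \<in> adjoin F B}" using adjoin_base[of F B] by (auto simp: aut_base)
  moreover have "A \<subseteq> {z. \<sigma> z \<in> adjoin F B}" using assms(1) by auto
  ultimately show ?thesis
    using adjoin_least[OF aut_vimage_subfield[OF adjoin_subfield[of F B]], of F A] assms(2) by blast
qed

end

lemma auts_mono: "F \<subseteq> L \<Longrightarrow> auts L \<subseteq> auts F"
  by (auto simp: auts_def)

lemma auts_adjoin:
  assumes "is_subfield F"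
  shows "auts (adjoin F A) = {\<sigma> \<in> auts F. \<forall>a\<in>A. \<sigma> a = a}"
proof (intro equalityI subsetI)
  fix \<sigma> assume \<sigma>: "\<sigma> \<in> auts (adjoin F A)"
  have "\<sigma> a = a" if "a \<in> A" for a
    using aut_base[OF adjoin_subfield \<sigma>] adjoin_gens[of A F] that by blast
  thus "\<sigma> \<in> {\<sigma> \<in> auts F. \<forall>a\<in>A. \<sigma> a = a}"
    using subsetD[OF auts_mono[OF adjoin_base] \<sigma>] by simp
next
  fix \<sigma> assume "\<sigma> \<in> {\<sigma> \<in> auts F. \<forall>a\<in>A. \<sigma> a = a}"
  hence \<sigma>: "\<sigma> \<in> auts F" "\<forall>a\<in>A. \<sigma> a = a" by simp_all
  note s = assms \<sigma>(1)
  have "is_subfield {z. \<sigma> z = z}"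
    by (auto simp: is_subfield_def aut_0[OF s] aut_1[OF s] aut_add[OF s] aut_mult[OF s]
        aut_minus[OF s] aut_inverse[OF s])
  moreover have "F \<subseteq> {z. \<sigma> z = z}" by (auto simp: aut_base[OF s])
  moreover have "A \<subseteq> {z. \<sigma> z = z}" using \<sigma>(2) by auto
  ultimately have "adjoin F A \<subseteq> {z. \<sigma> z = z}" by (rule adjoin_least)
  thus "\<sigma> \<in> auts (adjoin F A)"
    using \<sigma>(1) by (simp add: auts_def subset_iff)
qed

lemma auts_comp: "\<sigma> \<in> auts F \<Longrightarrow> \<tau> \<in> auts F \<Longrightarrow> \<sigma> \<circ> \<tau> \<in> auts F"
  by (auto simp: auts_def)

lemma auts_id: "id \<in> auts F"
  by (auto simp: auts_def)

section \<open>Polynomials with distinct roots and separable elements\<close>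

definition lin_prod :: "'k::field set \<Rightarrow> 'k poly" where
  "lin_prod A = (\<Prod>a\<in>A. [:- a, 1:])"

lemma poly_lin_prod: "finite A \<Longrightarrow> poly (lin_prod A) x = 0 \<longleftrightarrow> x \<in> A"
  by (auto simp: lin_prod_def poly_prod)

lemma lin_prod_nz: "finite A \<Longrightarrow> lin_prod A \<noteq> 0"
  by (auto simp: lin_prod_def)

lemma degree_lin_prod: "finite A \<Longrightarrow> degree (lin_prod A) = card A"
  unfolding lin_prod_def by (subst degree_prod_eq_sum_degree) auto

lemma rsquarefree_lin_prod:
  assumes "finite A"
  shows "rsquarefree (lin_prod A)"
proof -
  have "proots (lin_prod A) = mset_set A"
    using assms unfolding lin_prod_def
    by (induction A rule: finite_induct) (auto simp: proots_mult simp del: mult_pCons_left)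
  hence "order a (lin_prod A) = count (mset_set A) a" for a
    using count_proots[OF lin_prod_nz[OF assms], of a] by simp
  thus ?thesis
    using lin_prod_nz[OF assms] assms unfolding rsquarefree_def by (auto simp: count_mset_set')
qed

lemma rsquarefree_factorization:
  fixes q :: "'k::alg_closed_field poly"
  assumes "rsquarefree q"
  shows "q = [:lead_coeff q:] * lin_prod {x. poly q x = 0}"
proof -
  have q: "q \<noteq> 0" using assms by (simp add: rsquarefree_def)
  obtain M where M: "q = [:lead_coeff q:] * (\<Prod>x\<in>#M. [:- x, 1:])"
    using alg_closed_imp_factorization[OF q] by auto
  have "(\<Prod>x\<in>#M. [:- x, 1:]) \<noteq> 0 \<and> proots (\<Prod>x\<in>#M. [:- x, 1:]) = M" for M :: "'k multiset"
    by (induction M) (auto simp: proots_mult simp del: mult_pCons_left)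
  hence "proots q = M"
    using q by (subst M) (simp add: proots_mult del: mult_pCons_left)
  hence c: "count M a = order a q" for a using q by auto
  have "M = mset_set {x. poly q x = 0}"
  proof (rule multiset_eqI)
    fix a
    have "order a q = 0 \<or> order a q = 1" using assms by (simp add: rsquarefree_def)
    thus "count M a = count (mset_set {x. poly q x = 0}) a"
      using order_root[of q a] q poly_roots_finite[OF q] by (auto simp: c count_mset_set')
  qed
  with M show ?thesis by (simp add: lin_prod_def prod_unfold_prod_mset)
qed

text \<open>A divisor of a product of distinct linear factors inherits simple roots. For a minimal
  polynomial this counts the conjugates of a separable element.\<close>

lemma card_roots_dvd_lin_prod:
  fixes m :: "'k::alg_closed_field poly"
  assumes "m dvd lin_prod A" "finite A"
  shows "card {x. poly m x = 0} = degree m"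
proof -
  have m: "m \<noteq> 0" using assms(1) lin_prod_nz[OF assms(2)] by (metis dvd_0_left)
  have "order a m = 0 \<or> order a m = 1" for a
  proof -
    have "order a m \<le> order a (lin_prod A)"
      by (rule dvd_imp_order_le[OF lin_prod_nz[OF assms(2)] assms(1)])
    moreover have "order a (lin_prod A) = 0 \<or> order a (lin_prod A) = 1"
      using rsquarefree_lin_prod[OF assms(2)] by (simp add: rsquarefree_def)
    ultimately show ?thesis by linarith
  qed
  hence "rsquarefree m" unfolding rsquarefree_def using m by simp
  hence "degree m = degree ([:lead_coeff m:] * lin_prod {x. poly m x = 0})"
    by (rule arg_cong[OF rsquarefree_factorization])
  also have "\<dots> = card {x. poly m x = 0}"
    using m poly_roots_finite[OF m] by (simp add: degree_lin_prod)
  finally show ?thesis by simp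
qed

lemma coeff_linear_mult:
  fixes a :: "'k::comm_ring_1"
  shows "poly.coeff ([:- a, 1:] * q) i = (case i of 0 \<Rightarrow> 0 | Suc j \<Rightarrow> poly.coeff q j) - a * poly.coeff q i"
  by (auto simp: coeff_pCons algebra_simps split: nat.splits)

text \<open>The coefficients are symmetric in \<open>A\<close>; hence a set stable under all
  automorphisms gives a polynomial with invariant coefficients, which is how elements are later
  shown to be separable over \<open>F\<close>.\<close>

lemma aut_coeff_lin_prod:
  assumes "is_subfield F" "\<sigma> \<in> auts F" "finite A"
  shows "\<sigma> (poly.coeff (lin_prod A) i) = poly.coeff (lin_prod (\<sigma> ` A)) i"
  using assms(3)
proof (induction A arbitrary: i rule: finite_induct)
  case empty
  thus ?case by (auto simp: lin_prod_def coeff_1 aut_0[OF assms(1,2)] aut_1[OF assms(1,2)])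
next
  case (insert a A)
  have "\<sigma> a \<notin> \<sigma> ` A" using insert aut_inj[OF assms(1,2)] by auto
  hence "lin_prod (\<sigma> ` insert a A) = [:- \<sigma> a, 1:] * lin_prod (\<sigma> ` A)"
    using insert by (simp add: lin_prod_def)
  moreover have "lin_prod (insert a A) = [:- a, 1:] * lin_prod A"
    using insert by (simp add: lin_prod_def)
  ultimately show ?case
    by (auto simp: coeff_linear_mult insert.IH aut_diff[OF assms(1,2)] aut_mult[OF assms(1,2)]
        aut_0[OF assms(1,2)] simp del: mult_pCons_left split: nat.splits)
qed

lemma poly_over_lin_prod:
  assumes "is_subfield L" "A \<subseteq> L"
  shows "poly_over L (lin_prod A)"
  using assms(2)
proof (induction A rule: infinite_finite_induct)
  case (insert a A)
  have "lin_prod (insert a A) = [:- a, 1:] * lin_prod A"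
    using insert by (simp add: lin_prod_def)
  thus ?case using insert
    by (auto simp: poly_over_def coeff_linear_mult simp del: mult_pCons_left split: nat.splits
        intro!: subfield_closed[OF assms(1)] subfield_closed'(1)[OF assms(1)])
qed (auto simp: lin_prod_def poly_over_def coeff_1 subfield_closed[OF assms(1)])

text \<open>A polynomial without multiple roots is, after normalisation, the product over its root
  set. This replaces it by a finite set of elements, on which automorphisms act directly.\<close>

lemma sep_closure_iff:
  assumes "is_subfield L"
  shows "x \<in> sep_closure L \<longleftrightarrow> (\<exists>A. finite A \<and> x \<in> A \<and> poly_over L (lin_prod A))"
proof
  assume "x \<in> sep_closure L"
  then obtain q where q: "poly_over L q" "rsquarefree q" "poly q x = 0"
    by (auto simp: sep_closure_def poly_over_def)
  have nz: "q \<noteq> 0" using q by (simp add: rsquarefree_def)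
  hence l: "inverse (lead_coeff q) \<in> L"
    using q(1) subfield_closed[OF assms] by (simp add: poly_over_def)
  have "lin_prod {x. poly q x = 0} = [:inverse (lead_coeff q):] * q"
    by (subst (3) rsquarefree_factorization[OF q(2)]) (use nz in \<open>simp\<close>)
  hence "poly_over L (lin_prod {x. poly q x = 0})"
    using q(1) l subfield_closed[OF assms] by (simp add: poly_over_def)
  thus "\<exists>A. finite A \<and> x \<in> A \<and> poly_over L (lin_prod A)"
    using q(3) poly_roots_finite[OF nz] by blast
next
  assume "\<exists>A. finite A \<and> x \<in> A \<and> poly_over L (lin_prod A)"
  thus "x \<in> sep_closure L"
    unfolding sep_closure_def using rsquarefree_lin_prod poly_lin_prod by (auto simp: poly_over_def)
qed

lemma sep_closure_mono: "L \<subseteq> L' \<Longrightarrow> sep_closure L \<subseteq> sep_closure L'"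
  unfolding sep_closure_def by blast

lemma sep_closure_base:
  assumes "is_subfield L"
  shows "L \<subseteq> sep_closure L"
proof
  fix x assume "x \<in> L"
  thus "x \<in> sep_closure L"
    using poly_over_lin_prod[OF assms, of "{x}"] sep_closure_iff[OF assms] by blast
qed

section \<open>Galois theory inside the separable closure\<close>

context alg_over
begin

lemma alg_over_extension:
  assumes "is_subfield L" "F \<subseteq> L"
  shows "alg_over L"
proof
  fix x obtain q where "q \<noteq> 0" "poly_over F q" "poly q x = 0" using algebraic by blast
  thus "\<exists>q. q \<noteq> 0 \<and> poly_over L q \<and> poly q x = 0"
    using assms(2) by (intro exI[of _ q]) (auto simp: poly_over_def)
qed (rule assms)

lemma finite_conjugates: "finite {\<sigma> x | \<sigma>. \<sigma> \<in> auts F}"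
proof -
  obtain q where q: "q \<noteq> 0" "poly_over F q" "poly q x = 0" using algebraic by blast
  have "{\<sigma> x | \<sigma>. \<sigma> \<in> auts F} \<subseteq> {y. poly q y = 0}"
    using aut_poly[OF subfield _ q(2), of _ x] q(3) aut_0[OF subfield] by auto
  thus ?thesis using poly_roots_finite[OF q(1)] finite_subset by blast
qed

text \<open>The finite root set of a polynomial over \<open>F\<close> is mapped injectively into
  itself, hence onto itself, and every element lies in such a set.\<close>

lemma aut_bij:
  assumes \<sigma>: "\<sigma> \<in> auts F"
  shows "bij \<sigma>"
proof -
  have inj: "inj \<sigma>" using aut_inj[OF subfield \<sigma>] by (auto intro: injI)
  moreover have "\<exists>x. \<sigma> x = y" for y
  proof -
    obtain q where q: "q \<noteq> 0" "poly_over F q" "poly q y = 0" using algebraic by blast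
    let ?R = "{x. poly q x = 0}"
    have "\<sigma> ` ?R \<subseteq> ?R"
      using aut_poly[OF subfield \<sigma> q(2)] aut_0[OF subfield \<sigma>] by (auto simp flip: aut_poly[OF subfield \<sigma> q(2)])
    hence "\<sigma> ` ?R = ?R"
      using poly_roots_finite[OF q(1)] inj by (intro endo_inj_surj) (auto intro: inj_on_subset)
    moreover have "y \<in> ?R" using q(3) by simp
    ultimately show ?thesis by (metis imageE)
  qed
  ultimately show ?thesis unfolding bij_def surj_def by metis
qed

lemma aut_inv:
  assumes \<sigma>: "\<sigma> \<in> auts F"
  shows "inv_into UNIV \<sigma> \<in> auts F" "\<sigma> (inv_into UNIV \<sigma> x) = x" "inv_into UNIV \<sigma> (\<sigma> x) = x"
proof -
  show a: "\<sigma> (inv_into UNIV \<sigma> x) = x" for x using aut_bij[OF \<sigma>] by (simp add: bij_is_surj surj_f_inv_f)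
  show b: "inv_into UNIV \<sigma> (\<sigma> x) = x" for x using aut_bij[OF \<sigma>] by (simp add: bij_is_inj)
  have "inv_into UNIV \<sigma> (x + y) = inv_into UNIV \<sigma> x + inv_into UNIV \<sigma> y \<and> inv_into UNIV \<sigma> (x * y) = inv_into UNIV \<sigma> x * inv_into UNIV \<sigma> y" for x y
    using b[of "inv_into UNIV \<sigma> x + inv_into UNIV \<sigma> y"] b[of "inv_into UNIV \<sigma> x * inv_into UNIV \<sigma> y"]
    by (simp add: aut_add[OF subfield \<sigma>] aut_mult[OF subfield \<sigma>] a)
  moreover have "inv_into UNIV \<sigma> c = c" if "c \<in> F" for c
    using b[of c] aut_base[OF subfield \<sigma> that] by simp
  ultimately show "inv_into UNIV \<sigma> \<in> auts F" by (simp add: auts_def)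
qed

lemma conjugates_stable:
  assumes \<sigma>: "\<sigma> \<in> auts F"
  shows "\<sigma> ` {\<tau> x | \<tau>. \<tau> \<in> auts F} = {\<tau> x | \<tau>. \<tau> \<in> auts F}"
proof (rule equalityI)
  show "\<sigma> ` {\<tau> x | \<tau>. \<tau> \<in> auts F} \<subseteq> {\<tau> x | \<tau>. \<tau> \<in> auts F}"
  proof
    fix y assume "y \<in> \<sigma> ` {\<tau> x | \<tau>. \<tau> \<in> auts F}"
    then obtain \<tau> where "\<tau> \<in> auts F" "y = (\<sigma> \<circ> \<tau>) x" by auto
    thus "y \<in> {\<tau> x | \<tau>. \<tau> \<in> auts F}" using auts_comp[OF \<sigma>] by blast
  qed
  show "{\<tau> x | \<tau>. \<tau> \<in> auts F} \<subseteq> \<sigma> ` {\<tau> x | \<tau>. \<tau> \<in> auts F}"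
  proof
    fix y assume "y \<in> {\<tau> x | \<tau>. \<tau> \<in> auts F}"
    then obtain \<tau> where t: "\<tau> \<in> auts F" "y = \<tau> x" by auto
    have "y = \<sigma> ((inv_into UNIV \<sigma> \<circ> \<tau>) x)" using aut_inv(2)[OF \<sigma>] t by simp
    thus "y \<in> \<sigma> ` {\<tau> x | \<tau>. \<tau> \<in> auts F}"
      using auts_comp[OF aut_inv(1)[OF \<sigma>] t(1)] by blast
  qed
qed

text \<open>If \<open>z = r(x)\<close> with \<open>deg r\<close> below the degree of the minimal polynomial of \<open>x\<close>, then \<open>r - z\<close>
  vanishes at all conjugates of \<open>x\<close>, which is too many roots unless \<open>r\<close> is constant.\<close>

lemma fixed_simple_extension:
  assumes x: "x \<in> sep_closure F" and z: "z \<in> adjoin F {x}" and fixed: "\<And>\<sigma>. \<sigma> \<in> auts F \<Longrightarrow> \<sigma> z = z"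
  shows "z \<in> F"
proof -
  have \<Gamma>: "ring_graph F (Id_on F)" using subfield by (intro ring_graph_Id) auto
  note s = subfield \<Gamma>
  have pp: "poly_pair (Id_on F) f f' \<longleftrightarrow> f = f' \<and> poly_over F f" for f f'
    by (auto simp: poly_pair_def poly_over_def Id_on_iff poly_eq_iff)
  obtain m m' where m: "poly_pair (Id_on F) m m'" "lead_coeff m = 1" "poly m x = 0" "degree m > 0"
    "\<And>f f'. poly_pair (Id_on F) f f' \<Longrightarrow> poly f x = 0 \<Longrightarrow>
       \<exists>g g'. poly_pair (Id_on F) g g' \<and> f = g * m \<and> f' = g' * m'"
    using min_poly_pair[OF \<Gamma>, of x] by metis
  have mF: "poly_over F m" using m(1) unfolding pp by blast
  have dvd: "m dvd f" if "poly_over F f" "poly f x = 0" for f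
    using m(5)[of f f] that by (auto simp: pp)
  \<comment> \<open>Sending \<open>x\<close> to any root of its minimal polynomial is a ring graph,
    so it extends to an automorphism.\<close>
  have conj: "\<exists>\<sigma>\<in>auts F. \<sigma> x = y" if y: "poly m y = 0" for y
  proof -
    have "\<forall>f f'. poly_pair (Id_on F) f f' \<longrightarrow> poly f x = 0 \<longrightarrow> poly f' y = 0"
      unfolding pp using dvd y by (metis dvdE mult_zero_left poly_mult)
    note ext = graph_extend[OF \<Gamma> this]
    show ?thesis
    proof (rule extend_graph_to_aut[OF ext(1)])
      fix \<sigma> assume \<sigma>: "\<sigma> \<in> auts F" "\<And>a b. (a, b) \<in> {(poly f x, poly f' y) | f f'. poly_pair (Id_on F) f f'} \<Longrightarrow> \<sigma> a = b"
      show "\<exists>\<sigma>\<in>auts F. \<sigma> x = y" using \<sigma>(1) \<sigma>(2)[OF ext(3)] by blast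
    qed
  qed
  let ?L = "{poly f x | f. poly_over F f}"
  have "is_subfield ?L"
  proof (rule subfieldI)
    show "F \<subseteq> ?L"
    proof
      fix c assume "c \<in> F"
      hence "poly_over F [:c:]" using subfield_closed(1)[OF subfield]
        by (auto simp: poly_over_def coeff_pCons split: nat.splits)
      thus "c \<in> ?L" by (intro CollectI exI[of _ "[:c:]"]) simp
    qed
    fix a b assume "a \<in> ?L" "b \<in> ?L"
    then obtain f g where fg: "poly_over F f" "poly_over F g" "a = poly f x" "b = poly g x" by blast
    have "poly_over F (f + g)" "poly_over F (f * g)"
      using fg(1,2) poly_pair_add[OF s, of f f g g] poly_pair_mult[OF s, of f f g g] by (simp_all add: pp)
    thus "a + b \<in> ?L" "a * b \<in> ?L" using fg(3,4) by (metis (mono_tags, lifting) mem_Collect_eq poly_add poly_mult)+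
  qed
  moreover have "F \<subseteq> ?L"
  proof
    fix c assume "c \<in> F"
    hence "poly_over F [:c:]" using subfield_closed(1)[OF subfield]
      by (auto simp: poly_over_def coeff_pCons split: nat.splits)
    thus "c \<in> ?L" by (intro CollectI exI[of _ "[:c:]"]) simp
  qed
  moreover have "x \<in> ?L"
    using subfield_closed(1,2)[OF subfield]
    by (intro CollectI exI[of _ "[:0, 1:]"]) (auto simp: poly_over_def coeff_pCons split: nat.splits)
  ultimately have "z \<in> ?L" using z adjoin_least[of ?L F "{x}"] by blast
  then obtain f where f: "poly_over F f" "z = poly f x" by blast
  obtain g g' r r' where div: "poly_pair (Id_on F) r r'" "f = g * m + r" "degree r < degree m"
    using poly_pair_division[OF s m(1,2,4), of f f] f(1) by (auto simp: pp)
  have r: "poly_over F r" "z = poly r x" using div f m(3) by (auto simp: pp)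
  have root: "poly (r - [:z:]) y = 0" if y: "poly m y = 0" for y
  proof -
    obtain \<sigma> where \<sigma>: "\<sigma> \<in> auts F" "\<sigma> x = y" using conj[OF y] by blast
    have "z = \<sigma> (poly r x)" using fixed[OF \<sigma>(1)] r(2) by simp
    also have "\<dots> = poly r y" using aut_poly[OF subfield \<sigma>(1) r(1)] \<sigma>(2) by simp
    finally show ?thesis by simp
  qed
  obtain A where A: "finite A" "x \<in> A" "poly_over F (lin_prod A)"
    using x sep_closure_iff[OF subfield] by blast
  have "m dvd lin_prod A" using dvd A poly_lin_prod by blast
  hence card: "card {y. poly m y = 0} = degree m" using card_roots_dvd_lin_prod A(1) by blast
  have "r - [:z:] = 0"
  proof (rule ccontr)
    assume nz: "r - [:z:] \<noteq> 0"
    have "card {y. poly m y = 0} \<le> card {y. poly (r - [:z:]) y = 0}"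
      using root by (intro card_mono poly_roots_finite[OF nz]) auto
    also have "\<dots> \<le> degree (r - [:z:])" by (rule card_poly_roots_bound[OF nz])
    also have "\<dots> \<le> max (degree r) (degree [:z:])" by (rule degree_diff_le_max)
    also have "\<dots> < degree m" using div(3) m(4) by simp
    finally show False using card by simp
  qed
  hence "z = poly.coeff r 0" by (simp add: algebra_simps)
  thus ?thesis using r(1) by (simp add: poly_over_def)
qed

text \<open>Generators are removed one at a time: \<open>z\<close> is also fixed by the
  automorphisms over the field generated by the others, so the simple case applies with that field
  as base.\<close>

lemma fixed_adjoin:
  assumes "finite A" "A \<subseteq> sep_closure F" "z \<in> adjoin F A" "\<And>\<sigma>. \<sigma> \<in> auts F \<Longrightarrow> \<sigma> z = z"
  shows "z \<in> F"
  using assms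
proof (induction A rule: finite_induct)
  case empty
  thus ?case using adjoin_least[OF subfield, of F "{}"] by auto
next
  case (insert x A)
  let ?L = "adjoin F A"
  interpret L: alg_over ?L using alg_over_extension adjoin_subfield adjoin_base by blast
  have "adjoin F (insert x A) \<subseteq> adjoin ?L {x}"
    using adjoin_base[of F A] adjoin_gens[of A F] adjoin_base[of ?L "{x}"] adjoin_gens[of "{x}" ?L]
    by (intro adjoin_least adjoin_subfield) auto
  hence "z \<in> adjoin ?L {x}" using insert.prems by blast
  moreover have "x \<in> sep_closure ?L"
    using insert.prems(1) sep_closure_mono[OF adjoin_base[of F A]] by blast
  moreover have "\<sigma> z = z" if "\<sigma> \<in> auts ?L" for \<sigma>
    using insert.prems(3) that auts_mono[OF adjoin_base[of F A]] by blast
  ultimately have "z \<in> ?L" using L.fixed_simple_extension by blast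
  thus ?case using insert.IH insert.prems by blast
qed

lemma sep_closure_fixed:
  assumes "z \<in> sep_closure F" "\<And>\<sigma>. \<sigma> \<in> auts F \<Longrightarrow> \<sigma> z = z"
  shows "z \<in> F"
  using fixed_adjoin[of "{z}" z] assms adjoin_gens[of "{z}" F] by auto

lemma sep_closure_image:
  assumes L: "is_subfield L" and \<sigma>: "\<sigma> \<in> auts F" "\<And>y. y \<in> L \<Longrightarrow> \<sigma> y \<in> L" and x: "x \<in> sep_closure L"
  shows "\<sigma> x \<in> sep_closure L"
proof -
  obtain A where A: "finite A" "x \<in> A" "poly_over L (lin_prod A)"
    using x sep_closure_iff[OF L] by blast
  have "poly_over L (lin_prod (\<sigma> ` A))"
    unfolding poly_over_def
    using A(3) \<sigma>(2) by (simp flip: aut_coeff_lin_prod[OF subfield \<sigma>(1) A(1)] add: poly_over_def)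
  thus ?thesis using A sep_closure_iff[OF L] by blast
qed

lemma sep_closure_stable: "\<sigma> \<in> auts F \<Longrightarrow> x \<in> sep_closure F \<Longrightarrow> \<sigma> x \<in> sep_closure F"
  by (rule sep_closure_image[OF subfield]) (simp_all add: aut_base[OF subfield])

lemma conjugates_coeff_fixed:
  assumes "\<sigma> \<in> auts F"
  shows "\<sigma> (poly.coeff (lin_prod {\<tau> x | \<tau>. \<tau> \<in> auts F}) i) = poly.coeff (lin_prod {\<tau> x | \<tau>. \<tau> \<in> auts F}) i"
  using aut_coeff_lin_prod[OF subfield assms finite_conjugates] conjugates_stable[OF assms] by simp

text \<open>The polynomial whose roots are the conjugates of \<open>z\<close> has invariant
  coefficients in a field generated by finitely many separable elements, so they lie in
  \<open>F\<close>. Sums and products of separable elements are covered at once.\<close>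

lemma adjoin_in_sep_closure:
  assumes A: "finite A" "A \<subseteq> sep_closure F" and z: "z \<in> adjoin F A"
  shows "z \<in> sep_closure F"
proof -
  let ?A = "\<Union>a\<in>A. {\<tau> a | \<tau>. \<tau> \<in> auts F}" and ?O = "{\<tau> z | \<tau>. \<tau> \<in> auts F}"
  have fin: "finite ?A" using A finite_conjugates by auto
  have sub: "?A \<subseteq> sep_closure F" using A(2) sep_closure_stable by auto
  have "\<tau> z \<in> adjoin F ?A" if "\<tau> \<in> auts F" for \<tau>
  proof (rule aut_adjoin_stable[OF subfield that _ z])
    fix a assume "a \<in> A"
    thus "\<tau> a \<in> adjoin F ?A" using adjoin_gens[of ?A F] that by blast
  qed
  hence "poly_over (adjoin F ?A) (lin_prod ?O)" by (intro poly_over_lin_prod adjoin_subfield) auto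
  hence "poly_over F (lin_prod ?O)"
    using fixed_adjoin[OF fin sub] conjugates_coeff_fixed unfolding poly_over_def by blast
  moreover have "z \<in> ?O" using auts_id by (metis (mono_tags, lifting) id_apply mem_Collect_eq)
  ultimately show ?thesis using sep_closure_iff[OF subfield] finite_conjugates by blast
qed

lemma sep_closure_subfield: "is_subfield (sep_closure F)"
proof (rule subfieldI)
  show "F \<subseteq> sep_closure F" by (rule sep_closure_base[OF subfield])
  fix x y assume xy: "x \<in> sep_closure F" "y \<in> sep_closure F"
  have "x \<in> adjoin F {x, y}" "y \<in> adjoin F {x, y}" using adjoin_gens[of "{x, y}" F] by auto
  hence "x + y \<in> adjoin F {x, y}" "x * y \<in> adjoin F {x, y}"
    using subfield_closed(3,4)[OF adjoin_subfield] by auto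
  thus "x + y \<in> sep_closure F" "x * y \<in> sep_closure F"
    using adjoin_in_sep_closure[of "{x, y}"] xy by auto
qed

definition normal_ext :: "'k set \<Rightarrow> bool" where
  "normal_ext L \<longleftrightarrow> is_subfield L \<and> F \<subseteq> L \<and> (\<forall>\<sigma>\<in>auts F. \<forall>y\<in>L. \<sigma> y \<in> L)"

lemma normal_ext_sep_closure: "normal_ext (sep_closure F)"
  unfolding normal_ext_def using sep_closure_subfield sep_closure_base[OF subfield] sep_closure_stable by simp

text \<open>Transitivity of separability: the coefficients belonging to the conjugates of
  \<open>x\<close> descend first from \<open>sep_closure L\<close> to \<open>L\<close>, then from
  \<open>L\<close> to \<open>F\<close>. Thanks to it the Kummer extensions below share the separable
  closure of \<open>F\<close>.\<close>

lemma sep_closure_normal_ext: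
  assumes "normal_ext L" "L \<subseteq> sep_closure F"
  shows "sep_closure L = sep_closure F"
proof (rule equalityI)
  have L: "is_subfield L" "F \<subseteq> L" "L \<subseteq> sep_closure F"
    and stable: "\<And>\<sigma> y. \<sigma> \<in> auts F \<Longrightarrow> y \<in> L \<Longrightarrow> \<sigma> y \<in> L"
    using assms by (auto simp: normal_ext_def)
  interpret L: alg_over L by (rule alg_over_extension[OF L(1,2)])
  show "sep_closure F \<subseteq> sep_closure L" by (rule sep_closure_mono[OF L(2)])
  show "sep_closure L \<subseteq> sep_closure F"
  proof
    fix x assume x: "x \<in> sep_closure L"
    let ?O = "{\<tau> x | \<tau>. \<tau> \<in> auts F}"
    have "?O \<subseteq> sep_closure L" using sep_closure_image[OF L(1) _ stable x] by auto
    hence "poly_over (sep_closure L) (lin_prod ?O)"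
      by (rule poly_over_lin_prod[OF L.sep_closure_subfield])
    hence "poly_over L (lin_prod ?O)"
      using L.sep_closure_fixed conjugates_coeff_fixed auts_mono[OF L(2)] unfolding poly_over_def by blast
    hence "poly_over F (lin_prod ?O)"
      using sep_closure_fixed conjugates_coeff_fixed L(3) unfolding poly_over_def by blast
    moreover have "x \<in> ?O" using auts_id by (metis (mono_tags, lifting) id_apply mem_Collect_eq)
    ultimately show "x \<in> sep_closure F" using sep_closure_iff[OF subfield] finite_conjugates by blast
  qed
qed

lemma restrict_aut_Bij:
  assumes "normal_ext L" "\<sigma> \<in> auts F"
  shows "restrict \<sigma> L \<in> Bij L"
proof -
  have "bij_betw \<sigma> L L"
  proof (rule bij_betwI)
    show "\<sigma> \<in> L \<rightarrow> L" "inv_into UNIV \<sigma> \<in> L \<rightarrow> L"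
      using assms aut_inv(1)[OF assms(2)] by (auto simp: normal_ext_def)
  qed (use aut_inv(2,3)[OF assms(2)] in auto)
  thus ?thesis unfolding Bij_def by (simp add: bij_betw_def inj_on_def)
qed

text \<open>The graph of an embedding is a ring graph and so extends. Norms and Galois groups of
  intermediate fields can then be computed with automorphisms of the whole closure.\<close>

lemma embeddings_eq_restrict:
  assumes L: "is_subfield L" "F \<subseteq> L"
  shows "embeddings F L = (\<lambda>\<sigma>. restrict \<sigma> L) ` auts F"
proof (intro equalityI subsetI)
  fix \<sigma> assume s: "\<sigma> \<in> embeddings F L"
  let ?G = "{(x, \<sigma> x) | x. x \<in> L}"
  have add: "\<sigma> (x + y) = \<sigma> x + \<sigma> y" and mult: "\<sigma> (x * y) = \<sigma> x * \<sigma> y" if "x \<in> L" "y \<in> L" for x y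
    using s that by (auto simp: embeddings_def)
  have base: "\<sigma> c = c" if "c \<in> F" for c using s that by (auto simp: embeddings_def)
  have "ring_graph F ?G"
  proof (rule ring_graphI)
    show "(c, c) \<in> ?G" if "c \<in> F" for c using that L base by auto
    show "y = 0" if "(0, y) \<in> ?G" for y using that base subfield_closed(1)[OF subfield] by auto
  qed (auto simp: add mult subfield_closed(3,4)[OF L(1)])
  then obtain \<tau> where \<tau>: "\<tau> \<in> auts F" "\<And>x y. (x, y) \<in> ?G \<Longrightarrow> \<tau> x = y"
    using extend_graph_to_aut by blast
  have "\<sigma> \<in> extensional L" using s by (simp add: embeddings_def)
  hence "\<sigma> = restrict \<tau> L" using \<tau>(2) by (auto simp: restrict_def extensional_def)
  thus "\<sigma> \<in> (\<lambda>\<sigma>. restrict \<sigma> L) ` auts F" using \<tau>(1) by blast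
next
  fix \<sigma> assume "\<sigma> \<in> (\<lambda>\<sigma>. restrict \<sigma> L) ` auts F"
  then obtain \<tau> where \<tau>: "\<tau> \<in> auts F" "\<sigma> = restrict \<tau> L" by blast
  have "c \<in> L" if "c \<in> F" for c using that L(2) by blast
  thus "\<sigma> \<in> embeddings F L"
    using subfield_closed(3,4)[OF L(1)]
    by (simp add: embeddings_def \<tau>(2) aut_add[OF subfield \<tau>(1)] aut_mult[OF subfield \<tau>(1)] aut_base[OF subfield \<tau>(1)])
qed

lemma carrier_gal_group:
  assumes "normal_ext L"
  shows "carrier (gal_group F L) = (\<lambda>\<sigma>. restrict \<sigma> L) ` auts F"
  using embeddings_eq_restrict[of L] restrict_aut_Bij[OF assms] assms
  unfolding gal_group_def by (auto simp: normal_ext_def)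

lemma mult_gal_group:
  assumes "normal_ext L" "\<sigma> \<in> auts F" "\<tau> \<in> auts F"
  shows "restrict \<sigma> L \<otimes>\<^bsub>gal_group F L\<^esub> restrict \<tau> L = restrict (\<sigma> \<circ> \<tau>) L"
  using restrict_aut_Bij[OF assms(1)] assms
  by (auto simp: gal_group_def BijGroup_def compose_def restrict_def fun_eq_iff normal_ext_def)

end

section \<open>Kummer theory\<close>

definition zpow :: "'k::field \<Rightarrow> 'p::prime_card mod_ring \<Rightarrow> 'k" where
  "zpow \<zeta> i = \<zeta> ^ nat (to_int_mod_ring i)"

lemma to_int_mod_ring_bounds:
  "0 \<le> to_int_mod_ring (i :: 'p::finite mod_ring)" "to_int_mod_ring i < int CARD('p)"
  using range_to_int_mod_ring[where 'a = 'p] by (auto simp: set_eq_iff image_iff)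

text \<open>The classical elimination of one character: subtract \<open>s j0 y\<close> times the
  relation at \<open>x\<close> from the relation at \<open>x * y\<close>. Everything is relative to
  \<open>L\<close> because it is applied to automorphisms that are compared only on the fixed field
  of an open subgroup.\<close>

lemma dedekind_independence:
  fixes s :: "'j \<Rightarrow> 'b::times \<Rightarrow> 'k::field"
  assumes "finite J"
    and "\<And>j x y. j \<in> J \<Longrightarrow> x \<in> L \<Longrightarrow> y \<in> L \<Longrightarrow> s j (x * y) = s j x * s j y"
    and "\<And>x y. x \<in> L \<Longrightarrow> y \<in> L \<Longrightarrow> x * y \<in> L"
    and "\<And>i j. i \<in> J \<Longrightarrow> j \<in> J \<Longrightarrow> i \<noteq> j \<Longrightarrow> \<exists>x\<in>L. s i x \<noteq> s j x"
    and "\<And>j. j \<in> J \<Longrightarrow> \<exists>x\<in>L. s j x \<noteq> 0"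
    and "\<And>x. x \<in> L \<Longrightarrow> (\<Sum>j\<in>J. c j * s j x) = 0"
    and "j \<in> J"
  shows "c j = 0"
  using assms
proof (induction J arbitrary: c j rule: finite_induct)
  case (insert j0 J)
  note mult = insert.prems(1) and L = insert.prems(2) and dist = insert.prems(3)
    and nz = insert.prems(4) and rel = insert.prems(5)
  have c: "c i = 0" if i: "i \<in> J" for i
  proof -
    obtain y where y: "y \<in> L" "s i y \<noteq> s j0 y" using dist[of i j0] i insert.hyps(2) by auto
    define d where "d j = c j * (s j y - s j0 y)" for j
    have "(\<Sum>j\<in>J. d j * s j x) = 0" if x: "x \<in> L" for x
    proof -
      have "(\<Sum>j\<in>J. d j * s j x) = (\<Sum>j\<in>J. c j * s j (x * y)) - s j0 y * (\<Sum>j\<in>J. c j * s j x)"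
        unfolding sum_distrib_left sum_subtractf[symmetric]
        by (rule sum.cong) (auto simp: d_def mult x y(1) algebra_simps)
      also have "\<dots> = (\<Sum>j\<in>insert j0 J. c j * s j (x * y)) - s j0 y * (\<Sum>j\<in>insert j0 J. c j * s j x)"
        using insert.hyps mult[of j0 x y] x y(1) by (simp add: algebra_simps)
      also have "\<dots> = 0" using rel[OF x] rel[OF L[OF x y(1)]] by simp
      finally show ?thesis .
    qed
    hence "d i = 0"
      using insert.IH[of d i] mult L dist nz i by simp
    thus ?thesis using y(2) by (simp add: d_def)
  qed
  obtain x where x: "x \<in> L" "s j0 x \<noteq> 0" using nz by blast
  have "(\<Sum>j\<in>J. c j * s j x) = 0" using c by simp
  hence "c j0 = 0" using rel[OF x(1)] insert.hyps x(2) by simp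
  thus ?case using c insert.prems(6) by auto
qed simp

text \<open>Continuity of a map from \<open>G\<close>, with the Krull topology of its action on \<open>S\<close>, to a discrete space.\<close>

definition locally_const :: "('k \<Rightarrow> 'k) set \<Rightarrow> 'k set \<Rightarrow> (('k \<Rightarrow> 'k) \<Rightarrow> 'c) \<Rightarrow> bool" where
  "locally_const G S f \<longleftrightarrow> (\<forall>\<sigma>\<in>G. \<exists>T. finite T \<and> T \<subseteq> S \<and> (\<forall>\<tau>\<in>G. (\<forall>x\<in>T. \<tau> x = \<sigma> x) \<longrightarrow> f \<tau> = f \<sigma>))"

lemma locally_constI:
  assumes "\<And>\<sigma>. \<sigma> \<in> G \<Longrightarrow> \<exists>T. finite T \<and> T \<subseteq> S \<and> (\<forall>\<tau>\<in>G. (\<forall>x\<in>T. \<tau> x = \<sigma> x) \<longrightarrow> f \<tau> = f \<sigma>)"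
  shows "locally_const G S f"
  using assms by (simp add: locally_const_def)

lemma locally_constE:
  assumes "locally_const G S f" "\<sigma> \<in> G"
  obtains T where "finite T" "T \<subseteq> S" "\<And>\<tau>. \<tau> \<in> G \<Longrightarrow> (\<And>x. x \<in> T \<Longrightarrow> \<tau> x = \<sigma> x) \<Longrightarrow> f \<tau> = f \<sigma>"
  using assms unfolding locally_const_def by metis

lemma locally_const_const: "locally_const G S (\<lambda>_. c)"
  by (auto simp: locally_const_def)

lemma locally_const_determined:
  assumes "finite T" "T \<subseteq> S" "\<And>\<sigma> \<tau>. \<sigma> \<in> G \<Longrightarrow> \<tau> \<in> G \<Longrightarrow> (\<And>x. x \<in> T \<Longrightarrow> \<tau> x = \<sigma> x) \<Longrightarrow> f \<tau> = f \<sigma>"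
  shows "locally_const G S f"
  by (intro locally_constI exI[of _ T] conjI assms(1,2) ballI impI) (auto intro: assms(3))

lemma locally_const_compose: "locally_const G S f \<Longrightarrow> locally_const G S (\<lambda>\<sigma>. h (f \<sigma>))"
  unfolding locally_const_def by metis

lemma locally_const_mono: "locally_const G S f \<Longrightarrow> G' \<subseteq> G \<Longrightarrow> locally_const G' S f"
  unfolding locally_const_def by (meson subsetD)

lemma locally_const_cong:
  assumes "locally_const G S f" "\<And>\<sigma>. \<sigma> \<in> G \<Longrightarrow> g \<sigma> = f \<sigma>"
  shows "locally_const G S g"
  using assms unfolding locally_const_def by metis

lemma locally_const_compose2:
  assumes "locally_const G S f" "locally_const G S g"
  shows "locally_const G S (\<lambda>\<sigma>. h (f \<sigma>) (g \<sigma>))"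
proof (rule locally_constI)
  fix \<sigma> assume \<sigma>: "\<sigma> \<in> G"
  obtain A B where A: "finite A" "A \<subseteq> S" "\<And>\<tau>. \<tau> \<in> G \<Longrightarrow> (\<And>x. x \<in> A \<Longrightarrow> \<tau> x = \<sigma> x) \<Longrightarrow> f \<tau> = f \<sigma>"
    and B: "finite B" "B \<subseteq> S" "\<And>\<tau>. \<tau> \<in> G \<Longrightarrow> (\<And>x. x \<in> B \<Longrightarrow> \<tau> x = \<sigma> x) \<Longrightarrow> g \<tau> = g \<sigma>"
    using locally_constE[OF assms(1) \<sigma>] locally_constE[OF assms(2) \<sigma>] by metis
  have "h (f \<tau>) (g \<tau>) = h (f \<sigma>) (g \<sigma>)" if "\<tau> \<in> G" "\<forall>x\<in>A \<union> B. \<tau> x = \<sigma> x" for \<tau>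
    using A(3)[OF that(1)] B(3)[OF that(1)] that(2) by simp
  thus "\<exists>T. finite T \<and> T \<subseteq> S \<and> (\<forall>\<tau>\<in>G. (\<forall>x\<in>T. \<tau> x = \<sigma> x) \<longrightarrow> h (f \<tau>) (g \<tau>) = h (f \<sigma>) (g \<sigma>))"
    using A(1,2) B(1,2) by (intro exI[of _ "A \<union> B"]) simp
qed

lemma locally_const_fun:
  fixes f :: "('k \<Rightarrow> 'k) \<Rightarrow> 'i::finite \<Rightarrow> 'c"
  assumes "\<And>k. locally_const G S (\<lambda>\<sigma>. f \<sigma> k)"
  shows "locally_const G S f"
proof (rule locally_constI)
  fix \<sigma> assume \<sigma>: "\<sigma> \<in> G"
  have "\<exists>T. finite T \<and> T \<subseteq> S \<and> (\<forall>\<tau>\<in>G. (\<forall>x\<in>T. \<tau> x = \<sigma> x) \<longrightarrow> f \<tau> k = f \<sigma> k)" for k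
    using assms[of k] \<sigma> unfolding locally_const_def by blast
  then obtain T where T: "\<And>k. finite (T k)" "\<And>k. T k \<subseteq> S"
    "\<And>k. \<forall>\<tau>\<in>G. (\<forall>x\<in>T k. \<tau> x = \<sigma> x) \<longrightarrow> f \<tau> k = f \<sigma> k" by metis
  have "f \<tau> = f \<sigma>" if "\<tau> \<in> G" "\<forall>x\<in>(\<Union>k. T k). \<tau> x = \<sigma> x" for \<tau>
    using T(3) that by (intro ext) simp
  thus "\<exists>T. finite T \<and> T \<subseteq> S \<and> (\<forall>\<tau>\<in>G. (\<forall>x\<in>T. \<tau> x = \<sigma> x) \<longrightarrow> f \<tau> = f \<sigma>)"
    using T(1,2) by (intro exI[of _ "\<Union>k. T k"]) auto
qed

lemma locally_const_left:
  assumes "locally_const G S f" "\<And>\<sigma>. \<sigma> \<in> G' \<Longrightarrow> \<rho> \<circ> \<sigma> \<in> G"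
  shows "locally_const G' S (\<lambda>\<sigma>. f (\<rho> \<circ> \<sigma>))"
proof (rule locally_constI)
  fix \<sigma> assume \<sigma>: "\<sigma> \<in> G'"
  obtain T where T: "finite T" "T \<subseteq> S" "\<And>\<tau>. \<tau> \<in> G \<Longrightarrow> (\<And>x. x \<in> T \<Longrightarrow> \<tau> x = (\<rho> \<circ> \<sigma>) x) \<Longrightarrow> f \<tau> = f (\<rho> \<circ> \<sigma>)"
    using locally_constE[OF assms(1) assms(2)[OF \<sigma>]] by metis
  have "f (\<rho> \<circ> \<tau>) = f (\<rho> \<circ> \<sigma>)" if "\<tau> \<in> G'" "\<forall>x\<in>T. \<tau> x = \<sigma> x" for \<tau>
    using that by (intro T(3) assms(2)) auto
  thus "\<exists>T. finite T \<and> T \<subseteq> S \<and> (\<forall>\<tau>\<in>G'. (\<forall>x\<in>T. \<tau> x = \<sigma> x) \<longrightarrow> f (\<rho> \<circ> \<tau>) = f (\<rho> \<circ> \<sigma>))"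
    using T(1,2) by blast
qed

text \<open>Right translation replaces the finite test set by its image under \<open>\<rho>\<close>.
  The claim concerns one point \<open>\<sigma>\<close>, since in Shapiro's lemma
  \<open>\<tau> \<circ> \<rho>\<close> lies in the subgroup only for \<open>\<tau>\<close> in one
  coset.\<close>

lemma locally_const_right_at:
  assumes f: "locally_const G S f" and "\<And>x. x \<in> S \<Longrightarrow> \<rho> x \<in> S" and \<sigma>: "\<sigma> \<circ> \<rho> \<in> G"
  shows "\<exists>T. finite T \<and> T \<subseteq> S \<and> (\<forall>\<tau>. \<tau> \<circ> \<rho> \<in> G \<longrightarrow> (\<forall>x\<in>T. \<tau> x = \<sigma> x) \<longrightarrow> f (\<tau> \<circ> \<rho>) = f (\<sigma> \<circ> \<rho>))"
proof -
  obtain T where T: "finite T" "T \<subseteq> S" "\<And>\<tau>. \<tau> \<in> G \<Longrightarrow> (\<And>x. x \<in> T \<Longrightarrow> \<tau> x = (\<sigma> \<circ> \<rho>) x) \<Longrightarrow> f \<tau> = f (\<sigma> \<circ> \<rho>)"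
    using locally_constE[OF f \<sigma>] by metis
  have "f (\<tau> \<circ> \<rho>) = f (\<sigma> \<circ> \<rho>)" if "\<tau> \<circ> \<rho> \<in> G" "\<forall>x\<in>\<rho> ` T. \<tau> x = \<sigma> x" for \<tau>
    using that by (intro T(3)) auto
  moreover have "\<rho> ` T \<subseteq> S" using T(2) assms(2) by blast
  ultimately show ?thesis using T(1) by (intro exI[of _ "\<rho> ` T"]) blast
qed

section \<open>Roots of unity and Kummer characters\<close>

locale kummer = alg_over F for F :: "'k::alg_closed_field set" +
  fixes \<zeta> :: 'k and P :: "'p::prime_card itself"
  assumes prim: "primitive_root CARD('p) \<zeta>" and \<zeta>_in: "\<zeta> \<in> F"
begin

abbreviation zp :: "'p mod_ring \<Rightarrow> 'k" where "zp \<equiv> zpow \<zeta>"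
abbreviation S :: "'k set" where "S \<equiv> sep_closure F"
abbreviation G :: "('k \<Rightarrow> 'k) set" where "G \<equiv> auts F"
abbreviation kchar :: "'k \<Rightarrow> ('k \<Rightarrow> 'k) \<Rightarrow> 'p mod_ring" where "kchar \<equiv> kummer_char \<zeta>"

lemma \<zeta>_power: "\<zeta> ^ CARD('p) = 1"
  using prim by (simp add: primitive_root_def)

lemma p_pos: "0 < CARD('p)" and p_gt1: "1 < CARD('p)"
  using prime_card[where 'a = 'p] prime_gt_1_nat by auto

lemma \<zeta>_power_mod: "\<zeta> ^ (n mod CARD('p)) = \<zeta> ^ n"
proof -
  have "\<zeta> ^ n = \<zeta> ^ (CARD('p) * (n div CARD('p)) + n mod CARD('p))" by simp
  also have "\<dots> = \<zeta> ^ (n mod CARD('p))" by (simp only: power_add power_mult \<zeta>_power power_one mult_1_left)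
  finally show ?thesis by simp
qed

lemma zp_0: "zp 0 = 1"
  by (simp add: zpow_def)

lemma zp_add: "zp (i + j) = zp i * zp j"
proof -
  have "to_int_mod_ring (i + j) = (to_int_mod_ring i + to_int_mod_ring j) mod int CARD('p)"
    by (rule to_int_mod_ring_add)
  hence "nat (to_int_mod_ring (i + j)) = (nat (to_int_mod_ring i) + nat (to_int_mod_ring j)) mod CARD('p)"
    using to_int_mod_ring_bounds(1)[of i] to_int_mod_ring_bounds(1)[of j]
    by (simp add: nat_mod_distrib nat_add_distrib)
  thus ?thesis by (simp add: zpow_def \<zeta>_power_mod power_add)
qed

lemma zp_nz: "zp i \<noteq> 0"
  using zp_add[of i "- i"] zp_0 by auto

lemma zp_sum: "zp (sum f A) = (\<Prod>i\<in>A. zp (f i))"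
  by (induction A rule: infinite_finite_induct) (auto simp: zp_0 zp_add)

lemma zp_power: "zp i ^ CARD('p) = 1"
  by (simp add: zpow_def \<zeta>_power flip: power_mult) (simp add: mult.commute[of _ "CARD('p)"] power_mult \<zeta>_power)

lemma zp_in: "zp i \<in> F"
  unfolding zpow_def by (rule subfield_closed'(3)[OF subfield \<zeta>_in])

lemma zp_eq_1: "zp i = 1 \<longleftrightarrow> i = 0"
proof
  assume "zp i = 1"
  hence "nat (to_int_mod_ring i) = 0"
    using prim to_int_mod_ring_bounds[of i] unfolding zpow_def primitive_root_def
    by (metis gr0I nat_less_iff)
  hence "to_int_mod_ring i = 0" using to_int_mod_ring_bounds(1)[of i] by simp
  hence "of_int_mod_ring (to_int_mod_ring i) = (0 :: 'p mod_ring)" by simp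
  thus "i = 0" by simp
qed (simp add: zp_0)

lemma zp_inj: "zp i = zp j \<longleftrightarrow> i = j"
  using zp_eq_1[of "i - j"] zp_add[of "i - j" j] zp_nz[of j] by auto

lemma card_zp: "card (range (\<lambda>i. zp i * y)) = CARD('p)" if "y \<noteq> 0"
  using that by (subst card_image) (auto intro!: injI simp: zp_inj)

lemma degree_kummer_poly: "degree (Polynomial.monom 1 CARD('p) - [:x:] :: 'k poly) = CARD('p)"
  using p_gt1 by (subst diff_conv_add_uminus, subst degree_add_eq_left) (auto simp: degree_monom_eq)

lemma root_unity:
  assumes "z ^ CARD('p) = 1"
  shows "\<exists>i. z = zp i"
proof -
  let ?q = "Polynomial.monom 1 CARD('p) - [:1:] :: 'k poly"
  have nz: "?q \<noteq> 0" using degree_kummer_poly[of 1] p_pos by (metis degree_0 less_irrefl)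
  have sub: "range zp \<subseteq> {z. poly ?q z = 0}" by (auto simp: poly_monom zp_power)
  have "card {z. poly ?q z = 0} \<le> CARD('p)"
    using card_poly_roots_bound[OF nz] degree_kummer_poly[of 1] by simp
  moreover have "card (range zp) = CARD('p)" using card_zp[of 1] by simp
  ultimately have "range zp = {z. poly ?q z = 0}"
    using sub poly_roots_finite[OF nz] by (intro card_seteq) auto
  moreover have "z \<in> {z. poly ?q z = 0}" using assms by (simp add: poly_monom)
  ultimately show ?thesis by blast
qed

lemma same_power:
  assumes "y ^ CARD('p) = z ^ CARD('p)" "z \<noteq> 0"
  obtains i where "y = zp i * z"
proof -
  have "(y / z) ^ CARD('p) = 1" using assms by (simp add: power_divide)
  then obtain i where "y / z = zp i" using root_unity by blast
  thus thesis using that[of i] assms(2) by (simp add: field_simps)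
qed

lemma rt_power: "proot CARD('p) x ^ CARD('p) = x"
  unfolding proot_def by (rule someI_ex[OF nth_root_exists[OF p_pos]])

lemma rt_nz: "x \<noteq> 0 \<Longrightarrow> proot CARD('p) x \<noteq> 0"
  using rt_power[of x] p_pos by (metis zero_power)

text \<open>Both sides are monic of degree p, so their difference has degree below p while vanishing
  at p points.\<close>

lemma lin_prod_kummer:
  assumes "y \<noteq> 0"
  shows "lin_prod (range (\<lambda>i. zp i * y)) = Polynomial.monom 1 CARD('p) - [:y ^ CARD('p):]"
proof -
  let ?A = "range (\<lambda>i. zp i * y)" and ?q = "Polynomial.monom 1 CARD('p) - [:y ^ CARD('p):]"
  have d: "degree (lin_prod ?A) = CARD('p)" "lead_coeff (lin_prod ?A) = 1"
    using card_zp[OF assms] by (simp add: degree_lin_prod, simp add: lin_prod_def lead_coeff_prod)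
  have "lin_prod ?A - ?q = 0"
  proof (rule ccontr)
    assume nz: "lin_prod ?A - ?q \<noteq> 0"
    have "degree (lin_prod ?A - ?q) \<le> CARD('p)"
      by (rule degree_diff_le) (simp_all add: d degree_kummer_poly)
    moreover have "poly.coeff (lin_prod ?A - ?q) CARD('p) = 0"
      using d p_gt1 by (simp add: coeff_pCons split: nat.splits)
    ultimately have "degree (lin_prod ?A - ?q) < CARD('p)"
      using nz by (metis leading_coeff_0_iff le_neq_implies_less)
    moreover have "?A \<subseteq> {z. poly (lin_prod ?A - ?q) z = 0}"
    proof
      fix z assume z: "z \<in> ?A"
      have "poly (lin_prod ?A) z = 0" using z poly_lin_prod[of ?A z] finite_imageI[OF finite] by blast
      moreover have "poly ?q z = 0" using z by (auto simp: poly_monom power_mult_distrib zp_power)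
      ultimately show "z \<in> {z. poly (lin_prod ?A - ?q) z = 0}" by (simp only: mem_Collect_eq poly_diff diff_self)
    qed
    hence "card ?A \<le> card {z. poly (lin_prod ?A - ?q) z = 0}"
      by (rule card_mono[OF poly_roots_finite[OF nz]])
    ultimately show False using card_poly_roots_bound[OF nz] card_zp[OF assms] by simp
  qed
  thus ?thesis by simp
qed

text \<open>X^p - x has distinct roots, but its coefficients lie in \<open>S\<close> rather than in
  \<open>F\<close>. Enlarging the base to the normal field generated by the conjugates of
  \<open>x\<close> does not change the separable closure.\<close>

lemma sep_closure_root:
  assumes x: "x \<in> S" and y: "y ^ CARD('p) = x"
  shows "y \<in> S"
proof (cases "y = 0")
  case True
  thus ?thesis using subfield_closed(1)[OF sep_closure_subfield] by simp
next
  case False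
  let ?L = "adjoin F {\<tau> x | \<tau>. \<tau> \<in> auts F}"
  have "normal_ext ?L"
    unfolding normal_ext_def
  proof (intro conjI ballI adjoin_subfield adjoin_base)
    fix \<sigma> z assume \<sigma>: "\<sigma> \<in> auts F" and z: "z \<in> ?L"
    show "\<sigma> z \<in> ?L"
    proof (rule aut_adjoin_stable[OF subfield \<sigma> _ z])
      fix a assume "a \<in> {\<tau> x | \<tau>. \<tau> \<in> auts F}"
      thus "\<sigma> a \<in> ?L" using conjugates_stable[OF \<sigma>, of x] adjoin_gens[of "{\<tau> x | \<tau>. \<tau> \<in> auts F}" F] by blast
    qed
  qed
  moreover have "?L \<subseteq> S"
    using sep_closure_stable[OF _ x] by (intro adjoin_least sep_closure_subfield sep_closure_base subfield) auto
  ultimately have L: "sep_closure ?L = S" by (rule sep_closure_normal_ext)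
  have "x \<in> ?L"
    using adjoin_gens[of "{\<tau> x | \<tau>. \<tau> \<in> auts F}" F] auts_id[of F] by (metis (mono_tags, lifting) id_apply mem_Collect_eq subsetD)
  hence o: "poly_over ?L (lin_prod (range (\<lambda>i. zp i * y)))"
    unfolding lin_prod_kummer[OF False] y poly_over_def
    using subfield_closed[OF adjoin_subfield] subfield_closed'(1)[OF adjoin_subfield]
    by (auto simp: coeff_pCons split: nat.splits)
  have "y \<in> range (\<lambda>i. zp i * y)" by (rule range_eqI[of _ _ 0]) (simp add: zp_0)
  hence "y \<in> sep_closure ?L"
    unfolding sep_closure_iff[OF adjoin_subfield] using o
    by (intro exI[of _ "range (\<lambda>i. zp i * y)"] conjI finite_imageI finite)
  thus ?thesis unfolding L .
qed

lemma rt_in_S: "x \<in> S \<Longrightarrow> proot CARD('p) x \<in> S"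
  using sep_closure_root rt_power by blast

text \<open>The character can be read off from any p-th root \<open>y\<close>, because two roots
  differ by a power of \<open>\<zeta>\<close>, which \<open>\<sigma>\<close> fixes. Here
  \<open>x\<close> may lie outside \<open>F\<close>, as it does for characters of subgroups of
  \<open>G\<close>.\<close>

lemma kchar_eqI:
  assumes \<sigma>: "\<sigma> \<in> G" and y: "y ^ CARD('p) = x" "y \<noteq> 0" and e: "\<sigma> y = zp i * y"
  shows "kchar x \<sigma> = i"
proof -
  have "x \<noteq> 0" using y p_pos by auto
  hence nz: "proot CARD('p) x \<noteq> 0" by (rule rt_nz)
  have "proot CARD('p) x ^ CARD('p) = y ^ CARD('p)" by (simp only: rt_power y(1))
  then obtain j where j: "proot CARD('p) x = zp j * y" using y(2) by (rule same_power)
  have "\<sigma> (proot CARD('p) x) = zp i * proot CARD('p) x"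
    by (simp add: j aut_mult[OF subfield \<sigma>] aut_base[OF subfield \<sigma> zp_in] e)
  moreover have "k = i" if "\<sigma> (proot CARD('p) x) = zp k * proot CARD('p) x" for k
    using that calculation nz zp_inj by simp
  ultimately show ?thesis
    unfolding kummer_char_def zpow_def[symmetric] by (rule the_equality)
qed

lemma kchar_root:
  assumes \<sigma>: "\<sigma> \<in> G" and y: "y ^ CARD('p) = x" "y \<noteq> 0" and fx: "\<sigma> x = x"
  shows "\<sigma> y = zp (kchar x \<sigma>) * y"
proof -
  have "\<sigma> y ^ CARD('p) = y ^ CARD('p)" using y fx by (simp flip: aut_power[OF subfield \<sigma>])
  then obtain i where i: "\<sigma> y = zp i * y" using same_power y(2) by blast
  thus ?thesis using kchar_eqI[OF \<sigma> y i] by simp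
qed

lemma kchar_restrict: "x \<in> S \<Longrightarrow> kchar x (restrict \<sigma> S) = kchar x \<sigma>"
  unfolding kummer_char_def using rt_in_S by simp

lemma kchar_hom:
  assumes x: "x \<in> F" "x \<noteq> 0" and \<sigma>: "\<sigma> \<in> G" "\<tau> \<in> G"
  shows "kchar x (\<sigma> \<circ> \<tau>) = kchar x \<sigma> + kchar x \<tau>"
proof (rule kchar_eqI[OF auts_comp[OF \<sigma>] rt_power rt_nz[OF x(2)]])
  note r = kchar_root[OF _ rt_power rt_nz[OF x(2)] aut_base[OF subfield _ x(1)]]
  show "(\<sigma> \<circ> \<tau>) (proot CARD('p) x) = zp (kchar x \<sigma> + kchar x \<tau>) * proot CARD('p) x"
    using r[OF \<sigma>(1) \<sigma>(1)] r[OF \<sigma>(2) \<sigma>(2)]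
    by (simp add: aut_mult[OF subfield \<sigma>(1)] aut_base[OF subfield \<sigma>(1) zp_in] zp_add mult_ac)
qed

lemma kchar_locally_const:
  assumes "x \<in> S"
  shows "locally_const G S (kchar x)"
  by (rule locally_const_determined[of "{proot CARD('p) x}"]) (use rt_in_S[OF assms] in \<open>auto simp: kummer_char_def\<close>)

end

section \<open>Hilbert 90 with permuted coordinates\<close>

context kummer
begin

text \<open>Hilbert 90 for the cocycle \<open>x\<close> twisted by the translation action of \<open>h\<close>: the family \<open>\<beta>\<close> is a
  Lagrange resolvent, summed over the finite quotient of \<open>G\<close> through which \<open>x\<close> and \<open>h\<close> factor.\<close>

lemma twisted_hilbert90:
  fixes x :: "('k \<Rightarrow> 'k) \<Rightarrow> 'p mod_ring \<Rightarrow> 'p mod_ring"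
  assumes h: "locally_const G S h" "\<And>\<sigma> \<tau>. \<sigma> \<in> G \<Longrightarrow> \<tau> \<in> G \<Longrightarrow> h (\<sigma> \<circ> \<tau>) = h \<sigma> + h \<tau>"
    and x: "locally_const G S x"
      "\<And>\<sigma> \<tau> k. \<sigma> \<in> G \<Longrightarrow> \<tau> \<in> G \<Longrightarrow> x (\<sigma> \<circ> \<tau>) k = x \<sigma> k + x \<tau> (k - h \<sigma>)"
  obtains \<beta> where "\<And>k. \<beta> k \<in> S" "\<beta> k0 \<noteq> 0"
    "\<And>\<sigma> k. \<sigma> \<in> G \<Longrightarrow> \<sigma> (\<beta> (k - h \<sigma>)) = zp (x \<sigma> k) * \<beta> k"
proof -
  note sS = sep_closure_subfield
  have h_id: "h id = 0" using h(2)[OF auts_id auts_id] by (metis add_cancel_right_right comp_id)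
  have x_id: "x id k = 0" for k
    using x(2)[OF auts_id auts_id, of k] h_id by (metis add_cancel_right_right comp_id diff_zero)
  obtain T1 where T1: "finite T1" "T1 \<subseteq> S"
    "\<And>\<tau>. \<tau> \<in> G \<Longrightarrow> (\<And>t. t \<in> T1 \<Longrightarrow> \<tau> t = id t) \<Longrightarrow> (x \<tau>, h \<tau>) = (x id, h id)"
    using locally_constE[OF locally_const_compose2[OF x(1) h(1), of Pair] auts_id] by metis
  \<comment> \<open>Closing \<open>T1\<close> under conjugation makes restrictions to
    \<open>T\<close> self-maps of a finite set, so there are finitely many of them.\<close>
  define T where "T = (\<Union>t\<in>T1. {\<tau> t | \<tau>. \<tau> \<in> G})"
  have fin: "finite T" using T1(1) finite_conjugates by (simp add: T_def)
  have TS: "T \<subseteq> S" using T1(2) sep_closure_stable by (auto simp: T_def)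
  have T1T: "T1 \<subseteq> T" using auts_id[of F] unfolding T_def by (force intro: exI[of _ id])
  have stab: "\<sigma> t \<in> T" if \<sigma>: "\<sigma> \<in> G" and t: "t \<in> T" for \<sigma> t
  proof -
    obtain t1 where t1: "t1 \<in> T1" "t \<in> {\<tau> t1 | \<tau>. \<tau> \<in> G}" using t unfolding T_def by blast
    hence "\<sigma> t \<in> {\<tau> t1 | \<tau>. \<tau> \<in> G}" using conjugates_stable[OF \<sigma>, of t1] by blast
    thus ?thesis using t1(1) unfolding T_def by blast
  qed
  define N where "N = {n \<in> G. \<forall>t\<in>T. n t = t}"
  have N: "x n = (\<lambda>_. 0)" "h n = 0" if "n \<in> N" for n
  proof -
    have "n t = id t" if "t \<in> T1" for t using \<open>n \<in> N\<close> that T1T unfolding N_def by auto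
    hence "(x n, h n) = (x id, h id)" using T1(3)[of n] that by (simp add: N_def)
    thus "x n = (\<lambda>_. 0)" "h n = 0" using x_id h_id by (simp_all add: fun_eq_iff)
  qed
  have quot: "inv_into UNIV \<sigma> \<circ> \<tau> \<in> N" "\<tau> = \<sigma> \<circ> (inv_into UNIV \<sigma> \<circ> \<tau>)"
    if "\<sigma> \<in> G" "\<tau> \<in> G" "restrict \<sigma> T = restrict \<tau> T" for \<sigma> \<tau>
  proof -
    note iv = aut_inv[OF that(1)]
    have "\<sigma> t = \<tau> t" if "t \<in> T" for t using \<open>restrict \<sigma> T = restrict \<tau> T\<close> that by (metis restrict_apply')
    hence "(inv_into UNIV \<sigma> \<circ> \<tau>) t = t" if "t \<in> T" for t using that iv(3)[of t] by simp
    thus "inv_into UNIV \<sigma> \<circ> \<tau> \<in> N" unfolding N_def using auts_comp[OF iv(1) that(2)] by simp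
    show "\<tau> = \<sigma> \<circ> (inv_into UNIV \<sigma> \<circ> \<tau>)" using iv(2) by (auto simp: fun_eq_iff)
  qed
  \<comment> \<open>On the fixed field of \<open>N\<close>, automorphisms with equal restriction to
    \<open>T\<close> agree. Choosing \<theta> in it makes the summands of the resolvent depend on
    that restriction only.\<close>
  define L where "L = {y \<in> S. \<forall>n\<in>N. n y = y}"
  have TL: "T \<subseteq> L" using TS by (auto simp: L_def N_def)
  have agree: "x \<tau> = x \<sigma>" "h \<tau> = h \<sigma>" "\<And>y. y \<in> L \<Longrightarrow> \<tau> y = \<sigma> y"
    if st: "\<sigma> \<in> G" "\<tau> \<in> G" "restrict \<sigma> T = restrict \<tau> T" for \<sigma> \<tau>
  proof -
    let ?n = "inv_into UNIV \<sigma> \<circ> \<tau>"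
    note n = quot[OF st]
    have nG: "?n \<in> G" using n(1) by (simp add: N_def)
    show "x \<tau> = x \<sigma>"
      by (subst n(2)) (use x(2)[OF st(1) nG] N(1)[OF n(1)] in \<open>simp add: fun_eq_iff\<close>)
    show "h \<tau> = h \<sigma>"
      by (subst n(2)) (use h(2)[OF st(1) nG] N(2)[OF n(1)] in simp)
    show "\<tau> y = \<sigma> y" if "y \<in> L" for y
    proof -
      have "?n y = y" using that n(1) unfolding L_def by blast
      thus ?thesis using n(2) by (metis comp_apply)
    qed
  qed
  \<comment> \<open>The restrictions to \<open>T\<close> are the elements of the finite quotient of
    \<open>G\<close>, and \<open>rep\<close> chooses automorphisms for them.\<close>
  define E where "E = (\<lambda>\<sigma>. restrict \<sigma> T) ` G"
  have finE: "finite E"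
  proof (rule finite_subset)
    show "E \<subseteq> T \<rightarrow>\<^sub>E T" using stab by (auto simp: E_def)
    show "finite (T \<rightarrow>\<^sub>E T)" by (intro finite_PiE fin)
  qed
  define rep where "rep e = (SOME \<sigma>. \<sigma> \<in> G \<and> restrict \<sigma> T = e)" for e
  have rep: "rep e \<in> G" "restrict (rep e) T = e" if "e \<in> E" for e
  proof -
    have "\<exists>\<sigma>. \<sigma> \<in> G \<and> restrict \<sigma> T = e" using that by (auto simp: E_def)
    from someI_ex[OF this] show "rep e \<in> G" "restrict (rep e) T = e" by (auto simp: rep_def)
  qed
  \<comment> \<open>Starting from a function supported at \<open>k0\<close>, only classes with
    \<open>h\<close> = 0 contribute to coordinate \<open>k0\<close> of the resolvent; Dedekind
    independence over \<open>J\<close> makes that coordinate nonzero.\<close>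
  define J where "J = {e \<in> E. h (rep e) = 0}"
  have "\<exists>\<theta>\<in>L. (\<Sum>e\<in>J. zp (- x (rep e) k0) * rep e \<theta>) \<noteq> 0"
  proof (rule ccontr)
    assume "\<not> ?thesis"
    hence rel: "(\<Sum>e\<in>J. zp (- x (rep e) k0) * rep e \<theta>) = 0" if "\<theta> \<in> L" for \<theta> using that by blast
    have eE: "restrict id T \<in> E" using auts_id by (auto simp: E_def)
    have "h (rep (restrict id T)) = h id" using rep[OF eE] by (intro agree(2)[OF auts_id]) auto
    hence eJ: "restrict id T \<in> J" using eE h_id by (simp add: J_def)
    have JG: "rep e \<in> G" if "e \<in> J" for e using that rep by (simp add: J_def)
    have "1 \<in> L" unfolding L_def N_def using subfield_closed(2)[OF sS] aut_1[OF subfield] by auto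
    have "zp (- x (rep (restrict id T)) k0) = 0"
    proof (rule dedekind_independence[of J L rep "\<lambda>e. zp (- x (rep e) k0)", OF _ _ _ _ _ rel eJ])
      show "finite J" using finE by (simp add: J_def)
      show "rep j (a * b) = rep j a * rep j b" if "j \<in> J" for j a b
        by (rule aut_mult[OF subfield JG[OF that]])
      show "a * b \<in> L" if "a \<in> L" "b \<in> L" for a b
      proof -
        have "n (a * b) = a * b" if "n \<in> N" for n
        proof -
          have "n (a * b) = n a * n b" using that by (intro aut_mult[OF subfield]) (simp add: N_def)
          moreover have "n a = a" "n b = b" using \<open>a \<in> L\<close> \<open>b \<in> L\<close> \<open>n \<in> N\<close> unfolding L_def by blast+
          ultimately show ?thesis by simp
        qed
        moreover have "a * b \<in> S" using that by (intro subfield_closed(4)[OF sS]) (simp_all add: L_def)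
        ultimately show ?thesis by (simp add: L_def)
      qed
      show "\<exists>a\<in>L. rep i a \<noteq> rep j a" if "i \<in> J" "j \<in> J" "i \<noteq> j" for i j
      proof (rule ccontr)
        assume "\<not> ?thesis"
        hence "restrict (rep i) T = restrict (rep j) T" using TL by (intro restrict_ext) auto
        thus False using rep that by (simp add: J_def)
      qed
      show "\<exists>a\<in>L. rep j a \<noteq> 0" if "j \<in> J" for j
        using \<open>1 \<in> L\<close> aut_1[OF subfield JG[OF that]] by (intro bexI[of _ 1]) auto
    qed
    thus False using zp_nz by blast
  qed
  then obtain \<theta> where \<theta>: "\<theta> \<in> L" "(\<Sum>e\<in>J. zp (- x (rep e) k0) * rep e \<theta>) \<noteq> 0" by blast
  define \<theta>' where "\<theta>' k = (if k = k0 then \<theta> else 0)" for k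
  have L0: "0 \<in> L" unfolding L_def N_def using subfield_closed(1)[OF sS] aut_0[OF subfield] by auto
  have \<theta>': "\<theta>' k \<in> L" for k using \<theta>(1) L0 by (simp add: \<theta>'_def)
  define f where "f \<sigma> k = zp (- x \<sigma> k) * \<sigma> (\<theta>' (k - h \<sigma>))" for \<sigma> k
  define \<beta> where "\<beta> k = (\<Sum>e\<in>E. f (rep e) k)" for k
  have f_agree: "f \<tau> k = f \<sigma> k" if "\<sigma> \<in> G" "\<tau> \<in> G" "restrict \<sigma> T = restrict \<tau> T" for \<sigma> \<tau> k
    using agree[OF that] \<theta>' by (simp add: f_def)
  have "\<beta> k0 \<noteq> 0"
  proof -
    have "\<beta> k0 = (\<Sum>e\<in>E. if h (rep e) = 0 then zp (- x (rep e) k0) * rep e \<theta> else 0)"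
      unfolding \<beta>_def by (rule sum.cong) (auto simp: f_def \<theta>'_def aut_0[OF subfield rep(1)])
    also have "\<dots> = (\<Sum>e\<in>J. zp (- x (rep e) k0) * rep e \<theta>)"
      unfolding J_def by (rule sum.inter_filter[OF finE, symmetric])
    finally show ?thesis using \<theta>(2) by simp
  qed
  moreover have "\<beta> k \<in> S" for k
    unfolding \<beta>_def
  proof (rule subfield_sum[OF sS])
    fix e assume e: "e \<in> E"
    have "zp (- x (rep e) k) \<in> S" using zp_in sep_closure_base[OF subfield] by blast
    moreover have "rep e (\<theta>' (k - h (rep e))) \<in> S"
      using \<theta>' by (intro sep_closure_stable[OF rep(1)[OF e]]) (auto simp: L_def)
    ultimately show "f (rep e) k \<in> S" unfolding f_def by (rule subfield_closed(4)[OF sS])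
  qed
  moreover have "\<sigma> (\<beta> (k - h \<sigma>)) = zp (x \<sigma> k) * \<beta> k" if \<sigma>: "\<sigma> \<in> G" for \<sigma> k
  proof -
    define g where "g e = restrict (\<sigma> \<circ> rep e) T" for e
    have gE: "g e \<in> E" if "e \<in> E" for e
      using auts_comp[OF \<sigma> rep(1)[OF that]] by (auto simp: E_def g_def)
    have inj: "inj_on g E"
    proof (rule inj_onI)
      fix e e' assume ee: "e \<in> E" "e' \<in> E" "g e = g e'"
      have "rep e t = rep e' t" if "t \<in> T" for t
        using ee(3) that aut_inj[OF subfield \<sigma>] unfolding g_def by (metis comp_apply restrict_apply')
      hence "restrict (rep e) T = restrict (rep e') T" by (intro restrict_ext)
      thus "e = e'" using rep ee by simp
    qed
    have bij: "bij_betw g E E"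
      using inj gE finE by (simp add: bij_betw_def endo_inj_surj image_subset_iff)
    \<comment> \<open>By the cocycle identity, \<open>\<sigma>\<close> takes the summand of
      \<open>\<tau>\<close> to that of \<open>\<sigma> \<circ> \<tau>\<close> up to the wanted
      factor; summation then merely permutes \<open>E\<close>.\<close>
    have step: "\<sigma> (f \<tau> (k - h \<sigma>)) = zp (x \<sigma> k) * f (\<sigma> \<circ> \<tau>) k" if \<tau>: "\<tau> \<in> G" for \<tau>
    proof -
      have "zp (- x \<tau> (k - h \<sigma>)) = zp (x \<sigma> k) * zp (- x (\<sigma> \<circ> \<tau>) k)"
        by (simp add: x(2)[OF \<sigma> \<tau>] flip: zp_add)
      moreover have k: "k - h \<sigma> - h \<tau> = k - h (\<sigma> \<circ> \<tau>)" by (simp add: h(2)[OF \<sigma> \<tau>])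
      ultimately show ?thesis
        unfolding f_def k aut_mult[OF subfield \<sigma>] aut_base[OF subfield \<sigma> zp_in] by simp
    qed
    have "\<sigma> (\<beta> (k - h \<sigma>)) = (\<Sum>e\<in>E. zp (x \<sigma> k) * f (\<sigma> \<circ> rep e) k)"
      unfolding \<beta>_def aut_sum[OF subfield \<sigma>] by (rule sum.cong) (simp_all add: step rep(1))
    also have "\<dots> = zp (x \<sigma> k) * (\<Sum>e\<in>E. f (rep (g e)) k)"
      unfolding sum_distrib_left
    proof (rule sum.cong)
      fix e assume e: "e \<in> E"
      have "f (\<sigma> \<circ> rep e) k = f (rep (g e)) k"
        using rep[OF gE[OF e]] auts_comp[OF \<sigma> rep(1)[OF e]] by (intro f_agree) (auto simp: g_def)
      thus "zp (x \<sigma> k) * f (\<sigma> \<circ> rep e) k = zp (x \<sigma> k) * f (rep (g e)) k" by simp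
    qed simp
    also have "(\<Sum>e\<in>E. f (rep (g e)) k) = \<beta> k"
      unfolding \<beta>_def by (rule sum.reindex_bij_betw[OF bij])
    finally show ?thesis .
  qed
  ultimately show thesis using that by blast
qed

end

section \<open>Group-algebra cocycles and norms from a Kummer extension\<close>

context kummer
begin

context
  fixes a :: 'k and Fa :: "'k set" and h :: "('k \<Rightarrow> 'k) \<Rightarrow> 'p mod_ring"
  assumes a: "a \<in> F" "a \<noteq> 0"
    and Fa: "Fa = adjoin F {proot CARD('p) a}" and h: "h = kchar a"
begin

lemma F_sub_S: "F \<subseteq> S"
  by (rule sep_closure_base[OF subfield])

lemma h_comp: "\<sigma> \<in> G \<Longrightarrow> \<tau> \<in> G \<Longrightarrow> h (\<sigma> \<circ> \<tau>) = h \<sigma> + h \<tau>"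
  unfolding h by (rule kchar_hom[OF a])

lemma h_locally_const: "locally_const G S h"
  unfolding h using a(1) F_sub_S by (intro kchar_locally_const) auto

lemma h_id: "h id = 0"
  using h_comp[OF auts_id auts_id] by (metis add_cancel_right_right comp_id)

lemma h_inv: "\<sigma> \<in> G \<Longrightarrow> h (inv_into UNIV \<sigma>) = - h \<sigma>"
proof -
  assume \<sigma>: "\<sigma> \<in> G"
  have "\<sigma> \<circ> inv_into UNIV \<sigma> = id" using aut_inv(2)[OF \<sigma>] by auto
  thus ?thesis using h_comp[OF \<sigma> aut_inv(1)[OF \<sigma>]] h_id by (simp add: add_eq_0_iff)
qed

lemma aut_root: "\<sigma> \<in> G \<Longrightarrow> \<sigma> (proot CARD('p) a) = zp (h \<sigma>) * proot CARD('p) a"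
  unfolding h using kchar_root[OF _ rt_power rt_nz[OF a(2)]] aut_base[OF subfield _ a(1)] by blast

lemma Fa_subfield: "is_subfield Fa" and F_sub_Fa: "F \<subseteq> Fa"
  unfolding Fa by (rule adjoin_subfield adjoin_base)+

lemma Fa_sub_S: "Fa \<subseteq> S"
  unfolding Fa using rt_in_S[of a] a(1) F_sub_S by (intro adjoin_least sep_closure_subfield) auto

lemma normal_Fa: "normal_ext Fa"
  unfolding normal_ext_def
proof (intro conjI ballI Fa_subfield F_sub_Fa)
  fix \<sigma> y assume \<sigma>: "\<sigma> \<in> G" and y: "y \<in> Fa"
  have "\<sigma> (proot CARD('p) a) \<in> adjoin F {proot CARD('p) a}"
    unfolding aut_root[OF \<sigma>] using zp_in adjoin_base[of F] adjoin_gens[of "{proot CARD('p) a}" F]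
    by (intro subfield_closed(4)[OF adjoin_subfield]) auto
  thus "\<sigma> y \<in> Fa" using aut_adjoin_stable[OF subfield \<sigma> _ y[unfolded Fa]] unfolding Fa by simp
qed

lemma Fa_stable: "\<sigma> \<in> G \<Longrightarrow> y \<in> Fa \<Longrightarrow> \<sigma> y \<in> Fa"
  using normal_Fa by (simp add: normal_ext_def)

lemma auts_Fa: "auts Fa = {\<sigma> \<in> G. h \<sigma> = 0}"
proof -
  have "\<sigma> (proot CARD('p) a) = proot CARD('p) a \<longleftrightarrow> h \<sigma> = 0" if "\<sigma> \<in> G" for \<sigma>
    unfolding aut_root[OF that] using rt_nz[OF a(2)] by (simp add: zp_eq_1)
  thus ?thesis unfolding Fa auts_adjoin[OF subfield] by auto
qed

text \<open>\<open>Fa\<close> is normal inside \<open>S\<close>, so its separable closure is again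
  \<open>S\<close>, and invariant elements descend with \<open>Fa\<close> as base field.\<close>

lemma Fa_fixed:
  assumes "y \<in> S" "\<And>\<sigma>. \<sigma> \<in> G \<Longrightarrow> h \<sigma> = 0 \<Longrightarrow> \<sigma> y = y"
  shows "y \<in> Fa"
proof -
  interpret Fa: alg_over Fa by (rule alg_over_extension[OF Fa_subfield F_sub_Fa])
  show ?thesis
    by (rule Fa.sep_closure_fixed) (use assms sep_closure_normal_ext[OF normal_Fa Fa_sub_S] auts_Fa in auto)
qed

lemma Fa_agree:
  assumes "\<sigma> \<in> G" "\<tau> \<in> G" "h \<sigma> = h \<tau>" "y \<in> Fa"
  shows "\<sigma> y = \<tau> y"
proof -
  have "inv_into UNIV \<sigma> \<circ> \<tau> \<in> auts Fa"
    unfolding auts_Fa using auts_comp[OF aut_inv(1)[OF assms(1)] assms(2)]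
      h_comp[OF aut_inv(1)[OF assms(1)] assms(2)] h_inv[OF assms(1)] assms(3) by simp
  hence "(inv_into UNIV \<sigma> \<circ> \<tau>) y = y" using aut_base[OF Fa_subfield _ assms(4)] by blast
  thus ?thesis using aut_inv(2)[OF assms(1), of "\<tau> y"] by simp
qed

text \<open>A nonzero value generates F_p, and powers of the automorphism attain its multiples. The
  cases are \<open>Fa\<close> = \<open>F\<close> and \<open>Fa\<close> of degree p over
  \<open>F\<close>.\<close>

lemma h_dichotomy: "(\<forall>\<sigma>\<in>G. h \<sigma> = 0) \<or> (\<forall>k. \<exists>\<sigma>\<in>G. h \<sigma> = k)"
proof (cases "\<forall>\<sigma>\<in>G. h \<sigma> = 0")
  case False
  then obtain \<sigma> where \<sigma>: "\<sigma> \<in> G" "h \<sigma> \<noteq> 0" by blast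
  have it: "\<sigma> ^^ m \<in> G \<and> h (\<sigma> ^^ m) = of_nat m * h \<sigma>" for m
  proof (induction m)
    case 0
    show ?case using auts_id[of F] h_id by (simp add: id_def)
  next
    case (Suc m)
    thus ?case unfolding funpow.simps(2)
      using auts_comp[OF \<sigma>(1), of "\<sigma> ^^ m"] h_comp[OF \<sigma>(1), of "\<sigma> ^^ m"]
      by (metis distrib_right mult_1 of_nat_Suc)
  qed
  have "\<exists>\<tau>\<in>G. h \<tau> = k" for k
  proof -
    obtain m where m: "k / h \<sigma> = of_nat m" using surj_of_nat_mod_ring[of "k / h \<sigma>"] by blast
    have "k = of_nat m * h \<sigma>" using \<sigma>(2) by (simp flip: m)
    thus ?thesis using it[of m] by metis
  qed
  thus ?thesis by blast
qed simp

lemma field_norm_trivial: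
  assumes triv: "\<forall>\<sigma>\<in>G. h \<sigma> = 0" and B: "B \<in> Fa"
  shows "field_norm F Fa B = B" "\<sigma> \<in> G \<Longrightarrow> \<sigma> B = B"
proof -
  have id: "\<sigma> y = y" if "\<sigma> \<in> G" "y \<in> Fa" for \<sigma> y
    using Fa_agree[OF that(1) auts_id _ that(2)] triv that(1) h_id by simp
  have "embeddings F Fa = {restrict id Fa}"
  proof (rule equalityI; rule subsetI)
    fix e assume "e \<in> embeddings F Fa"
    then obtain \<sigma> where "\<sigma> \<in> G" "e = restrict \<sigma> Fa"
      unfolding embeddings_eq_restrict[OF Fa_subfield F_sub_Fa] by blast
    hence "e = restrict id Fa" using id by (auto simp: restrict_def)
    thus "e \<in> {restrict id Fa}" by simp
  next
    fix e assume "e \<in> {restrict id Fa}"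
    thus "e \<in> embeddings F Fa"
      unfolding embeddings_eq_restrict[OF Fa_subfield F_sub_Fa] using auts_id by blast
  qed
  thus "field_norm F Fa B = B" using B by (simp add: field_norm_def)
  show "\<sigma> \<in> G \<Longrightarrow> \<sigma> B = B" using id B by blast
qed

text \<open>An embedding of \<open>Fa\<close> is determined by the power of \<open>\<zeta>\<close>
  by which it multiplies the p-th root of \<open>a\<close>, that is, by a value of
  \<open>h\<close>.\<close>

lemma field_norm_surj:
  assumes g: "\<And>k. g k \<in> G" "\<And>k. h (g k) = k" and B: "B \<in> Fa"
  shows "field_norm F Fa B = (\<Prod>k\<in>UNIV. g k B)"
proof -
  have ra: "proot CARD('p) a \<in> Fa" unfolding Fa using adjoin_gens by blast
  let ?e = "\<lambda>k. restrict (g k) Fa"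
  have "inj ?e"
  proof (rule injI)
    fix k l assume "?e k = ?e l"
    hence "g k (proot CARD('p) a) = g l (proot CARD('p) a)" using ra by (metis restrict_apply')
    thus "k = l" using aut_root[OF g(1)] g(2) rt_nz[OF a(2)] zp_inj by simp
  qed
  moreover have "embeddings F Fa = range ?e"
  proof (rule equalityI; rule subsetI)
    fix e assume "e \<in> embeddings F Fa"
    then obtain \<sigma> where \<sigma>: "\<sigma> \<in> G" "e = restrict \<sigma> Fa"
      unfolding embeddings_eq_restrict[OF Fa_subfield F_sub_Fa] by blast
    hence "e = ?e (h \<sigma>)" using Fa_agree[OF \<sigma>(1) g(1)] g(2) by (auto simp: restrict_def)
    thus "e \<in> range ?e" by blast
  next
    fix e assume "e \<in> range ?e"
    thus "e \<in> embeddings F Fa"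
      unfolding embeddings_eq_restrict[OF Fa_subfield F_sub_Fa] using g(1) by blast
  qed
  ultimately have "field_norm F Fa B = (\<Prod>k\<in>UNIV. ?e k B)"
    unfolding field_norm_def by (simp add: prod.reindex)
  thus ?thesis using B by simp
qed

lemma prod_shift: "(\<Prod>k\<in>UNIV. (f :: 'p mod_ring \<Rightarrow> 'k) (k - c)) = (\<Prod>k\<in>UNIV. f k)"
  by (rule prod.reindex_bij_witness[of _ "\<lambda>k. k + c" "\<lambda>k. k - c"]) auto

text \<open>The product of the p-th powers of the \<beta>_k is \<open>b\<close> up to a p-th power,
  because the coordinates of \<open>x\<close> add up to the character of \<open>b\<close>. The set
  \<open>I\<close> names the coordinates making up \<sigma>(B): a single one if \<open>h\<close> is
  onto, all of them if \<open>h\<close> vanishes.\<close>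

lemma cocycle_to_norm:
  fixes x :: "('k \<Rightarrow> 'k) \<Rightarrow> 'p mod_ring \<Rightarrow> 'p mod_ring"
  assumes b: "b \<in> F" "b \<noteq> 0"
    and x: "locally_const G S x"
      "\<And>\<sigma> \<tau> k. \<sigma> \<in> G \<Longrightarrow> \<tau> \<in> G \<Longrightarrow> x (\<sigma> \<circ> \<tau>) k = x \<sigma> k + x \<tau> (k - h \<sigma>)"
    and aug: "\<And>\<sigma>. \<sigma> \<in> G \<Longrightarrow> (\<Sum>k\<in>UNIV. x \<sigma> k) = kchar b \<sigma>"
  obtains B f where "B \<in> Fa" "f \<in> F" "f \<noteq> 0" "field_norm F Fa B = b * f ^ CARD('p)"
    "\<And>\<sigma>. \<sigma> \<in> G \<Longrightarrow> \<exists>I. \<forall>n\<in>auts Fa. kchar (\<sigma> B) n = (\<Sum>k\<in>I. x n k)"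
proof -
  note hilbert = twisted_hilbert90[OF h_locally_const h_comp x]
  have "\<exists>\<beta>. (\<forall>k. \<beta> k \<in> S \<and> \<beta> k \<noteq> 0) \<and> (\<forall>\<sigma>\<in>G. \<forall>k. \<sigma> (\<beta> (k - h \<sigma>)) = zp (x \<sigma> k) * \<beta> k)"
  proof (cases "\<forall>\<sigma>\<in>G. h \<sigma> = 0")
    case True
    \<comment> \<open>The resolvent is known to be nonzero only at its \<open>k0\<close>. For
      trivial \<open>h\<close> the coordinates are independent, so p solutions can be combined along
      the diagonal.\<close>
    have "\<exists>\<beta>. (\<forall>k. \<beta> k \<in> S) \<and> \<beta> k0 \<noteq> 0 \<and> (\<forall>\<sigma>\<in>G. \<forall>k. \<sigma> (\<beta> (k - h \<sigma>)) = zp (x \<sigma> k) * \<beta> k)" for k0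
      using hilbert[of k0] by metis
    then obtain \<beta> where \<beta>: "\<And>k0 k. \<beta> k0 k \<in> S" "\<And>k0. \<beta> k0 k0 \<noteq> 0"
      "\<And>k0 \<sigma> k. \<sigma> \<in> G \<Longrightarrow> \<sigma> (\<beta> k0 (k - h \<sigma>)) = zp (x \<sigma> k) * \<beta> k0 k" by metis
    show ?thesis
      using \<beta> True by (intro exI[of _ "\<lambda>k. \<beta> k k"]) (metis diff_zero)
  next
    case False
    hence surj: "\<exists>\<sigma>\<in>G. h \<sigma> = k" for k using h_dichotomy by blast
    obtain \<beta> where \<beta>: "\<And>k. \<beta> k \<in> S" "\<beta> 0 \<noteq> 0"
      "\<And>\<sigma> k. \<sigma> \<in> G \<Longrightarrow> \<sigma> (\<beta> (k - h \<sigma>)) = zp (x \<sigma> k) * \<beta> k"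
      using hilbert[of 0] by metis
    \<comment> \<open>Some automorphism carries coordinate 0 to coordinate \<open>k\<close>, so one
      nonzero coordinate suffices.\<close>
    have "\<beta> k \<noteq> 0" for k
    proof
      assume k: "\<beta> k = 0"
      obtain \<sigma> where \<sigma>: "\<sigma> \<in> G" "h \<sigma> = k" using surj by blast
      show False using \<beta>(3)[OF \<sigma>(1), of k] \<beta>(2) k \<sigma>(2) aut_eq_0[OF subfield \<sigma>(1)] by simp
    qed
    thus ?thesis using \<beta> by blast
  qed
  then obtain \<beta> where \<beta>: "\<And>k. \<beta> k \<in> S" "\<And>k. \<beta> k \<noteq> 0"
    "\<And>\<sigma> k. \<sigma> \<in> G \<Longrightarrow> \<sigma> (\<beta> (k - h \<sigma>)) = zp (x \<sigma> k) * \<beta> k" by blast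
  define b1 where "b1 = (\<Prod>k\<in>UNIV. \<beta> k)"
  have b1: "b1 \<in> S" "b1 \<noteq> 0" unfolding b1_def
    using \<beta>(1,2) by (auto intro!: subfield_prod[OF sep_closure_subfield])
  have rb: "proot CARD('p) b \<in> S" "proot CARD('p) b \<noteq> 0"
    using rt_in_S rt_nz b F_sub_S by auto
  have b1_act: "\<sigma> b1 = zp (kchar b \<sigma>) * b1" if \<sigma>: "\<sigma> \<in> G" for \<sigma>
  proof -
    have "\<sigma> b1 = (\<Prod>k\<in>UNIV. \<sigma> (\<beta> (k - h \<sigma>)))"
      unfolding b1_def aut_prod[OF subfield \<sigma>] by (rule prod_shift[symmetric])
    also have "\<dots> = zp (kchar b \<sigma>) * b1"
      by (simp add: \<beta>(3)[OF \<sigma>] prod.distrib b1_def flip: aug[OF \<sigma>] zp_sum)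
    finally show ?thesis .
  qed
  \<comment> \<open>\<open>b1\<close> and the chosen root of \<open>b\<close> transform by the same
    character, so their quotient is invariant.\<close>
  define f where "f = b1 / proot CARD('p) b"
  have fF: "f \<in> F"
  proof (rule sep_closure_fixed)
    show "f \<in> S" unfolding f_def by (rule subfield_closed'(2)[OF sep_closure_subfield b1(1) rb(1)])
    fix \<sigma> assume \<sigma>: "\<sigma> \<in> G"
    have "\<sigma> (proot CARD('p) b) = zp (kchar b \<sigma>) * proot CARD('p) b"
      by (rule kchar_root[OF \<sigma> rt_power rb(2) aut_base[OF subfield \<sigma> b(1)]])
    thus "\<sigma> f = f" using zp_nz by (simp add: f_def aut_divide[OF subfield \<sigma>] b1_act[OF \<sigma>])
  qed
  have f0: "f \<noteq> 0" using b1(2) rb(2) by (simp add: f_def)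
  have b1p: "b1 ^ CARD('p) = b * f ^ CARD('p)"
    using rb(2) b(2) by (simp add: f_def power_divide rt_power)
  define Bk where "Bk k = \<beta> k ^ CARD('p)" for k
  have Bk_act: "\<sigma> (Bk (k - h \<sigma>)) = Bk k" if "\<sigma> \<in> G" for \<sigma> k
  proof -
    have "\<sigma> (Bk (k - h \<sigma>)) = \<sigma> (\<beta> (k - h \<sigma>)) ^ CARD('p)"
      unfolding Bk_def by (rule aut_power[OF subfield that])
    thus ?thesis by (simp add: Bk_def \<beta>(3)[OF that] power_mult_distrib zp_power)
  qed
  have BkFa: "Bk k \<in> Fa" for k
  proof (rule Fa_fixed)
    show "Bk k \<in> S" unfolding Bk_def by (rule subfield_closed'(3)[OF sep_closure_subfield \<beta>(1)])
    show "\<sigma> (Bk k) = Bk k" if "\<sigma> \<in> G" "h \<sigma> = 0" for \<sigma> using Bk_act[OF that(1), of k] that(2) by simp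
  qed
  have prodB: "(\<Prod>k\<in>UNIV. Bk k) = b * f ^ CARD('p)"
    unfolding Bk_def b1p[symmetric] b1_def by (simp add: prod_power_distrib)
  show thesis
  proof (cases "\<forall>\<sigma>\<in>G. h \<sigma> = 0")
    case True
    \<comment> \<open>With \<open>h\<close> = 0 the norm is the identity, so the product of all
      \<open>Bk\<close> itself is taken as B.\<close>
    have BF: "b1 ^ CARD('p) \<in> Fa" unfolding b1p
      using b(1) fF F_sub_Fa by (intro subfield_closed(4)[OF Fa_subfield] subfield_closed'(3)[OF Fa_subfield]) auto
    note tr = field_norm_trivial[OF True BF]
    have "\<exists>I. \<forall>n\<in>auts Fa. kchar (\<sigma> (b1 ^ CARD('p))) n = (\<Sum>k\<in>I. x n k)" if \<sigma>: "\<sigma> \<in> G" for \<sigma>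
    proof (intro exI[of _ UNIV] ballI)
      fix n assume "n \<in> auts Fa"
      hence n: "n \<in> G" by (simp add: auts_Fa)
      show "kchar (\<sigma> (b1 ^ CARD('p))) n = (\<Sum>k\<in>UNIV. x n k)"
        unfolding tr(2)[OF \<sigma>] aug[OF n] by (rule kchar_eqI[OF n refl b1(2) b1_act[OF n]])
    qed
    with tr(1) BF b1p fF f0 show thesis by (intro that[of "b1 ^ CARD('p)" f]) simp_all
  next
    case False
    hence "\<exists>\<sigma>\<in>G. h \<sigma> = k" for k using h_dichotomy by blast
    then obtain g where g: "\<And>k. g k \<in> G" "\<And>k. h (g k) = k" by metis
    have gB: "\<sigma> (Bk 0) = Bk (h \<sigma>)" if "\<sigma> \<in> G" for \<sigma> using Bk_act[OF that, of "h \<sigma>"] by simp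
    have norm: "field_norm F Fa (Bk 0) = b * f ^ CARD('p)"
      unfolding field_norm_surj[OF g BkFa] gB[OF g(1)] g(2) by (rule prodB)
    have "\<exists>I. \<forall>n\<in>auts Fa. kchar (\<sigma> (Bk 0)) n = (\<Sum>k\<in>I. x n k)" if \<sigma>: "\<sigma> \<in> G" for \<sigma>
    proof (intro exI[of _ "{h \<sigma>}"] ballI)
      fix n assume "n \<in> auts Fa"
      hence n: "n \<in> G" "h n = 0" by (simp_all add: auts_Fa)
      have "n (\<beta> (h \<sigma>)) = zp (x n (h \<sigma>)) * \<beta> (h \<sigma>)" using \<beta>(3)[OF n(1), of "h \<sigma>"] n(2) by simp
      thus "kchar (\<sigma> (Bk 0)) n = (\<Sum>k\<in>{h \<sigma>}. x n k)"
        unfolding gB[OF \<sigma>] using kchar_eqI[OF n(1) _ \<beta>(2)] by (simp add: Bk_def)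
    qed
    with norm BkFa fF f0 show thesis by (intro that[of "Bk 0" f]) simp_all
  qed
qed

text \<open>\<open>B\<close> is spread over the coordinates as a family permuted through
  \<open>h\<close> whose product is the norm; \<open>x\<close> records how p-th roots of this family
  are moved. An entry 1 of the family leads to the zero alternative in the last claim.\<close>

lemma norm_to_cocycle:
  assumes b: "b \<in> F" "b \<noteq> 0" and B: "B \<in> Fa" and f: "f \<in> F" "f \<noteq> 0"
    and norm: "field_norm F Fa B = b * f ^ CARD('p)"
  obtains x :: "('k \<Rightarrow> 'k) \<Rightarrow> 'p mod_ring \<Rightarrow> 'p mod_ring" where "locally_const G S x"
    "\<And>\<sigma> \<tau> k. \<sigma> \<in> G \<Longrightarrow> \<tau> \<in> G \<Longrightarrow> x (\<sigma> \<circ> \<tau>) k = x \<sigma> k + x \<tau> (k - h \<sigma>)"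
    "\<And>\<sigma>. \<sigma> \<in> G \<Longrightarrow> (\<Sum>k\<in>UNIV. x \<sigma> k) = kchar b \<sigma>"
    "\<And>k. (\<exists>\<sigma>\<in>G. \<forall>n\<in>auts Fa. x n k = kchar (\<sigma> B) n) \<or> (\<forall>n\<in>auts Fa. x n k = 0)"
proof -
  have bf: "b * f ^ CARD('p) \<noteq> 0" using b f by simp
  have "\<exists>Bk. (\<forall>\<sigma>\<in>G. \<forall>k. \<sigma> (Bk (k - h \<sigma>)) = Bk k) \<and> (\<Prod>k\<in>UNIV. Bk k) = b * f ^ CARD('p) \<and>
      (\<forall>k. (\<exists>\<sigma>\<in>G. Bk k = \<sigma> B) \<or> Bk k = 1)"
  proof (cases "\<forall>\<sigma>\<in>G. h \<sigma> = 0")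
    case True
    note tr = field_norm_trivial[OF True B]
    \<comment> \<open>For trivial \<open>h\<close> any family in \<open>F\<close> with product
      \<open>B\<close> is permuted correctly; all of \<open>B\<close> goes into coordinate
      0.\<close>
    define Bk where "Bk k = (if k = 0 then B else 1)" for k :: "'p mod_ring"
    have "\<sigma> (Bk (k - h \<sigma>)) = Bk k" if "\<sigma> \<in> G" for \<sigma> k
      using True that tr(2) aut_1[OF subfield] by (simp add: Bk_def)
    moreover have "(\<Prod>k\<in>UNIV. Bk k) = b * f ^ CARD('p)"
      unfolding Bk_def using norm tr(1) by (simp add: prod.delta)
    moreover have "(\<exists>\<sigma>\<in>G. Bk k = \<sigma> B) \<or> Bk k = 1" for k
    proof -
      have "\<exists>\<sigma>\<in>G. B = \<sigma> B" by (rule bexI[of _ id]) (simp_all add: auts_id)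
      thus ?thesis by (simp add: Bk_def)
    qed
    ultimately show ?thesis by blast
  next
    case False
    hence "\<exists>\<sigma>\<in>G. h \<sigma> = k" for k using h_dichotomy by blast
    then obtain g where g: "\<And>k. g k \<in> G" "\<And>k. h (g k) = k" by metis
    \<comment> \<open>\<open>\<sigma> \<circ> g (k - h \<sigma>)\<close> and \<open>g k\<close> have
      the same value under \<open>h\<close>, hence agree on \<open>Fa\<close>.\<close>
    have "\<sigma> (g (k - h \<sigma>) B) = g k B" if \<sigma>: "\<sigma> \<in> G" for \<sigma> k
      using Fa_agree[OF auts_comp[OF \<sigma> g(1)] g(1) _ B, of "k - h \<sigma>" k] h_comp[OF \<sigma> g(1)] g(2) by simp
    moreover have "(\<Prod>k\<in>UNIV. g k B) = b * f ^ CARD('p)"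
      using field_norm_surj[OF g B] norm by simp
    ultimately show ?thesis using g(1) by (intro exI[of _ "\<lambda>k. g k B"]) blast
  qed
  then obtain Bk where Bk: "\<And>\<sigma> k. \<sigma> \<in> G \<Longrightarrow> \<sigma> (Bk (k - h \<sigma>)) = Bk k"
    "(\<Prod>k\<in>UNIV. Bk k) = b * f ^ CARD('p)" "\<And>k. (\<exists>\<sigma>\<in>G. Bk k = \<sigma> B) \<or> Bk k = 1" by blast
  have Bk0: "Bk k \<noteq> 0" for k using bf unfolding Bk(2)[symmetric] by simp
  have BkS: "Bk k \<in> S" for k
    using Bk(3)[of k] B Fa_sub_S Fa_stable subfield_closed(2)[OF sep_closure_subfield] by auto
  define \<beta> where "\<beta> k = proot CARD('p) (Bk k)" for k
  have \<beta>p: "\<beta> k ^ CARD('p) = Bk k" for k unfolding \<beta>_def by (rule rt_power)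
  have \<beta>: "\<beta> k \<noteq> 0" "\<beta> k \<in> S" for k
    unfolding \<beta>_def using rt_nz[OF Bk0] rt_in_S[OF BkS] by auto
  define x :: "('k \<Rightarrow> 'k) \<Rightarrow> 'p mod_ring \<Rightarrow> 'p mod_ring"
    where "x \<sigma> k = (SOME i. \<sigma> (\<beta> (k - h \<sigma>)) = zp i * \<beta> k)" for \<sigma> k
  have x: "\<sigma> (\<beta> (k - h \<sigma>)) = zp (x \<sigma> k) * \<beta> k" if \<sigma>: "\<sigma> \<in> G" for \<sigma> k
  proof -
    have "\<sigma> (\<beta> (k - h \<sigma>)) ^ CARD('p) = \<beta> k ^ CARD('p)"
      by (simp add: \<beta>p Bk(1)[OF \<sigma>] flip: aut_power[OF subfield \<sigma>])
    then obtain i where "\<sigma> (\<beta> (k - h \<sigma>)) = zp i * \<beta> k" using \<beta>(1) by (rule same_power)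
    thus ?thesis unfolding x_def by (rule someI)
  qed
  have x_eq: "x \<sigma> k = i" if "\<sigma> \<in> G" "\<sigma> (\<beta> (k - h \<sigma>)) = zp i * \<beta> k" for \<sigma> k i
    using x[OF that(1), of k] that(2) \<beta>(1) zp_inj by simp
  have "locally_const G S x"
  proof (rule locally_const_determined[of "insert (proot CARD('p) a) (range \<beta>)"])
    show "insert (proot CARD('p) a) (range \<beta>) \<subseteq> S"
      using \<beta>(2) rt_in_S[of a] a(1) F_sub_S by auto
    fix \<sigma> \<tau> assume st: "\<sigma> \<in> G" "\<tau> \<in> G" and eq: "\<And>y. y \<in> insert (proot CARD('p) a) (range \<beta>) \<Longrightarrow> \<tau> y = \<sigma> y"
    have "h \<tau> = h \<sigma>" unfolding h kummer_char_def using eq by simp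
    thus "x \<tau> = x \<sigma>" unfolding x_def using eq by (simp add: fun_eq_iff)
  qed simp
  moreover have "x (\<sigma> \<circ> \<tau>) k = x \<sigma> k + x \<tau> (k - h \<sigma>)" if st: "\<sigma> \<in> G" "\<tau> \<in> G" for \<sigma> \<tau> k
  proof (rule x_eq[OF auts_comp[OF st]])
    have k: "k - h (\<sigma> \<circ> \<tau>) = k - h \<sigma> - h \<tau>" by (simp add: h_comp[OF st])
    have "(\<sigma> \<circ> \<tau>) (\<beta> (k - h (\<sigma> \<circ> \<tau>))) = \<sigma> (zp (x \<tau> (k - h \<sigma>)) * \<beta> (k - h \<sigma>))"
      unfolding k comp_apply x[OF st(2)] ..
    also have "\<dots> = zp (x \<tau> (k - h \<sigma>)) * (zp (x \<sigma> k) * \<beta> k)"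
      by (simp only: aut_mult[OF subfield st(1)] aut_base[OF subfield st(1) zp_in] x[OF st(1)])
    finally show "(\<sigma> \<circ> \<tau>) (\<beta> (k - h (\<sigma> \<circ> \<tau>))) = zp (x \<sigma> k + x \<tau> (k - h \<sigma>)) * \<beta> k"
      by (simp add: zp_add mult_ac)
  qed
  moreover have "(\<Sum>k\<in>UNIV. x \<sigma> k) = kchar b \<sigma>" if \<sigma>: "\<sigma> \<in> G" for \<sigma>
  proof -
    let ?b = "\<Prod>k\<in>UNIV. \<beta> k"
    have b0: "?b \<noteq> 0" using \<beta>(1) by simp
    have "\<sigma> ?b = (\<Prod>k\<in>UNIV. \<sigma> (\<beta> (k - h \<sigma>)))"
      unfolding aut_prod[OF subfield \<sigma>] by (rule prod_shift[symmetric])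
    also have "\<dots> = zp (\<Sum>k\<in>UNIV. x \<sigma> k) * ?b"
      by (simp add: x[OF \<sigma>] prod.distrib zp_sum)
    \<comment> \<open>By the norm equation \<open>?b / f\<close> is a p-th root of \<open>b\<close>,
      so the factor found here is the character of \<open>b\<close>.\<close>
    finally have "\<sigma> (?b / f) = zp (\<Sum>k\<in>UNIV. x \<sigma> k) * (?b / f)"
      by (simp add: aut_divide[OF subfield \<sigma>] aut_base[OF subfield \<sigma> f(1)])
    moreover have "(?b / f) ^ CARD('p) = b"
      using f(2) Bk(2) by (simp add: power_divide prod_power_distrib \<beta>p)
    ultimately show ?thesis using kchar_eqI[OF \<sigma>, of "?b / f" b] b0 f(2) by simp
  qed
  moreover have "(\<exists>\<sigma>\<in>G. \<forall>n\<in>auts Fa. x n k = kchar (\<sigma> B) n) \<or> (\<forall>n\<in>auts Fa. x n k = 0)" for k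
    using Bk(3)[of k]
  proof
    assume "\<exists>\<sigma>\<in>G. Bk k = \<sigma> B"
    then obtain \<sigma> where \<sigma>: "\<sigma> \<in> G" "Bk k = \<sigma> B" by blast
    have "x n k = kchar (\<sigma> B) n" if "n \<in> auts Fa" for n
    proof -
      have n: "n \<in> G" "h n = 0" using that by (simp_all add: auts_Fa)
      have "n (\<beta> k) = zp (x n k) * \<beta> k" using x[OF n(1), of k] n(2) by simp
      hence "kchar (Bk k) n = x n k" by (rule kchar_eqI[OF n(1) \<beta>p \<beta>(1)])
      thus ?thesis using \<sigma>(2) by simp
    qed
    thus ?thesis using \<sigma>(1) by blast
  next
    assume "Bk k = 1"
    hence "\<beta> k ^ CARD('p) = 1" using \<beta>p by simp
    then obtain i where i: "\<beta> k = zp i" using root_unity by blast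
    have "x n k = 0" if "n \<in> auts Fa" for n
    proof (rule x_eq)
      show n: "n \<in> G" using that by (simp add: auts_Fa)
      have "h n = 0" using that by (simp add: auts_Fa)
      thus "n (\<beta> (k - h n)) = zp 0 * \<beta> k" by (simp add: i aut_base[OF subfield n zp_in] zp_0)
    qed
    thus ?thesis by blast
  qed
  ultimately show thesis by (rule that)
qed

end
end

section \<open>Shapiro's lemma\<close>

context alg_over
begin

text \<open>Shapiro's lemma in degree two, on cochains: \<open>c\<close> is a cocycle with values in the functions on
  \<open>'m\<close>, and \<open>v\<close> trivialises, on the stabiliser \<open>N\<close>, its component at one point \<open>m\<close> of each orbit.
  The function \<open>w\<close> extends \<open>v\<close> to \<open>G\<close> by \<open>w (n \<circ> g) = v n + w g + c n g m\<close>, and the trivialisation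
  \<open>u\<close> of \<open>c\<close> is read off from \<open>w\<close>, since \<open>w g\<close> has to be \<open>u g m\<close>.\<close>

lemma shapiro2:
  fixes H :: "('k \<Rightarrow> 'k) \<Rightarrow> 'm::{ab_group_add, finite}"
    and c :: "('k \<Rightarrow> 'k) \<Rightarrow> ('k \<Rightarrow> 'k) \<Rightarrow> 'm \<Rightarrow> 'c::ab_group_add"
  defines "G \<equiv> auts F" and "S \<equiv> sep_closure F"
  defines "N \<equiv> {\<sigma> \<in> G. H \<sigma> = 0}"
  assumes H: "locally_const G S H" "\<And>\<sigma> \<tau>. \<sigma> \<in> G \<Longrightarrow> \<tau> \<in> G \<Longrightarrow> H (\<sigma> \<circ> \<tau>) = H \<sigma> + H \<tau>"
    and c_left: "\<And>\<tau> m. \<tau> \<in> G \<Longrightarrow> locally_const G S (\<lambda>\<sigma>. c \<sigma> \<tau> m)"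
    and c_right: "\<And>\<sigma> m. \<sigma> \<in> G \<Longrightarrow> locally_const G S (\<lambda>\<tau>. c \<sigma> \<tau> m)"
    and cocycle: "\<And>\<sigma> \<tau> \<rho> m. \<sigma> \<in> G \<Longrightarrow> \<tau> \<in> G \<Longrightarrow> \<rho> \<in> G \<Longrightarrow>
      c \<sigma> \<tau> m + c (\<sigma> \<circ> \<tau>) \<rho> m = c \<tau> \<rho> (m - H \<sigma>) + c \<sigma> (\<tau> \<circ> \<rho>) m"
    and triv: "\<And>m. \<exists>v. locally_const N S v \<and> (\<forall>n\<in>N. \<forall>n'\<in>N. v (n \<circ> n') = v n + v n' + c n n' m)"
  obtains u where "locally_const G S u"
    "\<And>\<sigma> \<tau> m. \<sigma> \<in> G \<Longrightarrow> \<tau> \<in> G \<Longrightarrow> u (\<sigma> \<circ> \<tau>) m = u \<sigma> m + u \<tau> (m - H \<sigma>) + c \<sigma> \<tau> m"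
proof -
  note comp = auts_comp[of _ F, folded G_def] and iv = aut_inv[folded G_def]
  have stable: "\<sigma> y \<in> S" if "\<sigma> \<in> G" "y \<in> S" for \<sigma> y
    using that sep_closure_stable unfolding G_def S_def by blast
  have H_id: "H id = 0" using H(2)[of id id] auts_id[of F] unfolding G_def by (metis add_cancel_right_right comp_id)
  have H_inv: "H (inv_into UNIV \<sigma>) = - H \<sigma>" if \<sigma>: "\<sigma> \<in> G" for \<sigma>
  proof -
    have "\<sigma> \<circ> inv_into UNIV \<sigma> = id" using iv(2)[OF \<sigma>] by auto
    hence "H \<sigma> + H (inv_into UNIV \<sigma>) = 0" using H(2)[OF \<sigma> iv(1)[OF \<sigma>]] H_id by simp
    thus ?thesis by (simp add: add_eq_0_iff)
  qed
  have quot: "\<sigma> \<circ> inv_into UNIV \<tau> \<in> N" "\<sigma> \<circ> inv_into UNIV \<tau> \<circ> \<tau> = \<sigma>"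
    if st: "\<sigma> \<in> G" "\<tau> \<in> G" "H \<sigma> = H \<tau>" for \<sigma> \<tau>
  proof -
    show "\<sigma> \<circ> inv_into UNIV \<tau> \<in> N"
      unfolding N_def using comp[OF st(1) iv(1)[OF st(2)]] H(2)[OF st(1) iv(1)[OF st(2)]] H_inv[OF st(2)] st(3)
      by simp
    show "\<sigma> \<circ> inv_into UNIV \<tau> \<circ> \<tau> = \<sigma>" using iv(3)[OF st(2)] by (simp add: fun_eq_iff)
  qed
  have NG: "n \<in> G" "H n = 0" if "n \<in> N" for n using that by (simp_all add: N_def)
  from triv obtain v where v: "\<And>m. locally_const N S (v m)"
    "\<And>m n n'. n \<in> N \<Longrightarrow> n' \<in> N \<Longrightarrow> v m (n \<circ> n') = v m n + v m n' + c n n' m" by metis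
  define t where "t i = (SOME \<sigma>. \<sigma> \<in> G \<and> H \<sigma> = i)" for i
  have t: "t i \<in> G" "H (t i) = i" if "i \<in> H ` G" for i
  proof -
    have "\<exists>\<sigma>. \<sigma> \<in> G \<and> H \<sigma> = i" using that by blast
    from someI_ex[OF this] show "t i \<in> G" "H (t i) = i" by (simp_all add: t_def)
  qed
  \<comment> \<open>Each \<open>g\<close> is an element of \<open>N\<close> times the representative
    \<open>t (H g)\<close>; the extension rule together with the value 0 at representatives forces
    this formula.\<close>
  define w where "w m g = v m (g \<circ> inv_into UNIV (t (H g))) + c (g \<circ> inv_into UNIV (t (H g))) (t (H g)) m" for m g
  have w_N: "w m (n \<circ> g) = v m n + w m g + c n g m" if n: "n \<in> N" and g: "g \<in> G" for m n g
  proof -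
    let ?s = "t (H g)"
    have s: "?s \<in> G" "H g = H ?s" using t[of "H g"] g by auto
    let ?k = "g \<circ> inv_into UNIV ?s"
    note k = quot[OF g s]
    have Hng: "H (n \<circ> g) = H g" using H(2)[OF NG(1)[OF n] g] NG(2)[OF n] by simp
    have "w m (n \<circ> g) = v m (n \<circ> ?k) + c (n \<circ> ?k) ?s m" by (simp add: w_def Hng comp_assoc)
    moreover have "c n ?k m + c (n \<circ> ?k) ?s m = c ?k ?s m + c n (?k \<circ> ?s) m"
      using cocycle[OF NG(1)[OF n] NG(1)[OF k(1)] s(1), of m] NG(2)[OF n] by simp
    ultimately show ?thesis
      unfolding k(2) v(2)[OF n k(1)] w_def by (simp add: algebra_simps)
  qed
  \<comment> \<open>The cocycle identity cancels the contribution of \<open>N\<close>, so this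
    difference depends only on the value \<open>H g\<close>. Hence the choice of \<open>s\<close>
    below does not affect \<open>u\<close>.\<close>
  have w_coset: "w m (g \<circ> \<rho>) - w m g - c g \<rho> m = w m (g1 \<circ> \<rho>) - w m g1 - c g1 \<rho> m"
    if g: "g \<in> G" "g1 \<in> G" "H g = H g1" and \<rho>: "\<rho> \<in> G" for m g g1 \<rho>
  proof -
    let ?n = "g \<circ> inv_into UNIV g1"
    note n = quot[OF g]
    have "w m (g \<circ> \<rho>) = v m ?n + w m (g1 \<circ> \<rho>) + c ?n (g1 \<circ> \<rho>) m"
      using w_N[OF n(1) comp[OF g(2) \<rho>], of m] n(2) by (metis comp_assoc)
    moreover have "w m g = v m ?n + w m g1 + c ?n g1 m"
      using w_N[OF n(1) g(2), of m] n(2) by simp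
    moreover have "c ?n g1 m + c g \<rho> m = c g1 \<rho> m + c ?n (g1 \<circ> \<rho>) m"
      using cocycle[OF NG(1)[OF n(1)] g(2) \<rho>, of m] NG(2)[OF n(1)] n(2) by simp
    ultimately show ?thesis by (simp add: algebra_simps)
  qed
  have HG: "0 \<in> H ` G" "i \<in> H ` G \<Longrightarrow> j \<in> H ` G \<Longrightarrow> i + j \<in> H ` G" "i \<in> H ` G \<Longrightarrow> - i \<in> H ` G" for i j
  proof -
    show "0 \<in> H ` G" using H_id auts_id[of F] unfolding G_def by (metis imageI)
    show "i + j \<in> H ` G" if "i \<in> H ` G" "j \<in> H ` G"
      using that H(2) comp by (metis (no_types, lifting) imageE imageI)
    show "- i \<in> H ` G" if "i \<in> H ` G"
      using that H_inv iv(1) by (metis (no_types, lifting) imageE imageI)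
  qed
  \<comment> \<open>The image of \<open>H\<close> may be a proper subgroup: \<open>r m\<close> picks
    one point in the orbit of \<open>m\<close>, and \<open>s m\<close> below is an automorphism
    whose shift moves \<open>m\<close> to it.\<close>
  define r where "r m = (SOME m'. m' - m \<in> H ` G)" for m
  have r: "r m - m \<in> H ` G" for m
    unfolding r_def by (rule someI[of _ m]) (simp add: HG)
  have r_orbit: "r (m - i) = r m" if i: "i \<in> H ` G" for m i
  proof -
    have "m' - (m - i) \<in> H ` G \<longleftrightarrow> m' - m \<in> H ` G" for m'
      using HG(2)[OF _ i, of "m' - m"] HG(2)[OF _ HG(3)[OF i], of "m' - (m - i)"]
      by (auto simp: algebra_simps)
    thus ?thesis by (simp add: r_def)
  qed
  define s where "s m = t (r m - m)" for m
  have s: "s m \<in> G" "H (s m) = r m - m" for m using t[OF r[of m]] by (simp_all add: s_def)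
  \<comment> \<open>This solves the desired identity for \<open>s m\<close> and \<open>g\<close> at
    the point \<open>r m\<close>: there \<open>r m - H (s m)\<close> is \<open>m\<close>, and the
    values of \<open>u\<close> at \<open>r m\<close> are replaced by those of
    \<open>w\<close>.\<close>
  define u where "u g m = w (r m) (s m \<circ> g) - w (r m) (s m) - c (s m) g (r m)" for g m
  have u_eq: "u \<rho> m = w (r m) (g \<circ> \<rho>) - w (r m) g - c g \<rho> (r m)"
    if "g \<in> G" "H g = r m - m" "\<rho> \<in> G" for g \<rho> m
    unfolding u_def using w_coset[OF s(1) that(1) _ that(3)] s(2) that(2) by simp
  have "u (\<sigma> \<circ> \<tau>) m = u \<sigma> m + u \<tau> (m - H \<sigma>) + c \<sigma> \<tau> m" if st: "\<sigma> \<in> G" "\<tau> \<in> G" for \<sigma> \<tau> m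
  proof -
    let ?g = "s m"
    have rm: "r (m - H \<sigma>) = r m" using st(1) by (intro r_orbit) blast
    have "u \<tau> (m - H \<sigma>) = w (r m) (?g \<circ> \<sigma> \<circ> \<tau>) - w (r m) (?g \<circ> \<sigma>) - c (?g \<circ> \<sigma>) \<tau> (r m)"
      using u_eq[OF comp[OF s(1) st(1)] _ st(2), of m "m - H \<sigma>"] H(2)[OF s(1) st(1)] s(2) rm by simp
    moreover have "c ?g \<sigma> (r m) + c (?g \<circ> \<sigma>) \<tau> (r m) = c \<sigma> \<tau> m + c ?g (\<sigma> \<circ> \<tau>) (r m)"
      using cocycle[OF s(1) st, of m "r m"] s(2) by simp
    hence "c (?g \<circ> \<sigma>) \<tau> (r m) = c \<sigma> \<tau> m + c ?g (\<sigma> \<circ> \<tau>) (r m) - c ?g \<sigma> (r m)"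
      by (simp add: eq_diff_eq add.commute)
    ultimately show ?thesis unfolding u_def[of "\<sigma> \<circ> \<tau>"] u_def[of \<sigma>]
      by (simp add: algebra_simps comp_assoc)
  qed
  \<comment> \<open>Near \<open>\<sigma>\<close> the value of \<open>H\<close>, and with it the
    representative \<open>q\<close>, is constant; continuity of \<open>v\<close> and of
    \<open>c\<close> in its first argument is then carried over by right translation.\<close>
  moreover have w_lc: "locally_const G S (w m)" for m
  proof (rule locally_constI)
    fix \<sigma> assume \<sigma>: "\<sigma> \<in> G"
    define q where "q = t (H \<sigma>)"
    have q: "q \<in> G" "H \<sigma> = H q" using t[of "H \<sigma>"] \<sigma> by (auto simp: q_def)
    let ?i = "inv_into UNIV q"
    note iq = iv(1)[OF q(1)]
    obtain T1 where T1: "finite T1" "T1 \<subseteq> S" "\<And>\<tau>. \<tau> \<in> G \<Longrightarrow> (\<And>x. x \<in> T1 \<Longrightarrow> \<tau> x = \<sigma> x) \<Longrightarrow> H \<tau> = H \<sigma>"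
      using locally_constE[OF H(1) \<sigma>] by metis
    obtain T2 where T2: "finite T2" "T2 \<subseteq> S"
      "\<forall>\<tau>. \<tau> \<circ> ?i \<in> N \<longrightarrow> (\<forall>x\<in>T2. \<tau> x = \<sigma> x) \<longrightarrow> v m (\<tau> \<circ> ?i) = v m (\<sigma> \<circ> ?i)"
      using locally_const_right_at[OF v(1) stable[OF iq] quot(1)[OF \<sigma> q]] by metis
    obtain T3 where T3: "finite T3" "T3 \<subseteq> S"
      "\<forall>\<tau>. \<tau> \<circ> ?i \<in> G \<longrightarrow> (\<forall>x\<in>T3. \<tau> x = \<sigma> x) \<longrightarrow> c (\<tau> \<circ> ?i) q m = c (\<sigma> \<circ> ?i) q m"
      using locally_const_right_at[OF c_left[OF q(1)] stable[OF iq] comp[OF \<sigma> iq]] by metis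
    have "w m \<tau> = w m \<sigma>" if \<tau>: "\<tau> \<in> G" "\<forall>x\<in>T1 \<union> T2 \<union> T3. \<tau> x = \<sigma> x" for \<tau>
    proof -
      have Ht: "H \<tau> = H \<sigma>" using T1(3)[OF \<tau>(1)] \<tau>(2) by simp
      have N': "\<tau> \<circ> ?i \<in> N" using quot(1)[OF \<tau>(1) q(1)] Ht q(2) by simp
      have "v m (\<tau> \<circ> ?i) = v m (\<sigma> \<circ> ?i)" using T2(3) N' \<tau>(2) by simp
      moreover have "c (\<tau> \<circ> ?i) q m = c (\<sigma> \<circ> ?i) q m" using T3(3) NG(1)[OF N'] \<tau>(2) by simp
      ultimately show ?thesis unfolding w_def Ht q_def[symmetric] by simp
    qed
    thus "\<exists>T. finite T \<and> T \<subseteq> S \<and> (\<forall>\<tau>\<in>G. (\<forall>x\<in>T. \<tau> x = \<sigma> x) \<longrightarrow> w m \<tau> = w m \<sigma>)"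
      using T1(1,2) T2(1,2) T3(1,2) by (intro exI[of _ "T1 \<union> T2 \<union> T3"]) simp
  qed
  have "locally_const G S u"
  proof (rule locally_const_fun)
    fix m
    have "locally_const G S (\<lambda>g. w (r m) (s m \<circ> g))"
      by (rule locally_const_left[OF w_lc comp[OF s(1)]])
    from locally_const_compose2[OF this c_right[OF s(1), of m "r m"], of "\<lambda>y z. y - w (r m) (s m) - z"]
    show "locally_const G S (\<lambda>g. u g m)" unfolding u_def .
  qed
  ultimately show thesis by (intro that)
qed

end

section \<open>Continuous maps and symbols\<close>

lemma topspace_krull: "topspace (krull_topology K L) = carrier (gal_group K L)"
  unfolding krull_topology_def topology_generated_by_topspace by blast

lemma krull_open_nbhd:
  assumes "openin (krull_topology K L) U" "\<sigma> \<in> U"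
  shows "\<exists>T. finite T \<and> T \<subseteq> L \<and> (\<forall>\<tau>\<in>carrier (gal_group K L). (\<forall>x\<in>T. \<tau> x = \<sigma> x) \<longrightarrow> \<tau> \<in> U)"
  using assms unfolding krull_topology_def openin_topology_generated_by_iff
proof (induction rule: generate_topology_on.induct)
  case Empty
  thus ?case by simp
next
  case (Int a b)
  from Int obtain A where A: "finite A" "A \<subseteq> L" "\<forall>\<tau>\<in>carrier (gal_group K L). (\<forall>x\<in>A. \<tau> x = \<sigma> x) \<longrightarrow> \<tau> \<in> a" by blast
  from Int obtain B where B: "finite B" "B \<subseteq> L" "\<forall>\<tau>\<in>carrier (gal_group K L). (\<forall>x\<in>B. \<tau> x = \<sigma> x) \<longrightarrow> \<tau> \<in> b" by blast
  show ?case using A B by (intro exI[of _ "A \<union> B"]) simp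
next
  case (UN Us)
  then obtain k where k: "k \<in> Us" "\<sigma> \<in> k" by blast
  from UN.IH[OF k] obtain T where T: "finite T" "T \<subseteq> L"
    "\<forall>\<tau>\<in>carrier (gal_group K L). (\<forall>x\<in>T. \<tau> x = \<sigma> x) \<longrightarrow> \<tau> \<in> k" by (elim exE conjE)
  show ?case
    using T(3) by (intro exI[of _ T] conjI T(1,2) ballI impI UnionI[OF k(1)]) simp
next
  case (Basis s)
  then obtain \<rho> T where s: "s = {\<tau> \<in> carrier (gal_group K L). \<forall>x\<in>T. \<tau> x = \<rho> x}" "finite T" "T \<subseteq> L" by blast
  thus ?case using Basis(2) by (intro exI[of _ T]) simp
qed

lemma continuous_krull_iff:
  "continuous_map (krull_topology K L) (discrete_topology UNIV) f \<longleftrightarrow> locally_const (carrier (gal_group K L)) L f"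
proof
  assume f: "continuous_map (krull_topology K L) (discrete_topology UNIV) f"
  show "locally_const (carrier (gal_group K L)) L f"
  proof (rule locally_constI)
    fix \<sigma> assume \<sigma>: "\<sigma> \<in> carrier (gal_group K L)"
    have "openin (krull_topology K L) {\<tau> \<in> topspace (krull_topology K L). f \<tau> \<in> {f \<sigma>}}"
      by (rule openin_continuous_map_preimage[OF f]) simp
    from krull_open_nbhd[OF this, of \<sigma>] \<sigma>
    show "\<exists>T. finite T \<and> T \<subseteq> L \<and> (\<forall>\<tau>\<in>carrier (gal_group K L). (\<forall>x\<in>T. \<tau> x = \<sigma> x) \<longrightarrow> f \<tau> = f \<sigma>)"
      by (simp add: topspace_krull)
  qed
next
  assume lc: "locally_const (carrier (gal_group K L)) L f"
  have "openin (krull_topology K L) {\<sigma> \<in> topspace (krull_topology K L). f \<sigma> \<in> V}" for V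
    unfolding topspace_krull
  proof (subst openin_subopen, intro ballI)
    fix \<sigma> assume \<sigma>: "\<sigma> \<in> {\<sigma> \<in> carrier (gal_group K L). f \<sigma> \<in> V}"
    then obtain T where T: "finite T" "T \<subseteq> L"
      "\<And>\<tau>. \<tau> \<in> carrier (gal_group K L) \<Longrightarrow> (\<And>x. x \<in> T \<Longrightarrow> \<tau> x = \<sigma> x) \<Longrightarrow> f \<tau> = f \<sigma>"
      using locally_constE[OF lc, of \<sigma>] by auto
    let ?U = "{\<tau> \<in> carrier (gal_group K L). \<forall>x\<in>T. \<tau> x = \<sigma> x}"
    have "openin (krull_topology K L) ?U"
      unfolding krull_topology_def by (rule topology_generated_by_Basis) (use T(1,2) \<sigma> in blast)
    moreover have "\<sigma> \<in> ?U" using \<sigma> by simp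
    moreover have "?U \<subseteq> {\<sigma> \<in> carrier (gal_group K L). f \<sigma> \<in> V}"
    proof
      fix \<tau> assume \<tau>: "\<tau> \<in> ?U"
      hence "f \<tau> = f \<sigma>" by (intro T(3)) simp_all
      thus "\<tau> \<in> {\<sigma> \<in> carrier (gal_group K L). f \<sigma> \<in> V}" using \<tau> \<sigma> by simp
    qed
    ultimately show "\<exists>U. openin (krull_topology K L) U \<and> \<sigma> \<in> U \<and> U \<subseteq> {\<sigma> \<in> carrier (gal_group K L). f \<sigma> \<in> V}"
      by (intro exI[of _ ?U] conjI)
  qed
  thus "continuous_map (krull_topology K L) (discrete_topology UNIV) f"
    by (simp add: continuous_map_def)
qed

lemma locally_const_restrict:
  "locally_const ((\<lambda>\<sigma>. restrict \<sigma> S) ` G) S f \<longleftrightarrow> locally_const G S (\<lambda>\<sigma>. f (restrict \<sigma> S))"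
proof -
  have eq: "(\<forall>x\<in>T. restrict \<tau> S x = restrict \<sigma> S x) \<longleftrightarrow> (\<forall>x\<in>T. \<tau> x = \<sigma> x)" if "T \<subseteq> S" for T \<sigma> \<tau>
    by (rule ball_cong) (use that in auto)
  have "(finite T \<and> T \<subseteq> S \<and> (\<forall>\<tau>\<in>G. (\<forall>x\<in>T. restrict \<tau> S x = restrict \<sigma> S x) \<longrightarrow> Q \<tau>)) \<longleftrightarrow>
      (finite T \<and> T \<subseteq> S \<and> (\<forall>\<tau>\<in>G. (\<forall>x\<in>T. \<tau> x = \<sigma> x) \<longrightarrow> Q \<tau>))" for T \<sigma> Q
  proof (cases "T \<subseteq> S")
    case True
    show ?thesis by (simp only: eq[OF True])
  qed simp
  thus ?thesis unfolding locally_const_def by (simp only: ball_simps)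
qed

text \<open>Local constancy tests points of \<open>S\<close> only, so automorphisms with equal
  restriction to \<open>S\<close> have equal values. This carries maps on \<open>auts F\<close> back
  to the absolute Galois group.\<close>

lemma locally_const_descend:
  assumes "locally_const G S f"
  obtains f' where "\<And>\<sigma>. \<sigma> \<in> G \<Longrightarrow> f' (restrict \<sigma> S) = f \<sigma>"
proof -
  define r where "r \<rho> = (SOME \<sigma>. \<sigma> \<in> G \<and> restrict \<sigma> S = \<rho>)" for \<rho>
  have "f (r (restrict \<sigma> S)) = f \<sigma>" if \<sigma>: "\<sigma> \<in> G" for \<sigma>
  proof -
    have "r (restrict \<sigma> S) \<in> G \<and> restrict (r (restrict \<sigma> S)) S = restrict \<sigma> S"
      unfolding r_def by (rule someI[of _ \<sigma>]) (simp add: \<sigma>)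
    hence r: "r (restrict \<sigma> S) \<in> G" "\<And>x. x \<in> S \<Longrightarrow> r (restrict \<sigma> S) x = \<sigma> x" by (auto dest: fun_cong split: if_splits simp: restrict_def)
    obtain T where T: "T \<subseteq> S" "\<And>\<tau>. \<tau> \<in> G \<Longrightarrow> (\<And>x. x \<in> T \<Longrightarrow> \<tau> x = \<sigma> x) \<Longrightarrow> f \<tau> = f \<sigma>"
      using locally_constE[OF assms \<sigma>] by metis
    show ?thesis using r T(1) by (intro T(2)) auto
  qed
  thus thesis using that[of "\<lambda>\<rho>. f (r \<rho>)"] by simp
qed

section \<open>The absolute Galois group and the vanishing of symbols\<close>

context alg_over
begin

lemma abs_gal_carrier: "carrier (abs_gal F) = (\<lambda>\<sigma>. restrict \<sigma> (sep_closure F)) ` auts F"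
  unfolding abs_gal_def by (rule carrier_gal_group[OF normal_ext_sep_closure])

lemma abs_gal_mult:
  "\<sigma> \<in> auts F \<Longrightarrow> \<tau> \<in> auts F \<Longrightarrow>
    restrict \<sigma> (sep_closure F) \<otimes>\<^bsub>abs_gal F\<^esub> restrict \<tau> (sep_closure F) = restrict (\<sigma> \<circ> \<tau>) (sep_closure F)"
  unfolding abs_gal_def by (rule mult_gal_group[OF normal_ext_sep_closure])

lemma abs_gal_closed: "\<rho> \<in> carrier (abs_gal F) \<Longrightarrow> \<rho>' \<in> carrier (abs_gal F) \<Longrightarrow> \<rho> \<otimes>\<^bsub>abs_gal F\<^esub> \<rho>' \<in> carrier (abs_gal F)"
  unfolding abs_gal_carrier using abs_gal_mult auts_comp by fastforce

lemma continuous_abs_gal: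
  "continuous_map (abs_gal_top F) (discrete_topology UNIV) f \<longleftrightarrow>
     locally_const (auts F) (sep_closure F) (\<lambda>\<sigma>. f (restrict \<sigma> (sep_closure F)))"
  unfolding abs_gal_top_def continuous_krull_iff carrier_gal_group[OF normal_ext_sep_closure]
  by (rule locally_const_restrict)

lemma cochains1_iff:
  "f \<in> cochains1 (abs_gal F) (abs_gal_top F) \<longleftrightarrow> f \<in> extensional (carrier (abs_gal F)) \<and>
     locally_const (auts F) (sep_closure F) (\<lambda>\<sigma>. f (restrict \<sigma> (sep_closure F)))"
  by (simp add: cochains1_def continuous_abs_gal)

lemma cochains1_compose2:
  assumes "f \<in> cochains1 (abs_gal F) (abs_gal_top F)" "g \<in> cochains1 (abs_gal F) (abs_gal_top F)"
  shows "(\<lambda>s\<in>carrier (abs_gal F). h (f s) (g s)) \<in> cochains1 (abs_gal F) (abs_gal_top F)"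
  unfolding cochains1_iff
proof (intro conjI restrict_extensional)
  show "locally_const (auts F) (sep_closure F)
      (\<lambda>\<sigma>. (\<lambda>s\<in>carrier (abs_gal F). h (f s) (g s)) (restrict \<sigma> (sep_closure F)))"
    by (rule locally_const_cong[OF locally_const_compose2[of _ _ "\<lambda>\<sigma>. f (restrict \<sigma> (sep_closure F))"
          "\<lambda>\<sigma>. g (restrict \<sigma> (sep_closure F))" h]])
      (use assms in \<open>auto simp: cochains1_iff abs_gal_carrier\<close>)
qed

text \<open>The symbol is a coset of the coboundaries, hence the unit exactly if the cup product
  cochain is a coboundary. The function \<open>v\<close> is minus the bounding cochain, which
  matches the sign of the correction term in \<open>U5_mult\<close>.\<close>

lemma symbol_trivial_iff:
  fixes \<zeta> :: 'k and P :: "'p::prime_card itself"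
  assumes y: "proot CARD('p) y \<in> sep_closure F" and z: "proot CARD('p) z \<in> sep_closure F"
  shows "symbol P \<zeta> F y z = \<one>\<^bsub>H2_field P F\<^esub> \<longleftrightarrow>
    (\<exists>v :: _ \<Rightarrow> 'p mod_ring. locally_const (auts F) (sep_closure F) v \<and>
      (\<forall>n\<in>auts F. \<forall>n'\<in>auts F. v (n \<circ> n') = v n + v n' + kummer_char \<zeta> y n * kummer_char \<zeta> z n'))"
    (is "?sym \<longleftrightarrow> ?triv")
proof -
  let ?A = "carrier (abs_gal F)" and ?S = "sep_closure F"
  let ?C1 = "cochains1 (abs_gal F) (abs_gal_top F) :: (_ \<Rightarrow> 'p mod_ring) set"
  let ?C = "coboundaries2 (abs_gal F) (abs_gal_top F) :: (_ \<Rightarrow> 'p mod_ring) set"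
  let ?d = "coboundary1 (abs_gal F) :: (_ \<Rightarrow> 'p mod_ring) \<Rightarrow> _"
  define cup :: "('k \<Rightarrow> 'k) \<times> ('k \<Rightarrow> 'k) \<Rightarrow> 'p mod_ring"
    where "cup = (\<lambda>(s, t)\<in>?A \<times> ?A. kummer_char \<zeta> y s * kummer_char \<zeta> z t)"
  have sym: "symbol P \<zeta> F y z = (\<lambda>f. \<lambda>x\<in>?A \<times> ?A. f x + cup x) ` ?C"
    by (auto simp: symbol_def cup11_def r_coset_def cocycles2_def cup_def)
  have one: "\<one>\<^bsub>H2_field P F\<^esub> = ?C"
    by (simp add: H2_field_def H2_def FactGroup_def)
  have zero: "(\<lambda>x\<in>?A \<times> ?A. 0) \<in> ?C"
  proof -
    have "(\<lambda>s\<in>?A. 0) \<in> ?C1"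
      unfolding cochains1_iff
      by (intro conjI restrict_extensional locally_const_cong[OF locally_const_const[of _ _ 0]])
        (auto simp: abs_gal_carrier)
    moreover have "?d (\<lambda>s\<in>?A. 0) = (\<lambda>x\<in>?A \<times> ?A. 0)"
      using abs_gal_closed by (auto simp: coboundary1_def fun_eq_iff)
    ultimately show ?thesis unfolding coboundaries2_def by force
  qed
  have d_add: "?d (\<lambda>s\<in>?A. f s + g s) = (\<lambda>x\<in>?A \<times> ?A. ?d f x + ?d g x)" for f g
    using abs_gal_closed by (auto simp: coboundary1_def fun_eq_iff)
  have d_diff: "?d (\<lambda>s\<in>?A. f s - g s) = (\<lambda>x\<in>?A \<times> ?A. ?d f x - ?d g x)" for f g
    using abs_gal_closed by (auto simp: coboundary1_def fun_eq_iff)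
  have d_ext: "?d f = (\<lambda>x\<in>?A \<times> ?A. ?d f x)" for f
    by (auto simp: coboundary1_def fun_eq_iff)
  have "?sym \<longleftrightarrow> cup \<in> ?C"
  proof
    assume ?sym
    hence img: "(\<lambda>f. \<lambda>x\<in>?A \<times> ?A. f x + cup x) ` ?C = ?C" unfolding sym one .
    have z: "cup = (\<lambda>x\<in>?A \<times> ?A. (\<lambda>x\<in>?A \<times> ?A. 0) x + cup x)"
      by (auto simp: cup_def fun_eq_iff)
    have "cup \<in> (\<lambda>f. \<lambda>x\<in>?A \<times> ?A. f x + cup x) ` ?C"
      by (rule image_eqI[where x = "\<lambda>x\<in>?A \<times> ?A. 0"]) (rule z, rule zero)
    thus "cup \<in> ?C" unfolding img .
  next
    assume "cup \<in> ?C"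
    then obtain g where g: "g \<in> ?C1" "cup = ?d g" unfolding coboundaries2_def by blast
    show ?sym unfolding sym one
    proof (rule equalityI; rule subsetI)
      fix f' assume "f' \<in> (\<lambda>f. \<lambda>x\<in>?A \<times> ?A. f x + cup x) ` ?C"
      then obtain f where f: "f \<in> ?C1" "f' = (\<lambda>x\<in>?A \<times> ?A. ?d f x + ?d g x)"
        unfolding coboundaries2_def g(2) by blast
      have "f' = ?d (\<lambda>s\<in>?A. f s + g s)" unfolding d_add by (rule f(2))
      thus "f' \<in> ?C" unfolding coboundaries2_def using cochains1_compose2[OF f(1) g(1), of "(+)"] by blast
    next
      fix f' assume "f' \<in> ?C"
      then obtain f where f: "f \<in> ?C1" "f' = ?d f" unfolding coboundaries2_def by blast
      have "f' = (\<lambda>x\<in>?A \<times> ?A. ?d (\<lambda>s\<in>?A. f s - g s) x + cup x)"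
        unfolding d_diff g(2) f(2) by (subst d_ext) (auto simp: fun_eq_iff)
      moreover have "?d (\<lambda>s\<in>?A. f s - g s) \<in> ?C"
        unfolding coboundaries2_def using cochains1_compose2[OF f(1) g(1), of "(-)"] by blast
      ultimately show "f' \<in> (\<lambda>f. \<lambda>x\<in>?A \<times> ?A. f x + cup x) ` ?C" by blast
    qed
  qed
  also have "\<dots> \<longleftrightarrow> ?triv"
  proof -
    have chi: "kummer_char \<zeta> y (restrict n ?S) = (kummer_char \<zeta> y n :: 'p mod_ring)"
      "kummer_char \<zeta> z (restrict n ?S) = (kummer_char \<zeta> z n :: 'p mod_ring)" for n
      using y z by (simp_all add: kummer_char_def)
    have cup_d: "cup = ?d g \<longleftrightarrow> (\<forall>n\<in>auts F. \<forall>n'\<in>auts F. kummer_char \<zeta> y n * kummer_char \<zeta> z n' =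
        g (restrict n' ?S) - g (restrict (n \<circ> n') ?S) + g (restrict n ?S))" for g
    proof -
      have "cup = ?d g \<longleftrightarrow> (\<forall>s\<in>?A. \<forall>t\<in>?A. kummer_char \<zeta> y s * kummer_char \<zeta> z t = g t - g (s \<otimes>\<^bsub>abs_gal F\<^esub> t) + g s)"
        by (auto simp: cup_def coboundary1_def fun_eq_iff)
      thus ?thesis unfolding abs_gal_carrier by (simp add: abs_gal_mult chi)
    qed
    show ?thesis
    proof
      assume "cup \<in> ?C"
      then obtain g where g: "g \<in> ?C1" "cup = ?d g" unfolding coboundaries2_def by blast
      let ?v = "\<lambda>n. - g (restrict n ?S)"
      have "locally_const (auts F) ?S ?v"
        by (rule locally_const_compose[of _ _ "\<lambda>n. g (restrict n ?S)" uminus])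
          (use g(1) in \<open>simp add: cochains1_iff\<close>)
      moreover have "?v (n \<circ> n') = ?v n + ?v n' + kummer_char \<zeta> y n * kummer_char \<zeta> z n'"
        if "n \<in> auts F" "n' \<in> auts F" for n n'
        using g(2)[unfolded cup_d] that by simp
      ultimately show ?triv by blast
    next
      assume ?triv
      then obtain v :: "('k \<Rightarrow> 'k) \<Rightarrow> 'p mod_ring" where v: "locally_const (auts F) ?S v"
        "\<And>n n'. n \<in> auts F \<Longrightarrow> n' \<in> auts F \<Longrightarrow> v (n \<circ> n') = v n + v n' + kummer_char \<zeta> y n * kummer_char \<zeta> z n'" by blast
      obtain v' where v': "\<And>n. n \<in> auts F \<Longrightarrow> v' (restrict n ?S) = v n"
        using locally_const_descend[OF v(1)] by blast
      let ?g = "\<lambda>s\<in>?A. - v' s"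
      have g: "?g (restrict n ?S) = - v n" if "n \<in> auts F" for n
        using that v' by (auto simp: abs_gal_carrier)
      have "?g \<in> ?C1" unfolding cochains1_iff
        by (intro conjI restrict_extensional locally_const_cong[OF locally_const_compose[OF v(1), of uminus] g])
      moreover have "cup = ?d ?g"
        unfolding cup_d by (intro ballI) (simp add: g auts_comp v(2) del: restrict_apply)
      ultimately show "cup \<in> ?C" unfolding coboundaries2_def by blast
    qed
  qed
  finally show ?thesis .
qed

end

section \<open>The two assertions in terms of automorphisms\<close>

text \<open>The \<open>\<chi>i\<close> stand for the components \<open>si\<close> of a homomorphism to \<open>U\<^sub>5\<close>-tilde.\<close>

definition U5_lift ::
  "('k \<Rightarrow> 'k) set \<Rightarrow> 'k set \<Rightarrow> (('k \<Rightarrow> 'k) \<Rightarrow> 'p::prime_card mod_ring) \<Rightarrow> _ \<Rightarrow> _ \<Rightarrow> _ \<Rightarrow> _ \<Rightarrow> _ \<Rightarrow> _ \<Rightarrow> bool" where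
  "U5_lift G S \<chi>1 \<chi>2 \<chi>3 \<chi>4 u x1 x2 \<longleftrightarrow>
     locally_const G S u \<and> locally_const G S x1 \<and> locally_const G S x2 \<and>
     (\<forall>\<sigma>\<in>G. R_aug (x1 \<sigma>) = \<chi>2 \<sigma> \<and> R_aug (x2 \<sigma>) = \<chi>3 \<sigma>) \<and>
     (\<forall>\<sigma>\<in>G. \<forall>\<tau>\<in>G. \<forall>k l. x1 (\<sigma> \<circ> \<tau>) k = x1 \<sigma> k + x1 \<tau> (k - \<chi>1 \<sigma>) \<and> x2 (\<sigma> \<circ> \<tau>) l = x2 \<sigma> l + x2 \<tau> (l - \<chi>4 \<sigma>) \<and>
        u (\<sigma> \<circ> \<tau>) (k, l) = u \<sigma> (k, l) + u \<tau> (k - \<chi>1 \<sigma>, l - \<chi>4 \<sigma>) + x1 \<sigma> k * x2 \<tau> (l - \<chi>4 \<sigma>))"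

context kummer
begin

text \<open>Multiplicativity in \<open>U5_tilde\<close>, read by coordinates, is the two cocycle
  rules together with the twisted additivity of \<open>u\<close>; local constancy allows passing
  between \<open>G\<close> and its restrictions to \<open>S\<close>.\<close>

lemma lifts_iff:
  assumes a: "a \<in> F" "a \<noteq> 0" and b: "b \<in> F" and c: "c \<in> F" and d: "d \<in> F" "d \<noteq> 0"
  shows "(\<exists>\<phi> \<in> hom (abs_gal F) (U5_tilde :: 'p U5 monoid).
      continuous_map (abs_gal_top F) (discrete_topology UNIV) \<phi> \<and>
      (\<forall>\<sigma>\<in>carrier (abs_gal F). s1 (\<phi> \<sigma>) = kchar a \<sigma> \<and> s2 (\<phi> \<sigma>) = kchar b \<sigma> \<and>
         s3 (\<phi> \<sigma>) = kchar c \<sigma> \<and> s4 (\<phi> \<sigma>) = kchar d \<sigma>)) \<longleftrightarrow>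
    (\<exists>u x1 x2. U5_lift G S (kchar a) (kchar b) (kchar c) (kchar d) u x1 x2)" (is "?L \<longleftrightarrow> ?R")
proof -
  have FS: "F \<subseteq> S" by (rule sep_closure_base[OF subfield])
  have chi: "kchar y (restrict \<sigma> S) = kchar y \<sigma>" if "y \<in> F" for y \<sigma>
    using kchar_restrict FS that by blast
  show ?thesis
  proof
    assume ?L
    then obtain \<phi> :: "('k \<Rightarrow> 'k) \<Rightarrow> 'p U5" where \<phi>: "\<phi> \<in> hom (abs_gal F) U5_tilde"
      "continuous_map (abs_gal_top F) (discrete_topology UNIV) \<phi>"
      "\<And>\<sigma>. \<sigma> \<in> carrier (abs_gal F) \<Longrightarrow> s1 (\<phi> \<sigma>) = kchar a \<sigma> \<and> s2 (\<phi> \<sigma>) = kchar b \<sigma> \<and>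
         s3 (\<phi> \<sigma>) = kchar c \<sigma> \<and> s4 (\<phi> \<sigma>) = kchar d \<sigma>" by blast
    define \<Phi> where "\<Phi> \<sigma> = \<phi> (restrict \<sigma> S)" for \<sigma>
    have lc: "locally_const G S \<Phi>" using \<phi>(2) unfolding continuous_abs_gal \<Phi>_def .
    have s: "s1 (\<Phi> \<sigma>) = kchar a \<sigma>" "s2 (\<Phi> \<sigma>) = kchar b \<sigma>" "s3 (\<Phi> \<sigma>) = kchar c \<sigma>" "s4 (\<Phi> \<sigma>) = kchar d \<sigma>"
      if "\<sigma> \<in> G" for \<sigma>
      using \<phi>(3)[of "restrict \<sigma> S"] that chi a b c d by (simp_all add: \<Phi>_def abs_gal_carrier)
    have mult: "\<Phi> (\<sigma> \<circ> \<tau>) = U5_mult (\<Phi> \<sigma>) (\<Phi> \<tau>)" if "\<sigma> \<in> G" "\<tau> \<in> G" for \<sigma> \<tau>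
      using hom_mult[OF \<phi>(1), of "restrict \<sigma> S" "restrict \<tau> S"] that
      by (simp add: \<Phi>_def abs_gal_carrier abs_gal_mult U5_tilde_def)
    have "U5_lift G S (kchar a) (kchar b) (kchar c) (kchar d) (\<lambda>\<sigma>. fst (\<Phi> \<sigma>))
        (\<lambda>\<sigma>. fst (fst (snd (\<Phi> \<sigma>)))) (\<lambda>\<sigma>. fst (snd (snd (\<Phi> \<sigma>))))"
      unfolding U5_lift_def
    proof (intro conjI ballI allI)
      show "locally_const G S (\<lambda>\<sigma>. fst (\<Phi> \<sigma>))" by (rule locally_const_compose[OF lc])
      show "locally_const G S (\<lambda>\<sigma>. fst (fst (snd (\<Phi> \<sigma>))))" by (rule locally_const_compose[OF lc])
      show "locally_const G S (\<lambda>\<sigma>. fst (snd (snd (\<Phi> \<sigma>))))" by (rule locally_const_compose[OF lc])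
      fix \<sigma> assume \<sigma>: "\<sigma> \<in> G"
      show "R_aug (fst (fst (snd (\<Phi> \<sigma>)))) = kchar b \<sigma>" using s(2)[OF \<sigma>] by (simp add: s2_def split_beta)
      show "R_aug (fst (snd (snd (\<Phi> \<sigma>)))) = kchar c \<sigma>" using s(3)[OF \<sigma>] by (simp add: s3_def split_beta)
      fix \<tau> k l assume \<tau>: "\<tau> \<in> G"
      have h: "snd (fst (snd (\<Phi> \<sigma>))) = kchar a \<sigma>" "snd (snd (snd (\<Phi> \<sigma>))) = kchar d \<sigma>"
        using s(1,4)[OF \<sigma>] by (simp_all add: s1_def s4_def split_beta)
      show "fst (fst (snd (\<Phi> (\<sigma> \<circ> \<tau>)))) k = fst (fst (snd (\<Phi> \<sigma>))) k + fst (fst (snd (\<Phi> \<tau>))) (k - kchar a \<sigma>)"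
        unfolding mult[OF \<sigma> \<tau>] by (simp add: U5_mult_def W_mult_def R_act_def split_beta h)
      show "fst (snd (snd (\<Phi> (\<sigma> \<circ> \<tau>)))) l = fst (snd (snd (\<Phi> \<sigma>))) l + fst (snd (snd (\<Phi> \<tau>))) (l - kchar d \<sigma>)"
        unfolding mult[OF \<sigma> \<tau>] by (simp add: U5_mult_def W_mult_def R_act_def split_beta h)
      show "fst (\<Phi> (\<sigma> \<circ> \<tau>)) (k, l) = fst (\<Phi> \<sigma>) (k, l) + fst (\<Phi> \<tau>) (k - kchar a \<sigma>, l - kchar d \<sigma>) +
          fst (fst (snd (\<Phi> \<sigma>))) k * fst (snd (snd (\<Phi> \<tau>))) (l - kchar d \<sigma>)"
        unfolding mult[OF \<sigma> \<tau>] by (simp add: U5_mult_def M_act_def R_tensor_def R_act_def split_beta h)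
    qed
    thus ?R by blast
  next
    assume ?R
    then obtain u x1 x2 where U: "U5_lift G S (kchar a) (kchar b) (kchar c) (kchar d) u x1 x2" by blast
    define \<Phi> :: "('k \<Rightarrow> 'k) \<Rightarrow> 'p U5" where "\<Phi> \<sigma> = (u \<sigma>, ((x1 \<sigma>, kchar a \<sigma>), (x2 \<sigma>, kchar d \<sigma>)))" for \<sigma>
    have lc: "locally_const G S \<Phi>"
      unfolding \<Phi>_def using U a(1) d(1) FS
      by (intro locally_const_compose2[of _ _ _ _ Pair] kchar_locally_const) (auto simp: U5_lift_def)
    have mult: "\<Phi> (\<sigma> \<circ> \<tau>) = U5_mult (\<Phi> \<sigma>) (\<Phi> \<tau>)" if "\<sigma> \<in> G" "\<tau> \<in> G" for \<sigma> \<tau>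
      using U that unfolding U5_lift_def
      by (auto simp: \<Phi>_def U5_mult_def W_mult_def M_act_def R_tensor_def R_act_def fun_eq_iff
          kchar_hom[OF a] kchar_hom[OF d])
    obtain \<phi> where \<phi>: "\<And>\<sigma>. \<sigma> \<in> G \<Longrightarrow> \<phi> (restrict \<sigma> S) = \<Phi> \<sigma>" using locally_const_descend[OF lc] by blast
    have "\<phi> \<in> hom (abs_gal F) U5_tilde"
    proof (rule homI)
      fix \<rho> \<rho>' assume "\<rho> \<in> carrier (abs_gal F)" "\<rho>' \<in> carrier (abs_gal F)"
      then obtain \<sigma> \<tau> where st: "\<sigma> \<in> G" "\<tau> \<in> G" "\<rho> = restrict \<sigma> S" "\<rho>' = restrict \<tau> S"
        unfolding abs_gal_carrier by blast
      show "\<phi> (\<rho> \<otimes>\<^bsub>abs_gal F\<^esub> \<rho>') = \<phi> \<rho> \<otimes>\<^bsub>U5_tilde\<^esub> \<phi> \<rho>'"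
        unfolding st(3,4) abs_gal_mult[OF st(1,2)]
        by (simp add: \<phi> st(1,2) auts_comp mult U5_tilde_def)
    qed (simp add: U5_tilde_def)
    moreover have "continuous_map (abs_gal_top F) (discrete_topology UNIV) \<phi>"
      unfolding continuous_abs_gal by (rule locally_const_cong[OF lc \<phi>])
    moreover have "s1 (\<phi> \<rho>) = kchar a \<rho> \<and> s2 (\<phi> \<rho>) = kchar b \<rho> \<and> s3 (\<phi> \<rho>) = kchar c \<rho> \<and> s4 (\<phi> \<rho>) = kchar d \<rho>"
      if \<rho>: "\<rho> \<in> carrier (abs_gal F)" for \<rho>
    proof -
      obtain \<sigma> where \<sigma>: "\<sigma> \<in> G" "\<rho> = restrict \<sigma> S" using \<rho> unfolding abs_gal_carrier by blast
      thus ?thesis using U a b c d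
        by (simp add: \<phi> chi \<Phi>_def s1_def s2_def s3_def s4_def U5_lift_def)
    qed
    ultimately show ?L by blast
  qed
qed

section \<open>Comparison over the field generated by both roots\<close>

context
  fixes a b c d :: 'k and Fa Fd Fad :: "'k set"
  assumes a: "a \<in> F" "a \<noteq> 0" and b: "b \<in> F" "b \<noteq> 0" and c: "c \<in> F" "c \<noteq> 0" and d: "d \<in> F" "d \<noteq> 0"
    and Fa: "Fa = adjoin F {proot CARD('p) a}" and Fd: "Fd = adjoin F {proot CARD('p) d}"
    and Fad: "Fad = adjoin F {proot CARD('p) a, proot CARD('p) d}"
begin

lemma auts_Fad: "auts Fad = {\<sigma> \<in> G. kchar a \<sigma> = 0 \<and> kchar d \<sigma> = 0}"
proof -
  have "auts Fad = auts Fa \<inter> auts Fd"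
    unfolding Fad Fa Fd auts_adjoin[OF subfield] by auto
  thus ?thesis unfolding auts_Fa[OF a Fa refl] auts_Fa[OF d Fd refl] by auto
qed

text \<open>\<open>Fad\<close> is normal over \<open>F\<close> inside \<open>S\<close>, so symbols
  over \<open>Fad\<close> can be tested by functions that are locally constant for the same
  \<open>S\<close>.\<close>

lemma sep_closure_Fad: "sep_closure Fad = S"
proof (rule sep_closure_normal_ext)
  have gen: "proot CARD('p) a \<in> Fad" "proot CARD('p) d \<in> Fad"
    unfolding Fad using adjoin_gens by blast+
  have sub: "Fa \<subseteq> Fad" "Fd \<subseteq> Fad"
    unfolding Fa Fd using gen by (simp_all add: Fad adjoin_least adjoin_subfield adjoin_base)
  have gens: "proot CARD('p) a \<in> Fa" "proot CARD('p) d \<in> Fd"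
    unfolding Fa Fd using adjoin_gens by blast+
  show "normal_ext Fad"
    unfolding normal_ext_def
  proof (intro conjI ballI)
    fix \<sigma> y assume \<sigma>: "\<sigma> \<in> G" and y: "y \<in> Fad"
    have "\<sigma> e \<in> adjoin F {proot CARD('p) a, proot CARD('p) d}" if "e \<in> {proot CARD('p) a, proot CARD('p) d}" for e
      using that Fa_stable[OF a Fa refl \<sigma> gens(1)] Fa_stable[OF d Fd refl \<sigma> gens(2)] sub unfolding Fad[symmetric] by auto
    thus "\<sigma> y \<in> Fad" using aut_adjoin_stable[OF subfield \<sigma> _ y[unfolded Fad]] unfolding Fad by simp
  qed (unfold Fad, rule adjoin_subfield, rule adjoin_base)
  show "Fad \<subseteq> S"
    unfolding Fad using rt_in_S a(1) d(1) sep_closure_base[OF subfield]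
    by (intro adjoin_least sep_closure_subfield) auto
qed

lemma symbol_Fad_iff:
  assumes "y \<in> S" "z \<in> S"
  shows "symbol P \<zeta> Fad y z = \<one>\<^bsub>H2_field P Fad\<^esub> \<longleftrightarrow>
    (\<exists>v. locally_const (auts Fad) S v \<and>
      (\<forall>n\<in>auts Fad. \<forall>n'\<in>auts Fad. v (n \<circ> n') = v n + v n' + kchar y n * kchar z n'))"
proof -
  have "alg_over Fad" unfolding Fad by (rule alg_over_extension[OF adjoin_subfield adjoin_base])
  from alg_over.symbol_trivial_iff[OF this, of y z P \<zeta>, unfolded sep_closure_Fad, OF rt_in_S[OF assms(1)] rt_in_S[OF assms(2)]]
  show ?thesis .
qed

text \<open>On \<open>auts Fad\<close> both shifts vanish, so the (k, l) coordinate of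
  \<open>u\<close> trivialises the cup product of the k-th coordinate of \<open>x1\<close> with the
  l-th of \<open>x2\<close>. One direction adds up such coordinates, the other assembles
  \<open>u\<close> from them by \<open>shapiro2\<close>.\<close>

lemma U5_lift_iff_symbols:
  "(\<exists>u x1 x2. U5_lift G S (kchar a) (kchar b) (kchar c) (kchar d) u x1 x2) \<longleftrightarrow>
    (\<exists>B\<in>Fa. \<exists>C\<in>Fd. (\<exists>f\<in>F. f \<noteq> 0 \<and> field_norm F Fa B = b * f ^ CARD('p)) \<and>
       (\<exists>f\<in>F. f \<noteq> 0 \<and> field_norm F Fd C = c * f ^ CARD('p)) \<and>
       (\<forall>\<sigma>\<in>carrier (gal_group F Fa). \<forall>\<tau>\<in>carrier (gal_group F Fd).
          symbol P \<zeta> Fad (\<sigma> B) (\<tau> C) = \<one>\<^bsub>H2_field P Fad\<^esub>))" (is "?L \<longleftrightarrow> ?R")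
proof
  assume ?L
  then obtain u x1 x2 where U: "U5_lift G S (kchar a) (kchar b) (kchar c) (kchar d) u x1 x2" by blast
  have lc: "locally_const G S u" "locally_const G S x1" "locally_const G S x2"
    and aug: "\<And>\<sigma>. \<sigma> \<in> G \<Longrightarrow> (\<Sum>k\<in>UNIV. x1 \<sigma> k) = kchar b \<sigma>" "\<And>\<sigma>. \<sigma> \<in> G \<Longrightarrow> (\<Sum>k\<in>UNIV. x2 \<sigma> k) = kchar c \<sigma>"
    and x1: "\<And>\<sigma> \<tau> k. \<sigma> \<in> G \<Longrightarrow> \<tau> \<in> G \<Longrightarrow> x1 (\<sigma> \<circ> \<tau>) k = x1 \<sigma> k + x1 \<tau> (k - kchar a \<sigma>)"
    and x2: "\<And>\<sigma> \<tau> k. \<sigma> \<in> G \<Longrightarrow> \<tau> \<in> G \<Longrightarrow> x2 (\<sigma> \<circ> \<tau>) k = x2 \<sigma> k + x2 \<tau> (k - kchar d \<sigma>)"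
    and u: "\<And>\<sigma> \<tau> k l. \<sigma> \<in> G \<Longrightarrow> \<tau> \<in> G \<Longrightarrow> u (\<sigma> \<circ> \<tau>) (k, l) =
       u \<sigma> (k, l) + u \<tau> (k - kchar a \<sigma>, l - kchar d \<sigma>) + x1 \<sigma> k * x2 \<tau> (l - kchar d \<sigma>)"
    using U by (simp_all add: U5_lift_def R_aug_def)
  obtain B f1 where B: "B \<in> Fa" "f1 \<in> F" "f1 \<noteq> 0" "field_norm F Fa B = b * f1 ^ CARD('p)"
    "\<And>\<sigma>. \<sigma> \<in> G \<Longrightarrow> \<exists>I. \<forall>n\<in>auts Fa. kchar (\<sigma> B) n = (\<Sum>k\<in>I. x1 n k)"
    using cocycle_to_norm[OF a Fa refl b lc(2) x1 aug(1)] by blast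
  obtain C f2 where C: "C \<in> Fd" "f2 \<in> F" "f2 \<noteq> 0" "field_norm F Fd C = c * f2 ^ CARD('p)"
    "\<And>\<sigma>. \<sigma> \<in> G \<Longrightarrow> \<exists>I. \<forall>n\<in>auts Fd. kchar (\<sigma> C) n = (\<Sum>k\<in>I. x2 n k)"
    using cocycle_to_norm[OF d Fd refl c lc(3) x2 aug(2)] by blast
  have "symbol P \<zeta> Fad (\<rho> B) (\<rho>' C) = \<one>\<^bsub>H2_field P Fad\<^esub>"
    if r: "\<rho> \<in> carrier (gal_group F Fa)" "\<rho>' \<in> carrier (gal_group F Fd)" for \<rho> \<rho>'
  proof -
    obtain \<sigma> \<tau> where st: "\<sigma> \<in> G" "\<tau> \<in> G" "\<rho> B = \<sigma> B" "\<rho>' C = \<tau> C"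
      using r B(1) C(1) unfolding carrier_gal_group[OF normal_Fa[OF a Fa refl]] carrier_gal_group[OF normal_Fa[OF d Fd refl]] by auto
    obtain I where I: "\<And>n. n \<in> auts Fa \<Longrightarrow> kchar (\<sigma> B) n = (\<Sum>k\<in>I. x1 n k)" using B(5)[OF st(1)] by blast
    obtain J where J: "\<And>n. n \<in> auts Fd \<Longrightarrow> kchar (\<tau> C) n = (\<Sum>k\<in>J. x2 n k)" using C(5)[OF st(2)] by blast
    have N: "n \<in> G" "n \<in> auts Fa" "n \<in> auts Fd" "kchar a n = 0" "kchar d n = 0" if "n \<in> auts Fad" for n
      using that unfolding auts_Fad auts_Fa[OF a Fa refl] auts_Fa[OF d Fd refl] by auto
    \<comment> \<open>The two characters are sums of coordinates over \<open>I\<close> and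
      \<open>J\<close>; by bilinearity the sum of \<open>u\<close> over \<open>I \<times> J\<close>
      trivialises their cup product.\<close>
    let ?v = "\<lambda>n. \<Sum>(k, l)\<in>I \<times> J. u n (k, l)"
    have "locally_const (auts Fad) S ?v"
      by (rule locally_const_mono[OF locally_const_compose[OF lc(1)]]) (use N(1) in blast)
    moreover have "?v (n \<circ> n') = ?v n + ?v n' + kchar (\<sigma> B) n * kchar (\<tau> C) n'"
      if n: "n \<in> auts Fad" "n' \<in> auts Fad" for n n'
    proof -
      have "?v (n \<circ> n') = (\<Sum>(k, l)\<in>I \<times> J. u n (k, l) + u n' (k, l) + x1 n k * x2 n' l)"
        by (rule sum.cong) (auto simp: u[OF N(1)[OF n(1)] N(1)[OF n(2)]] N(4,5)[OF n(1)])
      also have "\<dots> = ?v n + ?v n' + (\<Sum>(k, l)\<in>I \<times> J. x1 n k * x2 n' l)"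
        by (simp add: split_beta sum.distrib)
      also have "(\<Sum>(k, l)\<in>I \<times> J. x1 n k * x2 n' l) = kchar (\<sigma> B) n * kchar (\<tau> C) n'"
        unfolding I[OF N(2)[OF n(1)]] J[OF N(3)[OF n(2)]] sum_product by (rule sum.cartesian_product[symmetric])
      finally show ?thesis .
    qed
    ultimately have "\<exists>v. locally_const (auts Fad) S v \<and>
      (\<forall>n\<in>auts Fad. \<forall>n'\<in>auts Fad. v (n \<circ> n') = v n + v n' + kchar (\<sigma> B) n * kchar (\<tau> C) n')" by blast
    moreover have "\<sigma> B \<in> S" "\<tau> C \<in> S"
      using st(1,2) B(1) C(1) Fa_sub_S[OF a Fa refl] Fa_sub_S[OF d Fd refl] sep_closure_stable by blast+
    ultimately show ?thesis unfolding st(3,4) by (simp add: symbol_Fad_iff)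
  qed
  thus ?R using B(1-4) C(1-4) by blast
next
  assume ?R
  then obtain B C f1 f2 where B: "B \<in> Fa" "f1 \<in> F" "f1 \<noteq> 0" "field_norm F Fa B = b * f1 ^ CARD('p)"
    and C: "C \<in> Fd" "f2 \<in> F" "f2 \<noteq> 0" "field_norm F Fd C = c * f2 ^ CARD('p)"
    and sym: "\<And>\<sigma> \<tau>. \<sigma> \<in> carrier (gal_group F Fa) \<Longrightarrow> \<tau> \<in> carrier (gal_group F Fd) \<Longrightarrow>
          symbol P \<zeta> Fad (\<sigma> B) (\<tau> C) = \<one>\<^bsub>H2_field P Fad\<^esub>" by blast
  obtain x1 where x1: "locally_const G S x1"
    "\<And>\<sigma> \<tau> k. \<sigma> \<in> G \<Longrightarrow> \<tau> \<in> G \<Longrightarrow> x1 (\<sigma> \<circ> \<tau>) k = x1 \<sigma> k + x1 \<tau> (k - kchar a \<sigma>)"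
    "\<And>\<sigma>. \<sigma> \<in> G \<Longrightarrow> (\<Sum>k\<in>UNIV. x1 \<sigma> k) = kchar b \<sigma>"
    "\<And>k. (\<exists>\<sigma>\<in>G. \<forall>n\<in>auts Fa. x1 n k = kchar (\<sigma> B) n) \<or> (\<forall>n\<in>auts Fa. x1 n k = 0)"
    using norm_to_cocycle[OF a Fa refl b B] by blast
  obtain x2 where x2: "locally_const G S x2"
    "\<And>\<sigma> \<tau> k. \<sigma> \<in> G \<Longrightarrow> \<tau> \<in> G \<Longrightarrow> x2 (\<sigma> \<circ> \<tau>) k = x2 \<sigma> k + x2 \<tau> (k - kchar d \<sigma>)"
    "\<And>\<sigma>. \<sigma> \<in> G \<Longrightarrow> (\<Sum>k\<in>UNIV. x2 \<sigma> k) = kchar c \<sigma>"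
    "\<And>k. (\<exists>\<sigma>\<in>G. \<forall>n\<in>auts Fd. x2 n k = kchar (\<sigma> C) n) \<or> (\<forall>n\<in>auts Fd. x2 n k = 0)"
    using norm_to_cocycle[OF d Fd refl c C] by blast
  \<comment> \<open>\<open>H\<close> combines both shifts into one translation action on F_p x F_p,
    so R \<otimes> R becomes a module of functions as in \<open>shapiro2\<close>, and
    \<open>e\<close> is the cup product with values in it.\<close>
  define H where "H \<sigma> = (kchar a \<sigma>, kchar d \<sigma>)" for \<sigma>
  define e where "e \<sigma> \<tau> m = x1 \<sigma> (fst m) * x2 \<tau> (snd m - kchar d \<sigma>)" for \<sigma> \<tau> m
  have N: "{\<sigma> \<in> G. H \<sigma> = 0} = auts Fad" unfolding auts_Fad H_def zero_prod_def by simp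
  have lcH: "locally_const G S H"
    unfolding H_def by (rule locally_const_compose2[OF h_locally_const[OF a Fa refl] h_locally_const[OF d Fd refl]])
  have H_comp: "H (\<sigma> \<circ> \<tau>) = H \<sigma> + H \<tau>" if "\<sigma> \<in> G" "\<tau> \<in> G" for \<sigma> \<tau>
    using that by (simp add: H_def kchar_hom[OF a] kchar_hom[OF d])
  have lce: "locally_const G S (\<lambda>\<sigma>. e \<sigma> \<tau> m)" for \<tau> m
    unfolding e_def
    by (rule locally_const_compose2[OF x1(1) h_locally_const[OF d Fd refl], of "\<lambda>y z. y (fst m) * x2 \<tau> (snd m - z)"])
  have lce': "locally_const G S (\<lambda>\<tau>. e \<sigma> \<tau> m)" for \<sigma> m
    unfolding e_def by (rule locally_const_compose[OF x2(1), of "\<lambda>y. x1 \<sigma> (fst m) * y (snd m - kchar d \<sigma>)"])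
  have cocycle: "e \<sigma> \<tau> m + e (\<sigma> \<circ> \<tau>) \<rho> m = e \<tau> \<rho> (m - H \<sigma>) + e \<sigma> (\<tau> \<circ> \<rho>) m"
    if "\<sigma> \<in> G" "\<tau> \<in> G" "\<rho> \<in> G" for \<sigma> \<tau> \<rho> m
    using that by (simp add: e_def H_def x1(2) x2(2) kchar_hom[OF d] algebra_simps)
  have triv: "\<exists>v. locally_const {\<sigma> \<in> G. H \<sigma> = 0} S v \<and>
      (\<forall>n\<in>{\<sigma> \<in> G. H \<sigma> = 0}. \<forall>n'\<in>{\<sigma> \<in> G. H \<sigma> = 0}. v (n \<circ> n') = v n + v n' + e n n' m)" for m
    unfolding N
  proof -
    have Nd: "n \<in> auts Fa" "n \<in> auts Fd" "kchar d n = 0" if "n \<in> auts Fad" for n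
      using that unfolding auts_Fad auts_Fa[OF a Fa refl] auts_Fa[OF d Fd refl] by auto
    show "\<exists>v. locally_const (auts Fad) S v \<and> (\<forall>n\<in>auts Fad. \<forall>n'\<in>auts Fad. v (n \<circ> n') = v n + v n' + e n n' m)"
    \<comment> \<open>The first case covers the entries 1 in the families of \<open>B\<close> and
      \<open>C\<close>. Any other point (k, l) belongs to one conjugate of each, a pair that the
      condition for all \<sigma> and \<tau> includes.\<close>
    proof (cases "(\<forall>n\<in>auts Fa. x1 n (fst m) = 0) \<or> (\<forall>n\<in>auts Fd. x2 n (snd m) = 0)")
      case True
      hence "e n n' m = 0" if "n \<in> auts Fad" "n' \<in> auts Fad" for n n'
        using Nd that by (auto simp: e_def)
      thus ?thesis by (intro exI[of _ "\<lambda>_. 0"]) (simp add: locally_const_const)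
    next
      case False
      then obtain \<sigma> \<tau> where st: "\<sigma> \<in> G" "\<tau> \<in> G" "\<And>n. n \<in> auts Fa \<Longrightarrow> x1 n (fst m) = kchar (\<sigma> B) n"
        "\<And>n. n \<in> auts Fd \<Longrightarrow> x2 n (snd m) = kchar (\<tau> C) n"
        using x1(4)[of "fst m"] x2(4)[of "snd m"] by blast
      have S: "\<sigma> B \<in> S" "\<tau> C \<in> S"
        using st(1,2) B(1) C(1) Fa_sub_S[OF a Fa refl] Fa_sub_S[OF d Fd refl] sep_closure_stable by blast+
      have "restrict \<sigma> Fa \<in> carrier (gal_group F Fa)" "restrict \<tau> Fd \<in> carrier (gal_group F Fd)"
        unfolding carrier_gal_group[OF normal_Fa[OF a Fa refl]] carrier_gal_group[OF normal_Fa[OF d Fd refl]]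
        using st(1,2) by blast+
      from sym[OF this] have "symbol P \<zeta> Fad (\<sigma> B) (\<tau> C) = \<one>\<^bsub>H2_field P Fad\<^esub>" using B(1) C(1) by simp
      then obtain v where v: "locally_const (auts Fad) S v"
        "\<forall>n\<in>auts Fad. \<forall>n'\<in>auts Fad. v (n \<circ> n') = v n + v n' + kchar (\<sigma> B) n * kchar (\<tau> C) n'"
        unfolding symbol_Fad_iff[OF S] by blast
      moreover have "e n n' m = kchar (\<sigma> B) n * kchar (\<tau> C) n'" if "n \<in> auts Fad" "n' \<in> auts Fad" for n n'
        using st(3) st(4) Nd that by (simp add: e_def)
      ultimately show ?thesis by (intro exI[of _ v]) simp
    qed
  qed
  have "\<exists>u. locally_const G S u \<and> (\<forall>\<sigma>\<in>G. \<forall>\<tau>\<in>G. \<forall>m. u (\<sigma> \<circ> \<tau>) m = u \<sigma> m + u \<tau> (m - H \<sigma>) + e \<sigma> \<tau> m)"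
  proof (rule shapiro2[of H e])
    show "locally_const G S H" by (rule lcH)
    show "H (\<sigma> \<circ> \<tau>) = H \<sigma> + H \<tau>" if "\<sigma> \<in> G" "\<tau> \<in> G" for \<sigma> \<tau> by (rule H_comp[OF that])
    show "locally_const G S (\<lambda>\<sigma>. e \<sigma> \<tau> m)" for \<tau> m by (rule lce)
    show "locally_const G S (\<lambda>\<tau>. e \<sigma> \<tau> m)" for \<sigma> m by (rule lce')
    show "e \<sigma> \<tau> m + e (\<sigma> \<circ> \<tau>) \<rho> m = e \<tau> \<rho> (m - H \<sigma>) + e \<sigma> (\<tau> \<circ> \<rho>) m"
      if "\<sigma> \<in> G" "\<tau> \<in> G" "\<rho> \<in> G" for \<sigma> \<tau> \<rho> m by (rule cocycle[OF that])
    show "\<exists>v. locally_const {\<sigma> \<in> G. H \<sigma> = 0} S v \<and>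
      (\<forall>n\<in>{\<sigma> \<in> G. H \<sigma> = 0}. \<forall>n'\<in>{\<sigma> \<in> G. H \<sigma> = 0}. v (n \<circ> n') = v n + v n' + e n n' m)" for m by (rule triv)
  qed blast
  then obtain u where u: "locally_const G S u"
    "\<And>\<sigma> \<tau> m. \<sigma> \<in> G \<Longrightarrow> \<tau> \<in> G \<Longrightarrow> u (\<sigma> \<circ> \<tau>) m = u \<sigma> m + u \<tau> (m - H \<sigma>) + e \<sigma> \<tau> m" by blast
  have "U5_lift G S (kchar a) (kchar b) (kchar c) (kchar d) u x1 x2"
    unfolding U5_lift_def R_aug_def using u x1(1-3) x2(1-3) by (simp add: e_def H_def)
  thus ?L by blast
qed

end
end

section \<open>The theorem\<close>

lemma alg_over_range_to_ac: "alg_over (range (to_ac :: 'a::field \<Rightarrow> 'a alg_closure))"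
proof
  show "is_subfield (range (to_ac :: 'a \<Rightarrow> 'a alg_closure))"
    unfolding is_subfield_def by (auto simp flip: to_ac_0 to_ac_1 to_ac_add to_ac_mult to_ac_minus to_ac_inverse)
  fix x :: "'a alg_closure"
  obtain q :: "'a poly" where q: "q \<noteq> 0" "poly (map_poly to_ac q) x = 0" by (rule alg_closure_algebraic)
  have "map_poly to_ac q \<noteq> (0 :: 'a alg_closure poly)"
    using q(1) by (simp add: map_poly_eq_0_iff)
  thus "\<exists>q. q \<noteq> 0 \<and> poly_over (range to_ac) q \<and> poly q x = 0"
    using q(2) by (intro exI[of _ "map_poly to_ac q"]) (simp add: poly_over_def coeff_map_poly)
qed

lemma lifts_iff_norm_symbol:
  fixes \<zeta> a b c d :: "'a::field"
  assumes "primitive_root CARD('p::prime_card) \<zeta>" "a \<noteq> 0" "b \<noteq> 0" "c \<noteq> 0" "d \<noteq> 0"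
  shows "lifts_to_U5 TYPE('p) \<zeta> a b c d \<longleftrightarrow> norm_symbol_condition TYPE('p) \<zeta> a b c d"
proof -
  let ?F = "range (to_ac :: 'a \<Rightarrow> 'a alg_closure)"
  have "primitive_root CARD('p) (to_ac \<zeta>)"
    using assms(1) unfolding primitive_root_def by (simp flip: to_ac_power to_ac_1)
  then interpret kummer ?F "to_ac \<zeta>" "TYPE('p)"
    using alg_over_range_to_ac by (simp add: kummer_def kummer_axioms_def)
  have nz: "to_ac a \<in> ?F" "to_ac a \<noteq> 0" "to_ac b \<in> ?F" "to_ac b \<noteq> 0" "to_ac c \<in> ?F" "to_ac c \<noteq> 0"
    "to_ac d \<in> ?F" "to_ac d \<noteq> 0" using assms by simp_all
  \<comment> \<open>The f1 and f2 of the assertion live in the original field, those of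
    \<open>U5_lift_iff_symbols\<close> in its copy inside the closure.\<close>
  have ex: "(\<exists>f\<in>?F. f \<noteq> 0 \<and> y = to_ac e * f ^ n) \<longleftrightarrow> (\<exists>f. f \<noteq> 0 \<and> y = to_ac (e * f ^ n))" for y e n
    by simp
  show ?thesis
    unfolding lifts_to_U5_def norm_symbol_condition_def Let_def
      lifts_iff[OF nz(1-3,5,7,8)] U5_lift_iff_symbols[OF nz refl refl refl] ex ..
qed

theorem theorem7p5:
  fixes p :: nat and \<zeta> a b c d :: "'a::field"
  assumes "p = CARD('p::prime_card)"
    and "primitive_root p \<zeta>"
    and "a \<noteq> 0" and "b \<noteq> 0" and "c \<noteq> 0" and "d \<noteq> 0"
  shows "(lifts_to_U5 TYPE('p) \<zeta> a b c d \<longrightarrow> norm_symbol_condition TYPE('p) \<zeta> a b c d) \<and>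
    (p = 2 \<or> ((indep_classes p a b \<or> (\<exists>f. a = f ^ p)) \<and> (indep_classes p d c \<or> (\<exists>f. d = f ^ p)))
       \<longrightarrow> norm_symbol_condition TYPE('p) \<zeta> a b c d \<longrightarrow> lifts_to_U5 TYPE('p) \<zeta> a b c d)"
  using lifts_iff_norm_symbol[where 'p = 'p, of \<zeta> a b c d] assms by simp

end
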